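(* Let $\mathcal{V}$ be an affine subspace of $\mathrm{M}_n(\mathbb{R})$ included in $\mathrm{GL}_n(\mathbb{R})$ with dimension $\binom{n}{2}$. Then there is a unique list $(n_1,\dots,n_p)$ of positive integers such that $n=n_1+\cdots+n_p$ and $$\mathcal{V}\sim I_n+\bigl(\mathrm{A}_{n_1}(\mathbb{R})\vee\cdots\vee \mathrm{A}_{n_p}(\mathbb{R})\bigr).$$
   Context: $\mathrm{M}_n(\mathbb{R})$ is the algebra of real $n\times n$ matrices, $I_n$ is the identity matrix, and $\mathrm{A}_n(\mathbb{R})$ is the space of skew-symmetric real $n\times n$ matrices. An affine subspace of $\mathrm{M}_n(\mathbb{R})$ is a translate of a linear subspace. Two affine subspaces $\mathcal{V},\mathcal{W}$ of $\mathrm{M}_n(\mathbb{R})$ are equivalent, written $\mathcal{V}\sim\mathcal{W}$, if $\mathcal{W}=R\mathcal{V}S$ for some $(R,S)\in\mathrm{GL}_n(\mathbb{R})^2$. For subsets $V\subset \mathrm{M}_n(\mathbb{R})$ and $W\subset \mathrm{M}_p(\mathbb{R})$, $V\vee W:=\left\{\begin{bmatrix}A&B\\0&C\end{bmatrix} \mid A\in V,\ B\in \mathrm{M}_{n,p}(\mathbb{R}),\ C\in W\right\}\subset \mathrm{M}_{n+p}(\mathbb{R})$, where $\mathrm{M}_{n,p}(\mathbb{R})$ is the space of $n\times p$ matrices; the operation $\vee$ is associative. *)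

theory Defs
  imports "Jordan_Normal_Form.VS_Connect"
begin

definition GL :: "nat \<Rightarrow> real mat set" where
  "GL n = {A \<in> carrier_mat n n. invertible_mat A}"

definition skew_mats :: "nat \<Rightarrow> real mat set" where
  "skew_mats n = {A \<in> carrier_mat n n. transpose_mat A = - A}"

definition translate_mat :: "real mat \<Rightarrow> real mat set \<Rightarrow> real mat set" where
  "translate_mat P W = {P + M |M. M \<in> W}"

definition affine_subspace_mat :: "nat \<Rightarrow> real mat set \<Rightarrow> bool" where
  "affine_subspace_mat n V \<longleftrightarrow>
     (\<exists>P W. P \<in> carrier_mat n n \<and>
            VectorSpace.subspace class_ring W (module_mat TYPE(real) n n) \<and>
            V = translate_mat P W)"

definition direction_mat :: "real mat set \<Rightarrow> real mat set" where
  "direction_mat V = {A - B |A B. A \<in> V \<and> B \<in> V}"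

definition affine_dim_mat :: "nat \<Rightarrow> real mat set \<Rightarrow> nat" where
  "affine_dim_mat n V =
     vectorspace.dim class_ring ((module_mat TYPE(real) n n)\<lparr>carrier := direction_mat V\<rparr>)"

definition equiv_mats :: "nat \<Rightarrow> real mat set \<Rightarrow> real mat set \<Rightarrow> bool" where
  "equiv_mats n V W \<longleftrightarrow> (\<exists>R \<in> GL n. \<exists>S \<in> GL n. W = {R * M * S |M. M \<in> V})"

definition join_mats :: "nat \<Rightarrow> nat \<Rightarrow> real mat set \<Rightarrow> real mat set \<Rightarrow> real mat set" where
  "join_mats n p V W =
     {four_block_mat A B (0\<^sub>m p n) C |A B C. A \<in> V \<and> B \<in> carrier_mat n p \<and> C \<in> W}"

text \<open>The join of the spaces of skew-symmetric matrices of sizes \<open>n\<^sub>1, \<dots>, n\<^sub>p\<close>, bracketed to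
  the right. The empty join consists of the \<open>0 \<times> 0\<close> matrix, which is neutral for the join.\<close>

fun skew_join :: "nat list \<Rightarrow> real mat set" where
  "skew_join [] = carrier_mat 0 0"
| "skew_join (m # ms) = join_mats m (sum_list ms) (skew_mats m) (skew_join ms)"

lemma skew_join_singleton: "skew_join [m] = skew_mats m"
proof -
  have *: "four_block_mat A B (0\<^sub>m 0 m) C = A"
    if "A \<in> carrier_mat m m" "B \<in> carrier_mat m 0" "C \<in> carrier_mat 0 0" for A B C :: "real mat"
    using that by (intro eq_matI) auto
  have "A \<in> skew_join [m]" if "A \<in> skew_mats m" for A
  proof -
    have "four_block_mat A (0\<^sub>m m 0) (0\<^sub>m 0 m) (0\<^sub>m 0 0) = A"
      using that by (intro *) (auto simp: skew_mats_def)
    moreover have "0\<^sub>m 0 0 \<in> skew_join []" "0\<^sub>m m 0 \<in> carrier_mat m (sum_list [])" by simp_all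
    ultimately show ?thesis using that
      unfolding skew_join.simps(2) join_mats_def sum_list.Nil mem_Collect_eq by metis
  qed
  moreover have "A \<in> skew_mats m" if "A \<in> skew_join [m]" for A
    using that * unfolding skew_join.simps join_mats_def skew_mats_def by auto
  ultimately show ?thesis by blast
qed

lemma skew_join_carrier: "skew_join ns \<subseteq> carrier_mat (sum_list ns) (sum_list ns)"
proof (induction ns)
  case (Cons m ms)
  then show ?case
    by (auto simp: join_mats_def skew_mats_def intro!: four_block_carrier_mat)
qed auto

lemma join_mats_assoc:
  assumes "U \<subseteq> carrier_mat a a" "V \<subseteq> carrier_mat b b" "W \<subseteq> carrier_mat c c"
  shows "join_mats (a + b) c (join_mats a b U V) W = join_mats a (b + c) U (join_mats b c V W)"
    (is "?L = ?R")
proof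
  show "?L \<subseteq> ?R"
  proof
    fix X assume "X \<in> ?L"
    then obtain A B C D E where X: "X = four_block_mat (four_block_mat A B (0\<^sub>m b a) C) D (0\<^sub>m c (a + b)) E"
      and m: "A \<in> U" "B \<in> carrier_mat a b" "C \<in> V" "D \<in> carrier_mat (a + b) c" "E \<in> W"
      unfolding join_mats_def by blast
    define D1 where "D1 = mat a c (\<lambda>(i,j). D $$ (i,j))"
    define D2 where "D2 = mat b c (\<lambda>(i,j). D $$ (i + a,j))"
    define B' where "B' = mat a (b + c) (\<lambda>(i,j). if j < b then B $$ (i,j) else D1 $$ (i,j - b))"
    have car: "A \<in> carrier_mat a a" "C \<in> carrier_mat b b" "E \<in> carrier_mat c c"
      using assms m by auto
    have D2: "D2 \<in> carrier_mat b c" by (simp add: D2_def)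
    have "X = four_block_mat A B' (0\<^sub>m (b + c) a) (four_block_mat C D2 (0\<^sub>m c b) E)"
      using car m(2,4) unfolding X
      by (intro eq_matI) (auto simp: B'_def D1_def D2_def)
    moreover have "four_block_mat C D2 (0\<^sub>m c b) E \<in> join_mats b c V W"
      using m(3,5) D2 unfolding join_mats_def by blast
    moreover have "B' \<in> carrier_mat a (b + c)" by (simp add: B'_def)
    ultimately show "X \<in> ?R" using m(1) unfolding join_mats_def[of a "b + c"] by blast
  qed
  show "?R \<subseteq> ?L"
  proof
    fix X assume "X \<in> ?R"
    then obtain A B C D E where X: "X = four_block_mat A B (0\<^sub>m (b + c) a) (four_block_mat C D (0\<^sub>m c b) E)"
      and m: "A \<in> U" "B \<in> carrier_mat a (b + c)" "C \<in> V" "D \<in> carrier_mat b c" "E \<in> W"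
      unfolding join_mats_def by blast
    define B1 where "B1 = mat a b (\<lambda>(i,j). B $$ (i,j))"
    define D' where "D' = mat (a + b) c (\<lambda>(i,j). if i < a then B $$ (i,j + b) else D $$ (i - a,j))"
    have car: "A \<in> carrier_mat a a" "C \<in> carrier_mat b b" "E \<in> carrier_mat c c"
      using assms m by auto
    have B1: "B1 \<in> carrier_mat a b" by (simp add: B1_def)
    have "X = four_block_mat (four_block_mat A B1 (0\<^sub>m b a) C) D' (0\<^sub>m c (a + b)) E"
      using car m(2,4) unfolding X
      by (intro eq_matI) (auto simp: B1_def D'_def)
    moreover have "four_block_mat A B1 (0\<^sub>m b a) C \<in> join_mats a b U V"
      using m(1,3) B1 unfolding join_mats_def by blast
    moreover have "D' \<in> carrier_mat (a + b) c" by (simp add: D'_def)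
    ultimately show "X \<in> ?L" using m(5) unfolding join_mats_def[of "a + b" c] by blast
  qed
qed

lemma direction_translate_mat:
  assumes P: "P \<in> carrier_mat n n"
    and W: "VectorSpace.subspace class_ring W (module_mat TYPE(real) n n)"
  shows "direction_mat (translate_mat P W) = W"
proof -
  interpret vectorspace class_ring "module_mat TYPE(real) n n" by (rule matrix_vs)
  have sub: "submodule class_ring W (module_mat TYPE(real) n n)"
    using W by (rule VectorSpace.subspace.submod)
  have c: "W \<subseteq> carrier_mat n n" and z: "0\<^sub>m n n \<in> W"
    and add: "\<And>A B. A \<in> W \<Longrightarrow> B \<in> W \<Longrightarrow> A + B \<in> W"
    and sm: "\<And>r A. A \<in> W \<Longrightarrow> r \<cdot>\<^sub>m A \<in> W"
    using sub unfolding submodule_def by (auto simp: module_mat_simps class_ring_simps)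
  have diff: "(P + A) - (P + B) = A + (-1) \<cdot>\<^sub>m B" if "A \<in> W" "B \<in> W" for A B
  proof -
    have "A \<in> carrier_mat n n" "B \<in> carrier_mat n n" using that c by auto
    then show ?thesis using P by (intro eq_matI) auto
  qed
  have "direction_mat (translate_mat P W) = {A + (-1) \<cdot>\<^sub>m B |A B. A \<in> W \<and> B \<in> W}"
    
  proof -
    have "direction_mat (translate_mat P W) = {(P + A) - (P + B) |A B. A \<in> W \<and> B \<in> W}"
      unfolding direction_mat_def translate_mat_def by blast
    also have "\<dots> = {A + (-1) \<cdot>\<^sub>m B |A B. A \<in> W \<and> B \<in> W}"
      by (intro Collect_cong) (use diff in metis)
    finally show ?thesis .
  qed
  also have "\<dots> = W"
  proof
    show "{A + (-1) \<cdot>\<^sub>m B |A B. A \<in> W \<and> B \<in> W} \<subseteq> W" using add sm by blast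
    show "W \<subseteq> {A + (-1) \<cdot>\<^sub>m B |A B. A \<in> W \<and> B \<in> W}"
    proof
      fix A assume A: "A \<in> W"
      have "A = A + (-1) \<cdot>\<^sub>m (0\<^sub>m n n)" using A c by (intro eq_matI) auto
      then show "A \<in> {A + (-1) \<cdot>\<^sub>m B |A B. A \<in> W \<and> B \<in> W}" using A z by blast
    qed
  qed
  finally show ?thesis .
qed

end

theory Submission
  imports Defs "HOL-Analysis.Linear_Algebra" "HOL-Library.Function_Algebras"
    "HOL-Library.Set_Algebras" "HOL-Library.Quadratic_Discriminant"
begin

text \<open>
  Multiplying by the inverse of an element of \<open>V\<close> turns \<open>V\<close> into \<open>I + W\<close> for a linear space \<open>W\<close>
  of operators on \<open>E = \<real>\<^sup>n\<close> none of which has a nonzero fixed vector; we call this a trivial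
  spectrum.

  A vector \<open>x \<noteq> 0\<close> is adapted if \<open>W\<close> contains no rank one operator with image \<open>\<real> x\<close>. Adapted
  vectors exist, \<open>W x\<close> has dimension at most \<open>n - 1\<close>, and the annihilator \<open>W\<^sub>x = {M \<in> W.
  M x = 0}\<close> acts faithfully and with trivial spectrum on \<open>E / \<real> x\<close>; so \<open>dim W \<le> n choose 2\<close> by
  induction. If equality holds, then \<open>W x\<close> is a hyperplane \<open>H\<close> with \<open>x \<notin> H\<close>, every element of
  \<open>W\<^sub>x\<close> has its image in \<open>H\<close>, and \<open>W\<^sub>x\<close> is a trivial spectrum space of maximal dimension on \<open>H\<close>.
  By induction one of two things happens. Either \<open>W\<^sub>x\<close> leaves a proper nonzero subspace of \<open>H\<close>
  invariant, and then so does \<open>W\<close>; or \<open>W\<^sub>x\<close> consists of the operators that are skew for a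
  definite bilinear form on \<open>H\<close>, and then either \<open>W\<close> leaves \<open>H\<close> invariant or the form extends to
  a definite form on \<open>E\<close> for which \<open>W\<close> consists of the skew operators. In the reducible cases
  counting dimensions shows that \<open>W\<close> is the full join of the spaces that it induces on the
  invariant subspace and on the quotient, both of maximal dimension.

  For uniqueness, the set of dimensions of \<open>W x\<close> with \<open>x \<noteq> 0\<close> is invariant under equivalence,
  and for the join of sizes \<open>n\<^sub>1, \<dots>, n\<^sub>p\<close> it consists of the numbers \<open>n\<^sub>1 + \<dots> + n\<^sub>k - 1\<close>.
\<close>

instantiation "fun" :: (type, real_vector) real_vector
begin
definition scaleR_fun :: "real \<Rightarrow> ('a \<Rightarrow> 'b) \<Rightarrow> 'a \<Rightarrow> 'b"
  where "scaleR_fun c f = (\<lambda>x. c *\<^sub>R f x)"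
instance
  by standard (simp_all add: scaleR_fun_def fun_eq_iff algebra_simps)
end

lemma scaleR_fun_apply [simp]: "(c *\<^sub>R f) x = c *\<^sub>R f x"
  by (simp add: scaleR_fun_def)

lemma sum_fun_apply: "(\<Sum>i\<in>I. f i) x = (\<Sum>i\<in>I. f i x)"
  by (induction I rule: infinite_finite_induct) auto

lemma linear_eval: "linear (\<lambda>f. f x)"
  by (rule linearI) auto

lemmas linear_map_simps = linear_add linear_diff linear_scale linear_0

section \<open>Finite-dimensional subspaces\<close>

text \<open>The theory of matrices as vector spaces hides the name of the predicate for real vector
  spaces.\<close>

abbreviation lin_subspace :: "'a::real_vector set \<Rightarrow> bool" where
  "lin_subspace \<equiv> Real_Vector_Spaces.subspace"

definition fin_dim :: "'a::real_vector set \<Rightarrow> bool" where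
  "fin_dim S \<longleftrightarrow> (\<exists>B. finite B \<and> span B = S)"

lemma fin_dim_span: "finite B \<Longrightarrow> fin_dim (span B)"
  unfolding fin_dim_def by blast

lemma fin_dim_imp_subspace: "fin_dim S \<Longrightarrow> lin_subspace S"
  unfolding fin_dim_def by auto

lemma subspace_kernel_in:
  assumes "linear f" "lin_subspace S"
  shows "lin_subspace {x \<in> S. f x = 0}"
  using real_vector.subspace_inter[OF assms(2) real_vector.linear_subspace_kernel[OF assms(1)]]
  by (simp add: Collect_conj_eq)

lemma fin_dim_basis:
  assumes "fin_dim S"
  obtains B where "finite B" "independent B" "span B = S" "card B = dim S"
proof -
  obtain F where F: "finite F" "span F = S" using assms unfolding fin_dim_def by blast
  obtain B where B: "B \<subseteq> S" "independent B" "S \<subseteq> span B" "card B = dim S"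
    using real_vector.basis_exists by blast
  have "finite B" using real_vector.independent_span_bound[OF F(1) B(2)] B(1) F(2) by blast
  moreover have "span B = S"
    using real_vector.span_subspace[OF B(1,3) fin_dim_imp_subspace[OF assms]] .
  ultimately show ?thesis using that B by blast
qed

lemma fin_dim_subset:
  assumes "fin_dim S" "lin_subspace T" "T \<subseteq> S"
  shows "fin_dim T" and dim_le_fin_dim: "dim T \<le> dim S"
proof -
  obtain F where F: "finite F" "span F = S" "card F = dim S" using assms(1) by (rule fin_dim_basis)
  obtain B where B: "B \<subseteq> T" "independent B" "T \<subseteq> span B" "card B = dim T"
    using real_vector.basis_exists by blast
  have bound: "finite B \<and> card B \<le> card F"
    using real_vector.independent_span_bound[OF F(1) B(2)] B(1) F(2) assms(3) by blast
  have "span B = T" using real_vector.span_subspace[OF B(1,3) assms(2)] .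
  then show "fin_dim T" "dim T \<le> dim S" using bound B(4) F(3) unfolding fin_dim_def by auto
qed

lemma fin_dim_kernel:
  assumes "linear f" "fin_dim S"
  shows "fin_dim {x \<in> S. f x = 0}"
  using subspace_kernel_in[OF assms(1) fin_dim_imp_subspace[OF assms(2)]]
  by (rule fin_dim_subset(1)[OF assms(2)]) blast

lemma fin_dim_subspace_equal:
  assumes "fin_dim S" "lin_subspace T" "T \<subseteq> S" "dim S \<le> dim T"
  shows "T = S"
proof (rule ccontr)
  assume "T \<noteq> S"
  then obtain x where x: "x \<in> S" "x \<notin> T" using assms(3) by blast
  obtain F where F: "finite F" "span F = S" "card F = dim S" using assms(1) by (rule fin_dim_basis)
  obtain B where B: "finite B" "independent B" "span B = T" "card B = dim T"
    using fin_dim_subset(1)[OF assms(1-3)] by (rule fin_dim_basis)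
  have "independent (insert x B)" using B x by (simp add: real_vector.independent_insertI)
  moreover have "insert x B \<subseteq> span F" using x F B(3) assms(3) real_vector.span_superset by blast
  ultimately have "card (insert x B) \<le> card F"
    using real_vector.independent_span_bound[OF F(1)] by blast
  moreover have "x \<notin> B" using x B(3) real_vector.span_superset by blast
  ultimately show False using B F assms(4) by simp
qed

lemma dim_zero: "dim {0::'a::real_vector} = 0"
  using real_vector.dim_le_card[of "{0::'a}" "{}"] by simp

lemma fin_dim_eq_zero_iff: "fin_dim S \<Longrightarrow> dim S = 0 \<longleftrightarrow> S = {0}"
  by (metis card_0_eq fin_dim_basis dim_zero real_vector.span_empty)

lemma fin_dim_image: "linear f \<Longrightarrow> fin_dim S \<Longrightarrow> fin_dim (f ` S)"
  unfolding fin_dim_def by (metis finite_imageI real_vector.linear_span_image)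

lemma dim_set_plus_le:
  assumes "fin_dim S" "fin_dim T"
  shows fin_dim_set_plus: "fin_dim (S + T)" and "dim (S + T) \<le> dim S + dim T"
proof -
  obtain B where B: "finite B" "span B = S" "card B = dim S" using assms(1) by (rule fin_dim_basis)
  obtain C where C: "finite C" "span C = T" "card C = dim T" using assms(2) by (rule fin_dim_basis)
  have sum: "S + T = span (B \<union> C)"
    unfolding real_vector.span_Un B(2) C(2) set_plus_def by blast
  show "fin_dim (S + T)" unfolding sum using B C by (simp add: fin_dim_span)
  have "dim (S + T) \<le> card (B \<union> C)" unfolding sum using B C by (intro real_vector.dim_le_card) auto
  also have "\<dots> \<le> dim S + dim T" using card_Un_le[of B C] B C by simp
  finally show "dim (S + T) \<le> dim S + dim T" .
qed

lemma independent_span_Int: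
  assumes "independent (A \<union> C)" "A \<inter> C = {}" "x \<in> span A" "x \<in> span C"
  shows "x = 0"
proof -
  obtain p :: "'a \<Rightarrow> 'a" where p: "linear p" "\<And>b. b \<in> A \<union> C \<Longrightarrow> p b = (if b \<in> A then b else 0)"
    using real_vector.linear_independent_extend[OF assms(1), of "\<lambda>b. if b \<in> A then b else 0"]
    by blast
  have "p x = x"
    by (rule real_vector.linear_eq_on[OF p(1) real_vector.linear_ident assms(3)]) (simp add: p(2))
  moreover have "p x = 0"
    using p(2) assms(2) by (intro real_vector.linear_eq_0_on_span[OF p(1) _ assms(4)]) auto
  ultimately show ?thesis by simp
qed

lemma fin_dim_adapted_basis:
  assumes S: "fin_dim S" and K: "lin_subspace K" "K \<subseteq> S"
  obtains A C where "finite A" "finite C" "A \<inter> C = {}" "independent (A \<union> C)"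
    "span A = K" "span (A \<union> C) = S"
proof -
  obtain A where A: "finite A" "independent A" "span A = K"
    using fin_dim_basis[OF fin_dim_subset(1)[OF S K]] by blast
  have "A \<subseteq> S" using A(3) K(2) real_vector.span_superset[of A] by blast
  then obtain B where B: "A \<subseteq> B" "B \<subseteq> S" "independent B" "S \<subseteq> span B"
    using real_vector.maximal_independent_subset_extend[OF _ A(2)] by metis
  obtain F where "finite F" "span F = S" using S unfolding fin_dim_def by blast
  then have "finite B" using real_vector.independent_span_bound[of F B] B(2,3) by blast
  moreover have "span B = S"
    using real_vector.span_subspace[OF B(2,4) fin_dim_imp_subspace[OF S]] .
  ultimately show ?thesis
    using that[of A "B - A"] A B(1,3) by (simp add: Un_absorb1)
qed

lemma rank_nullity:
  assumes f: "linear f" and S: "fin_dim S"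
  shows "dim S = dim (f ` S) + dim {x \<in> S. f x = 0}"
proof -
  have "lin_subspace {x \<in> S. f x = 0}"
    using f fin_dim_imp_subspace[OF S] by (rule subspace_kernel_in)
  then obtain A C where fin: "finite A" "finite C" and AC: "A \<inter> C = {}" "independent (A \<union> C)"
    and span: "span A = {x \<in> S. f x = 0}" "span (A \<union> C) = S"
    using fin_dim_adapted_basis[OF S] by blast
  have "x = 0" if "x \<in> span C" "f x = 0" for x
  proof -
    have "x \<in> span A" using that span real_vector.span_mono[of C "A \<union> C"] by auto
    then show ?thesis using independent_span_Int[OF AC(2,1)] that by blast
  qed
  then have inj: "inj_on f (span C)"
    using real_vector.linear_inj_on_iff_eq_0[OF f real_vector.subspace_span] by blast
  have "f ` A \<subseteq> {0}" using span(1) real_vector.span_superset[of A] by blast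
  then have "span (f ` A \<union> f ` C) = span (f ` C)"
    by (metis Un_commute Un_insert_right real_vector.span_insert_0 subset_singletonD sup_bot_right)
  then have "f ` S = span (f ` C)"
    by (simp add: span(2)[symmetric] real_vector.linear_span_image[OF f, symmetric] image_Un)
  moreover have "independent (f ` C)"
    using AC(2) inj real_vector.independent_mono
    by (intro real_vector.linear_independent_injective_image[OF f]) auto
  ultimately have "dim (f ` S) = card (f ` C)"
    using real_vector.dim_span_eq_card_independent by metis
  also have "\<dots> = card C"
    using inj real_vector.span_superset[of C] by (intro card_image) (rule inj_on_subset)
  finally have "dim (f ` S) = card C" .
  moreover have "dim S = card (A \<union> C)" "dim {x \<in> S. f x = 0} = card A"
    using span AC(2) real_vector.dim_span_eq_card_independent real_vector.independent_mono
    by (metis, metis Un_upper1)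
  ultimately show ?thesis using AC(1) fin by (simp add: card_Un_disjoint)
qed

lemma dim_image_inj:
  assumes "linear f" "fin_dim S" "\<And>x. x \<in> S \<Longrightarrow> f x = 0 \<Longrightarrow> x = 0"
  shows "dim (f ` S) = dim S"
proof -
  have "{x \<in> S. f x = 0} = {0}"
    using assms real_vector.subspace_0[OF fin_dim_imp_subspace[OF assms(2)]] linear_0[OF assms(1)]
    by auto
  then show ?thesis using rank_nullity[OF assms(1,2)] by (simp add: dim_zero)
qed

lemma inj_endomorphism_image_eq:
  assumes "linear f" "fin_dim S" "f ` S \<subseteq> S" "\<And>x. x \<in> S \<Longrightarrow> f x = 0 \<Longrightarrow> x = 0"
  shows "f ` S = S"
  using assms
  by (intro fin_dim_subspace_equal)
     (auto simp: dim_image_inj real_vector.linear_subspace_image fin_dim_imp_subspace)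

lemma dim_functional_kernel:
  fixes f :: "'a::real_vector \<Rightarrow> real"
  assumes "linear f" "fin_dim S" "z \<in> S" "f z \<noteq> 0"
  shows "dim S = Suc (dim {x \<in> S. f x = 0})"
proof -
  have "f ` S = UNIV"
  proof (intro equalityI subsetI)
    fix c :: real
    have "(c / f z) *\<^sub>R z \<in> S"
      using assms fin_dim_imp_subspace real_vector.subspace_scale by blast
    moreover have "f ((c / f z) *\<^sub>R z) = c" using assms by (simp add: linear_scale)
    ultimately show "c \<in> f ` S" by force
  qed simp
  then have "dim (f ` S) = 1" by simp
  then show ?thesis using rank_nullity[OF assms(1,2)] by simp
qed

lemma separating_functional:
  fixes x :: "'a::real_vector"
  assumes "lin_subspace S" "x \<notin> S"
  obtains \<phi> :: "'a \<Rightarrow> real" where "linear \<phi>" "\<phi> x = 1" "\<And>s. s \<in> S \<Longrightarrow> \<phi> s = 0"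
proof -
  obtain B where B: "B \<subseteq> S" "independent B" "S \<subseteq> span B"
    using real_vector.basis_exists[of S] by metis
  then have "x \<notin> span B" using real_vector.span_subspace[OF B(1,3) assms(1)] assms(2) by simp
  then have "independent (insert x B)" and xB: "x \<notin> B"
    using B(2) real_vector.independent_insertI real_vector.span_superset by blast+
  then obtain \<phi> :: "'a \<Rightarrow> real" where \<phi>: "linear \<phi>" "\<forall>b\<in>insert x B. \<phi> b = (if b = x then 1 else 0)"
    using real_vector.linear_independent_extend[of "insert x B" "\<lambda>b. if b = x then 1 else 0"]
    by blast
  have "\<phi> s = 0" if "s \<in> S" for s
    using \<phi>(2) xB by (intro real_vector.linear_eq_0_on_span[OF \<phi>(1) _ subsetD[OF B(3) that]]) auto
  then show ?thesis using that \<phi> by auto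
qed

lemma ex_common_nonzero:
  fixes f :: "'i \<Rightarrow> 'a::real_vector \<Rightarrow> real"
  assumes "finite I" "lin_subspace S" "\<And>i. i \<in> I \<Longrightarrow> linear (f i) \<and> (\<exists>z\<in>S. f i z \<noteq> 0)"
  shows "\<exists>x\<in>S. \<forall>i\<in>I. f i x \<noteq> 0"
  using assms(1,3)
proof (induction I)
  case empty
  then show ?case using real_vector.subspace_0[OF assms(2)] by blast
next
  case (insert j I)
  then obtain x z where x: "x \<in> S" "\<forall>i\<in>I. f i x \<noteq> 0" and z: "z \<in> S" "f j z \<noteq> 0" by blast
  have lin: "linear (f i)" if "i \<in> insert j I" for i using insert.prems that by blast
  show ?case
  proof (cases "f j x = 0")
    case True
    have "finite ((\<lambda>i. - (f i z / f i x)) ` I)" using insert.hyps by simp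
    then obtain t where t: "t \<notin> (\<lambda>i. - (f i z / f i x)) ` I"
      using ex_new_if_finite[OF infinite_UNIV_char_0] by blast
    have "f i (z + t *\<^sub>R x) \<noteq> 0" if "i \<in> insert j I" for i
    proof (cases "i = j")
      case True
      then show ?thesis using z \<open>f j x = 0\<close> lin[of j] by (simp add: linear_add linear_scale)
    next
      case False
      then have "i \<in> I" "f i x \<noteq> 0" using that x by auto
      then have "t \<noteq> - (f i z / f i x)" using t by blast
      then show ?thesis using \<open>f i x \<noteq> 0\<close> lin[OF that]
        by (simp add: linear_add linear_scale field_simps add_eq_0_iff)
    qed
    moreover have "z + t *\<^sub>R x \<in> S"
      using x z assms(2) by (simp add: real_vector.subspace_add real_vector.subspace_scale)
    ultimately show ?thesis by blast
  qed (use x in blast)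
qed

lemma finite_eigenvalues:
  fixes T :: "'a::real_vector \<Rightarrow> 'a"
  assumes T: "linear T" and "fin_dim S" "T ` S \<subseteq> S"
  shows "finite {s. \<exists>v\<in>S. v \<noteq> 0 \<and> T v = s *\<^sub>R v}"
  using assms(2,3)
proof (induction "dim S" arbitrary: S rule: less_induct)
  case less
  let ?spec = "\<lambda>S. {s. \<exists>v\<in>S. v \<noteq> 0 \<and> T v = s *\<^sub>R v}"
  show ?case
  proof (cases "?spec S = {}")
    case False
    then obtain r w where w: "w \<in> S" "w \<noteq> 0" "T w = r *\<^sub>R w" by blast
    define f where "f x = T x - r *\<^sub>R x" for x
    have f: "linear f" unfolding f_def
      by (rule linearI) (simp_all add: linear_map_simps[OF T] algebra_simps)
    have S: "lin_subspace S" using less.prems(1) by (rule fin_dim_imp_subspace)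
    have "w \<in> {x \<in> S. f x = 0}" using w by (simp add: f_def)
    then have "dim {x \<in> S. f x = 0} \<noteq> 0"
      using fin_dim_eq_zero_iff[OF fin_dim_kernel[OF f less.prems(1)]] w(2) by blast
    then have smaller: "dim (f ` S) < dim S" using rank_nullity[OF f less.prems(1)] by simp
    have "T (f x) = f (T x)" for x by (simp add: f_def linear_map_simps[OF T])
    then have "T ` f ` S \<subseteq> f ` S" using less.prems(2) by fastforce
    then have "finite (?spec (f ` S))"
      using less.hyps[OF smaller fin_dim_image[OF f less.prems(1)]] by blast
    moreover have "?spec S \<subseteq> insert r (?spec (f ` S))"
    proof
      fix s assume "s \<in> ?spec S"
      then obtain v where v: "v \<in> S" "v \<noteq> 0" "T v = s *\<^sub>R v" by blast
      have "f v = (s - r) *\<^sub>R v" using v by (simp add: f_def algebra_simps)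
      then have "s \<noteq> r \<Longrightarrow> v = f ((1 / (s - r)) *\<^sub>R v)" by (simp add: linear_scale[OF f])
      moreover have "(1 / (s - r)) *\<^sub>R v \<in> S" using v S real_vector.subspace_scale by blast
      ultimately show "s \<in> insert r (?spec (f ` S))" using v by blast
    qed
    ultimately show ?thesis using finite_subset by blast
  next
    case True
    then show ?thesis by (metis finite.emptyI)
  qed
qed

lemma ex_small_perturbation_surj:
  fixes T :: "'a::real_vector \<Rightarrow> 'a"
  assumes T: "linear T" and S: "fin_dim S" and TS: "T ` S \<subseteq> S"
  obtains t where "t \<noteq> 0" "(\<lambda>x. x + t *\<^sub>R T x) ` S = S"
proof -
  have "finite (insert 0 {s. \<exists>v\<in>S. v \<noteq> 0 \<and> T v = s *\<^sub>R v})"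
    using finite_eigenvalues[OF assms] by simp
  then obtain s where "s \<notin> insert 0 {s. \<exists>v\<in>S. v \<noteq> 0 \<and> T v = s *\<^sub>R v}"
    using ex_new_if_finite[OF infinite_UNIV_char_0] by meson
  then have s: "s \<noteq> 0" "\<And>v. v \<in> S \<Longrightarrow> T v = s *\<^sub>R v \<Longrightarrow> v = 0" by auto
  define t where "t = - (1 / s)"
  have "(\<lambda>x. x + t *\<^sub>R T x) ` S = S"
  proof (rule inj_endomorphism_image_eq[OF _ S])
    show "linear (\<lambda>x. x + t *\<^sub>R T x)"
      by (rule linearI) (simp_all add: linear_map_simps[OF T] algebra_simps)
    show "(\<lambda>x. x + t *\<^sub>R T x) ` S \<subseteq> S"
      using TS fin_dim_imp_subspace[OF S]
      by (auto intro!: real_vector.subspace_add real_vector.subspace_scale)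
    fix v assume "v \<in> S" "v + t *\<^sub>R T v = 0"
    then have "s *\<^sub>R (v + t *\<^sub>R T v) = 0" by simp
    then have "T v = s *\<^sub>R v" using s(1) by (simp add: t_def algebra_simps)
    then show "v = 0" using s(2) \<open>v \<in> S\<close> by blast
  qed
  moreover have "t \<noteq> 0" using s(1) by (simp add: t_def)
  ultimately show ?thesis using that by blast
qed

section \<open>Projectors and homomorphisms\<close>

locale fin_projector =
  fixes P :: "'a::real_vector \<Rightarrow> 'a"
  assumes linear_proj: "linear P" and idem: "P (P x) = P x" and fin_dim_range: "fin_dim (range P)"
begin

lemma in_range_iff: "x \<in> range P \<longleftrightarrow> P x = x"
  by (metis idem imageE rangeI)

lemma subspace_range: "lin_subspace (range P)"
  using fin_dim_range by (rule fin_dim_imp_subspace)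

lemma ex_coordinates:
  obtains B c where "finite B" "independent B" "B \<subseteq> range P" "card B = dim (range P)"
    "\<forall>b. linear (c b)" "\<forall>v. P v = (\<Sum>b\<in>B. c b v *\<^sub>R b)"
proof -
  obtain B where B: "finite B" "independent B" "span B = range P" "card B = dim (range P)"
    using fin_dim_range by (rule fin_dim_basis)
  have span: "P v \<in> span B" for v using B(3) by simp
  define c where "c b v = representation B (P v) b" for b v
  have linear: "linear (c b)" for b
    unfolding c_def
    by (rule linearI)
       (simp_all add: linear_map_simps[OF linear_proj] span
         real_vector.representation_add[OF B(2)] real_vector.representation_scale[OF B(2)])
  have expansion: "P v = (\<Sum>b\<in>B. c b v *\<^sub>R b)" for v
    unfolding c_def using real_vector.sum_representation_eq[OF B(2) span B(1) order_refl] by simp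
  have "B \<subseteq> range P" using B(3) real_vector.span_superset by blast
  then show ?thesis
    by (rule that[OF B(1,2) _ B(4) allI[OF linear] allI[OF expansion]])
qed

end

text \<open>For projectors \<open>P\<close> and \<open>Q\<close> this is \<open>Hom(range P, range Q)\<close>, a map being extended by \<open>0\<close> to the
  kernel of \<open>P\<close>.\<close>

definition homs :: "('a::real_vector \<Rightarrow> 'a) \<Rightarrow> ('b::real_vector \<Rightarrow> 'b) \<Rightarrow> ('a \<Rightarrow> 'b) set" where
  "homs P Q = {M. linear M \<and> (\<forall>v. Q (M v) = M v) \<and> (\<forall>v. M (P v) = M v)}"

lemma homsI:
  assumes "linear M" "\<And>v. Q (M v) = M v" "\<And>v. M (P v) = M v"
  shows "M \<in> homs P Q"
  using assms unfolding homs_def by blast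

lemma homsD:
  assumes "M \<in> homs P Q"
  shows homs_linear: "linear M" and homs_codomain: "Q (M v) = M v" and homs_domain: "M (P v) = M v"
  using assms by (simp_all add: homs_def)

lemma linear_fun_add: "linear f \<Longrightarrow> linear g \<Longrightarrow> linear (f + g)"
  unfolding plus_fun_def by (rule real_vector.linear_compose_add)

lemma linear_fun_scaleR: "linear f \<Longrightarrow> linear (c *\<^sub>R f)"
  unfolding scaleR_fun_def by (rule real_vector.linear_compose_scale_right)

lemma subspace_homs:
  assumes Q: "linear Q"
  shows "lin_subspace (homs P Q)"
proof (rule real_vector.subspaceI)
  show "0 \<in> homs P Q"
    by (rule homsI) (simp_all add: zero_fun_def real_vector.linear_zero linear_0[OF Q])
  show "M + N \<in> homs P Q" if "M \<in> homs P Q" "N \<in> homs P Q" for M N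
    using homsD[OF that(1)] homsD[OF that(2)]
    by (intro homsI linear_fun_add) (simp_all add: linear_add[OF Q])
  show "c *\<^sub>R M \<in> homs P Q" if "M \<in> homs P Q" for c M
    using homsD[OF that] by (intro homsI linear_fun_scaleR) (simp_all add: linear_scale[OF Q])
qed

lemma linear_rank_one:
  assumes "linear \<psi>"
  shows "linear (\<lambda>v. \<psi> v *\<^sub>R w)"
  by (rule linearI) (simp_all add: linear_map_simps[OF assms] scaleR_add_left)

lemma rank_one_in_homs:
  assumes "linear Q" "Q w = w" "linear \<psi>" "\<And>v. \<psi> (P v) = \<psi> v"
  shows "(\<lambda>v. \<psi> v *\<^sub>R w) \<in> homs P Q"
  using linear_rank_one[OF assms(3)] by (rule homsI) (simp_all add: linear_scale[OF assms(1)] assms)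

lemma homs_expansion:
  assumes M: "M \<in> homs P Q"
    and P: "\<And>v. P v = (\<Sum>b\<in>B. c b v *\<^sub>R b)" and Q: "\<And>w. Q w = (\<Sum>e\<in>C. d e w *\<^sub>R e)"
  shows "M = (\<Sum>(b, e)\<in>B \<times> C. d e (M b) *\<^sub>R (\<lambda>v. c b v *\<^sub>R e))"
proof
  fix v
  have "M v = M (\<Sum>b\<in>B. c b v *\<^sub>R b)" by (simp only: P[symmetric] homs_domain[OF M])
  also have "\<dots> = (\<Sum>b\<in>B. c b v *\<^sub>R Q (M b))"
    by (simp only: linear_sum[OF homs_linear[OF M]] linear_scale[OF homs_linear[OF M]]
        homs_codomain[OF M])
  also have "\<dots> = (\<Sum>b\<in>B. \<Sum>e\<in>C. d e (M b) *\<^sub>R c b v *\<^sub>R e)"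
    by (simp only: Q scaleR_sum_right scaleR_scaleR mult.commute)
  also have "\<dots> = (\<Sum>(b, e)\<in>B \<times> C. d e (M b) *\<^sub>R (\<lambda>v. c b v *\<^sub>R e)) v"
    by (simp only: sum_fun_apply sum.cartesian_product split_def scaleR_fun_apply)
  finally show "M v = (\<Sum>(b, e)\<in>B \<times> C. d e (M b) *\<^sub>R (\<lambda>v. c b v *\<^sub>R e)) v" .
qed

lemma dim_homs_le:
  fixes P :: "'a::real_vector \<Rightarrow> 'a" and Q :: "'b::real_vector \<Rightarrow> 'b"
  assumes P: "fin_projector P" and Q: "fin_projector Q"
  shows fin_dim_homs: "fin_dim (homs P Q)" and "dim (homs P Q) \<le> dim (range P) * dim (range Q)"
proof -
  interpret P: fin_projector P by (rule P)
  interpret Q: fin_projector Q by (rule Q)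
  obtain B c where B: "finite B" "independent B" "B \<subseteq> range P" "card B = dim (range P)"
    and c: "\<forall>b. linear (c b)" "\<forall>v. P v = (\<Sum>b\<in>B. c b v *\<^sub>R b)"
    by (rule P.ex_coordinates)
  obtain C d where C: "finite C" "independent C" "C \<subseteq> range Q" "card C = dim (range Q)"
    and d: "\<forall>e. linear (d e)" "\<forall>w. Q w = (\<Sum>e\<in>C. d e w *\<^sub>R e)"
    by (rule Q.ex_coordinates)
  define rank_one where "rank_one = (\<lambda>(b, e :: 'b) v. c b v *\<^sub>R e)"
  have span: "homs P Q \<subseteq> span (rank_one ` (B \<times> C))"
  proof
    fix M assume M: "M \<in> homs P Q"
    have "(\<Sum>(b, e)\<in>B \<times> C. d e (M b) *\<^sub>R rank_one (b, e)) \<in> span (rank_one ` (B \<times> C))"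
      unfolding split_def prod.collapse
      by (intro real_vector.span_sum real_vector.span_scale real_vector.span_base imageI)
    then show "M \<in> span (rank_one ` (B \<times> C))"
      using homs_expansion[OF M c(2)[rule_format] d(2)[rule_format]]
      unfolding rank_one_def case_prod_conv by argo
  qed
  have fin: "finite (rank_one ` (B \<times> C))" using B(1) C(1) by simp
  show "fin_dim (homs P Q)"
    using fin_dim_subset(1)[OF fin_dim_span[OF fin] subspace_homs[OF Q.linear_proj] span] .
  have "dim (homs P Q) \<le> card (rank_one ` (B \<times> C))"
    using span fin by (rule real_vector.dim_le_card)
  also have "\<dots> \<le> card (B \<times> C)" using B(1) C(1) by (intro card_image_le) simp
  finally show "dim (homs P Q) \<le> dim (range P) * dim (range Q)"
    by (simp add: card_cartesian_product B(4) C(4))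
qed

locale projector_decomp = fin_projector P + \<gamma>: fin_projector \<gamma> + \<delta>: fin_projector \<delta>
  for P \<gamma> \<delta> :: "'a::real_vector \<Rightarrow> 'a" +
  assumes decomp: "P v = \<gamma> v + \<delta> v" and \<gamma>\<delta>: "\<gamma> (\<delta> v) = 0" and \<delta>\<gamma>: "\<delta> (\<gamma> v) = 0"
begin

lemma proj_\<gamma>: "P (\<gamma> v) = \<gamma> v" "\<gamma> (P v) = \<gamma> v"
  by (simp_all add: decomp \<gamma>\<delta> \<delta>\<gamma> \<gamma>.idem linear_add[OF \<gamma>.linear_proj])

lemma proj_\<delta>: "P (\<delta> v) = \<delta> v" "\<delta> (P v) = \<delta> v"
  by (simp_all add: decomp \<gamma>\<delta> \<delta>\<gamma> \<delta>.idem linear_add[OF \<delta>.linear_proj])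

lemma fixed_\<gamma>_iff: "\<gamma> v = v \<longleftrightarrow> P v = v \<and> \<delta> v = 0"
  by (metis add.right_neutral decomp proj_\<gamma>(1) \<delta>\<gamma>)

lemma fixed_\<delta>_iff: "\<delta> v = v \<longleftrightarrow> P v = v \<and> \<gamma> v = 0"
  by (metis add.left_neutral decomp proj_\<delta>(1) \<gamma>\<delta>)

lemma range_\<gamma>_subset: "range \<gamma> \<subseteq> range P" and range_\<delta>_subset: "range \<delta> \<subseteq> range P"
  using proj_\<gamma>(1) proj_\<delta>(1) by (metis image_subsetI rangeI)+

lemma range_\<delta>_eq_kernel: "range \<delta> = {v \<in> range P. \<gamma> v = 0}"
  using \<delta>.in_range_iff in_range_iff fixed_\<delta>_iff by blast

lemma dim_range_eq: "dim (range P) = dim (range \<gamma>) + dim (range \<delta>)"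
proof -
  have "\<gamma> ` range P = range \<gamma>" by (simp add: image_image proj_\<gamma>(2))
  then show ?thesis
    using rank_nullity[OF \<gamma>.linear_proj fin_dim_range] by (simp add: range_\<delta>_eq_kernel)
qed

end

context fin_projector
begin

lemma projector_decompI:
  assumes \<gamma>: "linear \<gamma>" "\<And>v. P (\<gamma> v) = \<gamma> v" "\<And>v. \<gamma> (P v) = \<gamma> v" "\<And>v. \<gamma> (\<gamma> v) = \<gamma> v"
  shows "projector_decomp P \<gamma> (\<lambda>v. P v - \<gamma> v)"
proof -
  let ?\<delta> = "\<lambda>v. P v - \<gamma> v"
  have \<delta>: "linear ?\<delta>"
    by (rule linearI) (simp_all add: linear_add linear_scale \<gamma>(1) linear_proj algebra_simps)
  have fin: "fin_dim (range f)" if f: "linear f" "\<And>v. P (f v) = f v" for f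
  proof (rule fin_dim_subset(1)[OF fin_dim_range])
    show "lin_subspace (range f)"
      by (rule real_vector.linear_subspace_image[OF f(1) real_vector.subspace_UNIV])
    show "range f \<subseteq> range P" using f(2) in_range_iff by blast
  qed
  note diff = linear_diff[OF \<gamma>(1)] linear_diff[OF linear_proj]
  show ?thesis
  proof (intro projector_decomp.intro projector_decomp_axioms.intro fin_projector.intro)
    show "fin_dim (range \<gamma>)" using \<gamma>(1,2) by (rule fin)
    show "fin_dim (range ?\<delta>)" using \<delta> by (rule fin) (simp add: diff idem \<gamma>(2))
  qed (use fin_dim_range in \<open>simp_all add: diff \<gamma> \<delta> idem linear_proj\<close>)
qed

lemma ex_projector_decomp:
  assumes G: "lin_subspace G" "G \<subseteq> range P"
  obtains \<gamma> \<delta> where "projector_decomp P \<gamma> \<delta>" "range \<gamma> = G"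
proof -
  obtain A where A: "A \<subseteq> G" "independent A" "G \<subseteq> span A"
    using real_vector.basis_exists[of G] by metis
  obtain g where g: "linear g" "\<forall>a\<in>A. g a = a" "range g = span A"
    using real_vector.linear_independent_extend_subspace[OF A(2), of "\<lambda>a. a"] by auto
  have range_g: "range g = G" using g(3) real_vector.span_subspace[OF A(1,3) G(1)] by simp
  have fixes_G: "g w = w" "P w = w" if "w \<in> G" for w
  proof -
    show "g w = w"
      by (rule real_vector.linear_eq_on[OF g(1) real_vector.linear_ident subsetD[OF A(3) that]])
         (use g(2) in auto)
    show "P w = w" using that G(2) in_range_iff by blast
  qed
  have in_G: "g v \<in> G" for v using range_g by blast
  define \<gamma> where "\<gamma> v = g (P v)" for v
  have "linear \<gamma>" unfolding \<gamma>_def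
    by (rule linearI) (simp_all add: linear_add linear_scale g(1) linear_proj)
  then have "projector_decomp P \<gamma> (\<lambda>v. P v - \<gamma> v)"
    by (rule projector_decompI) (simp_all add: \<gamma>_def idem fixes_G in_G)
  moreover have "range \<gamma> = G"
  proof
    show "range \<gamma> \<subseteq> G" using in_G by (auto simp: \<gamma>_def)
    show "G \<subseteq> range \<gamma>"
    proof
      fix w assume "w \<in> G"
      then have "w = \<gamma> w" by (simp add: \<gamma>_def fixes_G)
      then show "w \<in> range \<gamma>" by (rule range_eqI)
    qed
  qed
  ultimately show ?thesis by (rule that)
qed

lemma line_projector_decomp:
  assumes "P x = x" "linear \<phi>" "\<And>v. \<phi> (P v) = \<phi> v" "\<phi> x = (1::real)"
  shows "projector_decomp P (\<lambda>v. \<phi> v *\<^sub>R x) (\<lambda>v. P v - \<phi> v *\<^sub>R x)"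
  using assms
  by (intro projector_decompI)
     (auto intro!: linearI simp: linear_add linear_scale linear_proj algebra_simps)

end

section \<open>Spaces of operators with trivial spectrum\<close>

definition orbit :: "('a \<Rightarrow> 'b) set \<Rightarrow> 'a \<Rightarrow> 'b set" where
  "orbit V x = (\<lambda>M. M x) ` V"

definition annihilator :: "('a \<Rightarrow> 'b::zero) set \<Rightarrow> 'a \<Rightarrow> ('a \<Rightarrow> 'b) set" where
  "annihilator V x = {M \<in> V. M x = 0}"

lemma subspace_orbit: "lin_subspace V \<Longrightarrow> lin_subspace (orbit V x)"
  unfolding orbit_def by (rule real_vector.linear_subspace_image[OF linear_eval])

lemma subspace_annihilator: "lin_subspace V \<Longrightarrow> lin_subspace (annihilator V x)"
  unfolding annihilator_def by (rule subspace_kernel_in[OF linear_eval])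

lemma dim_eq_orbit_annihilator:
  "fin_dim V \<Longrightarrow> dim V = dim (orbit V x) + dim (annihilator V x)"
  unfolding orbit_def annihilator_def by (rule rank_nullity[OF linear_eval])

definition compression :: "('a \<Rightarrow> 'a) \<Rightarrow> ('a \<Rightarrow> 'a) \<Rightarrow> 'a \<Rightarrow> 'a" where
  "compression \<delta> M = (\<lambda>v. \<delta> (M (\<delta> v)))"

lemma linear_compression: "linear \<delta> \<Longrightarrow> linear (compression \<delta>)"
  by (rule linearI) (simp_all add: compression_def fun_eq_iff linear_add linear_scale)

lemma compression_in_homs:
  assumes "fin_projector \<delta>" "linear M"
  shows "compression \<delta> M \<in> homs \<delta> \<delta>"
proof -
  interpret fin_projector \<delta> by (rule assms(1))
  show ?thesis
    unfolding compression_def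
    by (intro homsI linearI)
       (simp_all add: linear_map_simps[OF linear_proj]
         linear_map_simps[OF assms(2)] idem)
qed

locale trivial_spectrum = fin_projector P for P :: "'a::real_vector \<Rightarrow> 'a" +
  fixes V :: "('a \<Rightarrow> 'a) set"
  assumes subspace_V: "lin_subspace V"
    and V_homs: "V \<subseteq> homs P P"
    and no_fixed_vector: "M \<in> V \<Longrightarrow> M x = x \<Longrightarrow> x = 0"
begin

lemma linear_V: "M \<in> V \<Longrightarrow> linear M"
  and codomain_V: "M \<in> V \<Longrightarrow> P (M x) = M x"
  and domain_V: "M \<in> V \<Longrightarrow> M (P x) = M x"
  using V_homs homsD by blast+

lemma fin_dim_V: "fin_dim V"
  by (rule fin_dim_subset(1)[OF fin_dim_homs[OF fin_projector_axioms fin_projector_axioms]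
        subspace_V V_homs])

lemma trivial_spectrum_subset:
  assumes "lin_subspace U" "U \<subseteq> V"
  shows "trivial_spectrum P U"
  using assms V_homs no_fixed_vector by unfold_locales blast+

lemma orbit_subset_range: "orbit V x \<subseteq> range P"
  unfolding orbit_def using codomain_V in_range_iff by auto

lemma not_in_orbit: "x \<noteq> 0 \<Longrightarrow> x \<notin> orbit V x"
  unfolding orbit_def using no_fixed_vector by (metis imageE)

lemma image_one_minus:
  assumes M: "M \<in> V" and G: "lin_subspace G" "G \<subseteq> range P" "M ` G \<subseteq> G"
  shows "(\<lambda>v. v - M v) ` G = G"
proof (rule inj_endomorphism_image_eq)
  show "linear (\<lambda>v. v - M v)"
    using linear_V[OF M] by (intro linearI) (simp_all add: linear_add linear_scale algebra_simps)
  show "fin_dim G" using fin_dim_subset(1)[OF fin_dim_range G(1,2)] .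
  show "(\<lambda>v. v - M v) ` G \<subseteq> G" using G(1,3) by (auto intro: real_vector.subspace_diff)
  show "v = 0" if "v - M v = 0" for v using that no_fixed_vector[OF M, of v] by simp
qed

lemma ex_resolvent:
  assumes "M \<in> V" "P z = z"
  obtains w where "P w = w" "w - c *\<^sub>R M w = z"
proof -
  have "c *\<^sub>R M \<in> V" using assms(1) subspace_V real_vector.subspace_scale by blast
  moreover have "(c *\<^sub>R M) ` range P \<subseteq> range P"
    using assms(1) by (auto simp: in_range_iff codomain_V linear_scale[OF linear_proj])
  ultimately have "(\<lambda>v. v - (c *\<^sub>R M) v) ` range P = range P"
    by (intro image_one_minus subspace_range order_refl)
  moreover have "z \<in> range P" using assms(2) by (simp add: in_range_iff)
  ultimately obtain w where "w \<in> range P" "z = w - (c *\<^sub>R M) w" by (metis imageE)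
  then show ?thesis using that[of w] by (simp add: in_range_iff)
qed

lemma
  assumes M: "M \<in> V" and G: "lin_subspace G" "G \<subseteq> range P"
  shows subspace_resolvent_preimage: "lin_subspace {w \<in> range P. w - t *\<^sub>R M w \<in> G}"
    and dim_resolvent_preimage: "dim {w \<in> range P. w - t *\<^sub>R M w \<in> G} = dim G"
proof -
  let ?D = "\<lambda>w. w - t *\<^sub>R M w"
  let ?S = "{w \<in> range P. ?D w \<in> G}"
  have linear_D: "linear ?D"
    by (rule linearI)
       (simp_all add: linear_map_simps[OF linear_V[OF M]] algebra_simps)
  show sub: "lin_subspace ?S"
    using real_vector.subspace_inter[OF subspace_range
        real_vector.linear_subspace_linear_preimage[OF linear_D G(1)]]
    by (simp add: Collect_conj_eq)
  have "?D ` ?S = G"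
  proof
    show "G \<subseteq> ?D ` ?S"
    proof
      fix u assume u: "u \<in> G"
      then have "P u = u" using G(2) in_range_iff by blast
      then obtain w where "P w = w" "?D w = u" by (rule ex_resolvent[OF M])
      then show "u \<in> ?D ` ?S" using u by (intro image_eqI[of _ _ w]) (simp_all add: in_range_iff)
    qed
  qed blast
  moreover have "dim (?D ` ?S) = dim ?S"
  proof (rule dim_image_inj[OF linear_D])
    show "fin_dim ?S" by (rule fin_dim_subset(1)[OF fin_dim_range sub]) blast
    show "w = 0" if "?D w = 0" for w
      using that no_fixed_vector[OF real_vector.subspace_scale[OF subspace_V M], of t w] by simp
  qed
  ultimately show "dim ?S = dim G" by simp
qed

end

locale invariant_decomp = trivial_spectrum P V + projector_decomp P \<gamma> \<delta>
  for P \<gamma> \<delta> :: "'a::real_vector \<Rightarrow> 'a" and V +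
  assumes invariant: "M \<in> V \<Longrightarrow> \<delta> (M (\<gamma> v)) = 0"
begin

lemma \<gamma>_restriction: "M \<in> V \<Longrightarrow> \<gamma> (M (\<gamma> v)) = M (\<gamma> v)"
  using decomp[of "M (\<gamma> v)"] invariant codomain_V by simp

lemma trivial_spectrum_sub: "trivial_spectrum \<gamma> (compression \<gamma> ` V)"
proof unfold_locales
  show "lin_subspace (compression \<gamma> ` V)"
    by (rule real_vector.linear_subspace_image[OF linear_compression[OF \<gamma>.linear_proj] subspace_V])
  show "compression \<gamma> ` V \<subseteq> homs \<gamma> \<gamma>"
    using compression_in_homs[OF \<gamma>.fin_projector_axioms linear_V] by blast
  fix N v assume "N \<in> compression \<gamma> ` V" "N v = v"
  then obtain M where M: "M \<in> V" and Mv: "\<gamma> (M (\<gamma> v)) = v" by (auto simp: compression_def)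
  then have "\<gamma> v = v" using \<gamma>.idem by metis
  then show "v = 0" using no_fixed_vector[OF M, of v] Mv \<gamma>_restriction[OF M, of v] by simp
qed

text \<open>If \<open>M v = v\<close> modulo \<open>range \<gamma>\<close>, then \<open>v - M v = g - M g\<close> for some \<open>g \<in> range \<gamma>\<close>, so \<open>v = g\<close>.\<close>

lemma trivial_spectrum_quotient: "trivial_spectrum \<delta> (compression \<delta> ` V)"
proof unfold_locales
  show "lin_subspace (compression \<delta> ` V)"
    by (rule real_vector.linear_subspace_image[OF linear_compression[OF \<delta>.linear_proj] subspace_V])
  show "compression \<delta> ` V \<subseteq> homs \<delta> \<delta>"
    using compression_in_homs[OF \<delta>.fin_projector_axioms linear_V] by blast
  fix N v assume "N \<in> compression \<delta> ` V" "N v = v"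
  then obtain M where M: "M \<in> V" and Mv: "\<delta> (M (\<delta> v)) = v" by (auto simp: compression_def)
  then have \<delta>v: "\<delta> v = v" using \<delta>.idem by metis
  have "\<delta> (v - M v) = 0" using Mv \<delta>v by (simp add: linear_diff[OF \<delta>.linear_proj])
  moreover have "P (v - M v) = v - M v"
    using \<delta>v proj_\<delta>(1)[of v] codomain_V[OF M] by (simp add: linear_diff[OF linear_proj])
  ultimately have "v - M v \<in> range \<gamma>" using \<gamma>.in_range_iff fixed_\<gamma>_iff by blast
  moreover have "M ` range \<gamma> \<subseteq> range \<gamma>"
    using \<gamma>_restriction[OF M] \<gamma>.in_range_iff by auto
  ultimately obtain g where g: "g \<in> range \<gamma>" "v - M v = g - M g"
    using image_one_minus[OF M \<gamma>.subspace_range range_\<gamma>_subset] by blast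
  then have "M (v - g) = v - g" by (simp add: linear_diff[OF linear_V[OF M]] algebra_simps)
  then have "v = g" using no_fixed_vector[OF M, of "v - g"] by simp
  then show "v = 0" using g(1) \<delta>v \<gamma>.in_range_iff fixed_\<gamma>_iff by metis
qed

end

definition adapted :: "('a::real_vector \<Rightarrow> 'b::real_vector) set \<Rightarrow> 'b \<Rightarrow> bool" where
  "adapted V x \<longleftrightarrow> (\<forall>\<psi>. linear \<psi> \<longrightarrow> (\<lambda>v. \<psi> v *\<^sub>R x) \<in> V \<longrightarrow> (\<forall>v. \<psi> v = 0))"

context trivial_spectrum
begin

text \<open>If \<open>e \<otimes> \<psi>\<^sub>e \<in> V\<close> with \<open>\<psi>\<^sub>e \<noteq> 0\<close> for every \<open>e\<close> of a basis, and \<open>x = \<Sum>a\<^sub>e e\<close> avoids the kernels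
  of all \<open>\<psi>\<^sub>e\<close>, then the element \<open>\<Sum>(a\<^sub>e / \<psi>\<^sub>e x) e \<otimes> \<psi>\<^sub>e\<close> of \<open>V\<close> fixes \<open>x\<close>.\<close>

lemma ex_adapted_vector:
  assumes nontrivial: "range P \<noteq> {0}"
  shows "\<exists>x. P x = x \<and> x \<noteq> 0 \<and> adapted V x"
proof (rule ccontr)
  assume none: "\<nexists>x. P x = x \<and> x \<noteq> 0 \<and> adapted V x"
  obtain B c where B: "finite B" "independent B" "B \<subseteq> range P" "card B = dim (range P)"
    and c: "\<forall>e. linear (c e)" "\<forall>v. P v = (\<Sum>e\<in>B. c e v *\<^sub>R e)"
    by (rule ex_coordinates)
  have fixed: "P e = e" "e \<noteq> 0" if "e \<in> B" for e
  proof -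
    show "P e = e" using that B(3) in_range_iff by blast
    show "e \<noteq> 0" using that B(2) real_vector.dependent_zero by blast
  qed
  have "\<exists>\<psi>. linear \<psi> \<and> (\<lambda>v. \<psi> v *\<^sub>R e) \<in> V \<and> (\<exists>v. \<psi> v \<noteq> 0)" if "e \<in> B" for e
    using none fixed[OF that] unfolding adapted_def by blast
  then obtain \<psi> where \<psi>: "\<forall>e\<in>B. linear (\<psi> e) \<and> (\<lambda>v. \<psi> e v *\<^sub>R e) \<in> V \<and> (\<exists>v. \<psi> e v \<noteq> 0)"
    by (rule exE[OF bchoice[OF ballI]])
  then have lin: "linear (\<psi> e)" and rank_one: "(\<lambda>v. \<psi> e v *\<^sub>R e) \<in> V" if "e \<in> B" for e
    using that by simp_all
  have nonzero: "linear (\<psi> e) \<and> (\<exists>z\<in>range P. \<psi> e z \<noteq> 0)" if e: "e \<in> B" for e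
  proof -
    obtain v where "\<psi> e v \<noteq> 0" using \<psi> e by blast
    moreover have "\<psi> e (P v) = \<psi> e v" using domain_V[OF rank_one[OF e], of v] fixed[OF e] by simp
    ultimately show ?thesis by (intro conjI lin[OF e] bexI[of _ "P v"]) simp_all
  qed
  obtain x where x: "x \<in> range P" "\<forall>e\<in>B. \<psi> e x \<noteq> 0"
    by (rule bexE[OF ex_common_nonzero[OF B(1) subspace_range nonzero]])
  define M where "M = (\<Sum>e\<in>B. (c e x / \<psi> e x) *\<^sub>R (\<lambda>v. \<psi> e v *\<^sub>R e))"
  have "M \<in> V"
    unfolding M_def
    by (intro real_vector.subspace_sum real_vector.subspace_scale subspace_V rank_one)
  moreover have "M x = (\<Sum>e\<in>B. c e x *\<^sub>R e)"
    unfolding M_def sum_fun_apply by (rule sum.cong) (use x(2) in simp_all)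
  then have "M x = x" using x(1) by (simp only: c(2)[rule_format, symmetric] in_range_iff)
  ultimately have "x = 0" by (rule no_fixed_vector)
  then have "\<psi> e x = 0" if "e \<in> B" for e using linear_0[OF lin[OF that]] by simp
  then have "B = {}" using x(2) by blast
  then have "range P = {0}" by (simp add: c(2)[rule_format])
  then show False using nontrivial by blast
qed

end

locale adapted_splitting = trivial_spectrum P V for P :: "'a::real_vector \<Rightarrow> 'a" and V +
  fixes x :: 'a and \<phi> :: "'a \<Rightarrow> real"
  assumes Px: "P x = x" and adapted_x: "adapted V x"
    and linear_\<phi>: "linear \<phi>" and \<phi>P: "\<phi> (P v) = \<phi> v" and \<phi>x: "\<phi> x = 1"
    and \<phi>_orbit: "M \<in> V \<Longrightarrow> \<phi> (M x) = 0"
begin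

definition Q :: "'a \<Rightarrow> 'a" where
  "Q v = P v - \<phi> v *\<^sub>R x"

sublocale line: projector_decomp P "\<lambda>v. \<phi> v *\<^sub>R x" Q
  unfolding Q_def using Px linear_\<phi> \<phi>P \<phi>x by (rule line_projector_decomp)

lemma Qx: "Q x = 0"
  by (simp add: Q_def \<phi>x Px)

lemma x_nonzero: "x \<noteq> 0"
  using \<phi>x linear_0[OF linear_\<phi>] by auto

lemma range_Q: "range Q = {v \<in> range P. \<phi> v = 0}"
  using line.range_\<delta>_eq_kernel x_nonzero by simp

lemma fixed_Q_iff: "Q v = v \<longleftrightarrow> P v = v \<and> \<phi> v = 0"
  using line.fixed_\<delta>_iff x_nonzero by simp

lemma dim_range_Q: "dim (range P) = Suc (dim (range Q))"
  unfolding range_Q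
  by (rule dim_functional_kernel[OF linear_\<phi> fin_dim_range, of x])
     (simp_all add: in_range_iff Px \<phi>x)

lemma range_Q_psubset: "range Q \<subset> range P"
proof -
  have "x \<in> range P" "x \<notin> range Q" using Px \<phi>x by (simp_all add: in_range_iff range_Q)
  then show ?thesis using line.range_\<delta>_subset by blast
qed

lemma orbit_subset_Q: "orbit V x \<subseteq> range Q"
  unfolding range_Q using orbit_subset_range \<phi>_orbit by (auto simp: orbit_def)

sublocale ann: invariant_decomp P "\<lambda>v. \<phi> v *\<^sub>R x" Q "annihilator V x"
proof (intro invariant_decomp.intro invariant_decomp_axioms.intro line.projector_decomp_axioms)
  show "trivial_spectrum P (annihilator V x)"
    using subspace_annihilator[OF subspace_V]
    by (rule trivial_spectrum_subset) (auto simp: annihilator_def)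
  show "Q (M (\<phi> v *\<^sub>R x)) = 0" if "M \<in> annihilator V x" for M v
    using that linear_V[of M]
    by (simp add: annihilator_def linear_scale linear_0[OF line.\<delta>.linear_proj])
qed

lemma dim_compression_annihilator:
  "dim (compression Q ` annihilator V x) = dim (annihilator V x)"
proof (rule dim_image_inj[OF linear_compression[OF line.\<delta>.linear_proj] ann.fin_dim_V])
  fix M assume M: "M \<in> annihilator V x" and QMQ: "compression Q M = 0"
  then have MV: "M \<in> V" "M x = 0" by (auto simp: annihilator_def)
  note lin = linear_V[OF MV(1)]
  have "Q (M v) = 0" for v
  proof -
    have "M v = M (Q v)"
      using domain_V[OF MV(1), of v] MV(2)
      by (simp add: line.decomp linear_map_simps[OF lin])
    then show ?thesis using fun_cong[OF QMQ, of v] by (simp add: compression_def)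
  qed
  then have image: "M v = \<phi> (M v) *\<^sub>R x" for v
    using line.decomp[of "M v"] codomain_V[OF MV(1), of v] by simp
  have "(\<lambda>v. \<phi> (M v) *\<^sub>R x) = M" by (rule ext) (rule image[symmetric])
  moreover have "linear (\<lambda>v. \<phi> (M v))"
    by (rule linearI)
       (simp_all add: linear_map_simps[OF lin] linear_map_simps[OF linear_\<phi>])
  ultimately have "\<phi> (M v) = 0" for v
    using adapted_x[unfolded adapted_def, rule_format, of "\<lambda>v. \<phi> (M v)" v] MV(1) by argo
  then show "M = 0" by (intro ext) (subst image, simp)
qed

end

lemma (in trivial_spectrum) ex_adapted_splitting:
  assumes "range P \<noteq> {0}"
  obtains x \<phi> where "adapted_splitting P V x \<phi>"
proof -
  obtain x where x: "P x = x" "x \<noteq> 0" "adapted V x" using ex_adapted_vector[OF assms] by blast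
  obtain \<psi> :: "'a \<Rightarrow> real" where \<psi>: "linear \<psi>" "\<psi> x = 1" "\<And>v. v \<in> orbit V x \<Longrightarrow> \<psi> v = 0"
    using separating_functional[OF subspace_orbit[OF subspace_V] not_in_orbit[OF x(2)]] by metis
  have "linear (\<lambda>v. \<psi> (P v))"
    by (rule linearI)
       (simp_all add: linear_map_simps[OF \<psi>(1)] linear_map_simps[OF linear_proj])
  moreover have "\<psi> (P (M x)) = 0" if "M \<in> V" for M
    using \<psi>(3)[of "M x"] that codomain_V[OF that] by (simp add: orbit_def)
  ultimately have "adapted_splitting P V x (\<lambda>v. \<psi> (P v))"
    using x \<psi>(2)
    by (intro adapted_splitting.intro adapted_splitting_axioms.intro trivial_spectrum_axioms)
       (simp_all add: idem)
  then show ?thesis by (rule that)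
qed

lemma choose_two_Suc: "Suc k choose 2 = k + (k choose 2)"
  by (simp add: numeral_2_eq_2)

lemma choose_two_add: "(a + b) choose 2 = (a choose 2) + (b choose 2) + b * a"
  by (induction b) (simp_all add: choose_two_Suc)

theorem trivial_spectrum_dim_le:
  assumes "trivial_spectrum P V"
  shows "dim V \<le> dim (range P) choose 2"
  using assms
proof (induction "dim (range P)" arbitrary: P V)
  case 0
  then interpret trivial_spectrum P V by simp
  have "range P = {0}" using 0 fin_dim_eq_zero_iff[OF fin_dim_range] by simp
  then have "M = 0" if "M \<in> V" for M
    using codomain_V[OF that] by (intro ext) (metis rangeI singletonD zero_fun_apply)
  then have "V = {0}" using real_vector.subspace_0[OF subspace_V] by blast
  then show ?case by (simp add: dim_zero)
next
  case (Suc n)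
  then interpret trivial_spectrum P V by simp
  have "range P \<noteq> {0}" using Suc.hyps(2) by (metis dim_zero nat.distinct(1))
  then obtain x \<phi> where "adapted_splitting P V x \<phi>" by (rule ex_adapted_splitting)
  then interpret adapted_splitting P V x \<phi> .
  have n: "n = dim (range Q)" using dim_range_Q Suc.hyps(2) by simp
  have "dim V = dim (orbit V x) + dim (annihilator V x)"
    using fin_dim_V by (rule dim_eq_orbit_annihilator)
  also have "dim (orbit V x) \<le> n"
    unfolding n
    using dim_le_fin_dim[OF line.\<delta>.fin_dim_range subspace_orbit[OF subspace_V] orbit_subset_Q] .
  also have "dim (annihilator V x) \<le> n choose 2"
    using Suc.hyps(1)[OF n ann.trivial_spectrum_quotient]
    unfolding dim_compression_annihilator n[symmetric] .
  finally show ?case unfolding Suc.hyps(2)[symmetric] choose_two_Suc by simp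
qed

section \<open>Trivial spectrum spaces of maximal dimension\<close>

locale max_trivial_spectrum = trivial_spectrum +
  assumes dim_V: "dim V = dim (range P) choose 2"
begin

lemma superset_eq:
  assumes "trivial_spectrum P W" "V \<subseteq> W"
  shows "V = W"
proof -
  interpret W: trivial_spectrum P W by (rule assms(1))
  show ?thesis
    using trivial_spectrum_dim_le[OF assms(1)] dim_V
    by (intro fin_dim_subspace_equal[OF W.fin_dim_V subspace_V assms(2)]) simp
qed

end

lemma max_trivial_spectrumI:
  assumes "trivial_spectrum P V" "dim (range P) choose 2 \<le> dim V"
  shows "max_trivial_spectrum P V"
  using assms trivial_spectrum_dim_le[OF assms(1)]
  by (intro max_trivial_spectrum.intro max_trivial_spectrum_axioms.intro) simp_all

locale max_invariant_decomp = invariant_decomp P \<gamma> \<delta> V + max_trivial_spectrum P V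
  for P \<gamma> \<delta> :: "'a::real_vector \<Rightarrow> 'a" and V
begin

lemma subset_blocks: "V \<subseteq> compression \<gamma> ` V + compression \<delta> ` V + homs \<delta> \<gamma>"
proof
  fix M assume M: "M \<in> V"
  note lin = linear_V[OF M]
  define X where "X v = \<gamma> (M (\<delta> v))" for v
  have "linear X" unfolding X_def
    by (rule linearI)
       (simp_all add: linear_map_simps[OF lin] linear_map_simps[OF \<gamma>.linear_proj]
         linear_map_simps[OF \<delta>.linear_proj])
  then have "X \<in> homs \<delta> \<gamma>" by (rule homsI) (simp_all add: X_def \<gamma>.idem \<delta>.idem)
  moreover have "M = compression \<gamma> M + compression \<delta> M + X"
  proof
    fix v
    have "M v = M (\<gamma> v) + M (\<delta> v)"
      using domain_V[OF M, of v] by (simp add: decomp linear_add[OF lin])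
    also have "M (\<delta> v) = \<gamma> (M (\<delta> v)) + \<delta> (M (\<delta> v))"
      using codomain_V[OF M, of "\<delta> v"] decomp by simp
    finally show "M v = (compression \<gamma> M + compression \<delta> M + X) v"
      by (simp add: compression_def X_def \<gamma>_restriction[OF M])
  qed
  ultimately show "M \<in> compression \<gamma> ` V + compression \<delta> ` V + homs \<delta> \<gamma>"
    using M by (metis imageI set_plus_intro)
qed

lemma eq_blocks: "V = compression \<gamma> ` V + compression \<delta> ` V + homs \<delta> \<gamma>"
  and max_sub: "max_trivial_spectrum \<gamma> (compression \<gamma> ` V)"
  and max_quotient: "max_trivial_spectrum \<delta> (compression \<delta> ` V)"
proof -
  interpret A: trivial_spectrum \<gamma> "compression \<gamma> ` V" by (rule trivial_spectrum_sub)
  interpret B: trivial_spectrum \<delta> "compression \<delta> ` V" by (rule trivial_spectrum_quotient)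
  let ?A = "compression \<gamma> ` V" and ?B = "compression \<delta> ` V" and ?H = "homs \<delta> \<gamma>"
  have H: "fin_dim ?H" "dim ?H \<le> dim (range \<delta>) * dim (range \<gamma>)"
    using dim_homs_le[OF \<delta>.fin_projector_axioms \<gamma>.fin_projector_axioms] by auto
  have fin: "fin_dim (?A + ?B + ?H)"
    by (intro fin_dim_set_plus A.fin_dim_V B.fin_dim_V H(1))
  have "dim (?A + ?B + ?H) \<le> dim ?A + dim ?B + dim ?H"
    using dim_set_plus_le[OF fin_dim_set_plus[OF A.fin_dim_V B.fin_dim_V] H(1)]
      dim_set_plus_le[OF A.fin_dim_V B.fin_dim_V] by simp
  moreover have "dim V \<le> dim (?A + ?B + ?H)"
    using dim_le_fin_dim[OF fin subspace_V subset_blocks] .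
  moreover note trivial_spectrum_dim_le[OF trivial_spectrum_sub]
    trivial_spectrum_dim_le[OF trivial_spectrum_quotient]
  moreover have "dim V = (dim (range \<gamma>) choose 2) + (dim (range \<delta>) choose 2)
      + dim (range \<delta>) * dim (range \<gamma>)"
    unfolding dim_V dim_range_eq by (rule choose_two_add)
  ultimately have dims: "dim (?A + ?B + ?H) \<le> dim V"
    "dim (range \<gamma>) choose 2 \<le> dim ?A" "dim (range \<delta>) choose 2 \<le> dim ?B"
    using H(2) by linarith+
  show "V = ?A + ?B + ?H" by (rule fin_dim_subspace_equal[OF fin subspace_V subset_blocks dims(1)])
  show "max_trivial_spectrum \<gamma> ?A"
    using trivial_spectrum_sub dims(2) by (rule max_trivial_spectrumI)
  show "max_trivial_spectrum \<delta> ?B"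
    using trivial_spectrum_quotient dims(3) by (rule max_trivial_spectrumI)
qed

lemma homs_subset: "homs \<delta> \<gamma> \<subseteq> V"
proof
  fix X assume "X \<in> homs \<delta> \<gamma>"
  then have "0 + 0 + X \<in> compression \<gamma> ` V + compression \<delta> ` V + homs \<delta> \<gamma>"
    by (intro set_plus_intro
        real_vector.subspace_0[OF trivial_spectrum.subspace_V[OF trivial_spectrum_sub]]
        real_vector.subspace_0[OF trivial_spectrum.subspace_V[OF trivial_spectrum_quotient]])
  then show "X \<in> V" unfolding eq_blocks[symmetric] by simp
qed

end

locale max_adapted_splitting = adapted_splitting P V x \<phi> + max_trivial_spectrum P V
  for P :: "'a::real_vector \<Rightarrow> 'a" and V x \<phi>
begin

lemma orbit_eq: "orbit V x = range Q"
  and dim_annihilator: "dim (range Q) choose 2 \<le> dim (annihilator V x)"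
proof -
  have orbit_le: "dim (orbit V x) \<le> dim (range Q)"
    using dim_le_fin_dim[OF line.\<delta>.fin_dim_range subspace_orbit[OF subspace_V] orbit_subset_Q] .
  have ann_le: "dim (annihilator V x) \<le> dim (range Q) choose 2"
    using trivial_spectrum_dim_le[OF ann.trivial_spectrum_quotient]
    unfolding dim_compression_annihilator .
  have "dim (orbit V x) + dim (annihilator V x) = dim (range Q) + (dim (range Q) choose 2)"
    using dim_eq_orbit_annihilator[OF fin_dim_V, of x] dim_V
    unfolding dim_range_Q choose_two_Suc by simp
  with orbit_le ann_le show "dim (range Q) choose 2 \<le> dim (annihilator V x)" by simp
  have "dim (range Q) \<le> dim (orbit V x)"
    using \<open>dim (orbit V x) + _ = _\<close> ann_le by simp
  then show "orbit V x = range Q"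
    by (rule fin_dim_subspace_equal[OF line.\<delta>.fin_dim_range subspace_orbit[OF subspace_V]
          orbit_subset_Q])
qed

lemma ex_orbit_section:
  obtains g :: "'a \<Rightarrow> 'a \<Rightarrow> 'a"
  where "linear g" "range g \<subseteq> V" "\<forall>v\<in>range Q. g v x = v"
proof -
  obtain g :: "'a \<Rightarrow> 'a \<Rightarrow> 'a"
    where "range g \<subseteq> V \<and> linear g \<and> (\<forall>v\<in>(\<lambda>M. M x) ` V. g v x = v)"
    using real_vector.linear_exists_right_inverse_on[OF linear_eval subspace_V, of x] by (rule exE)
  then show ?thesis using that[of g] by (simp add: orbit_eq[unfolded orbit_def])
qed

lemma ex_perturbed_orbit_point:
  assumes w: "P w = w" "\<phi> w \<noteq> 0" and y: "P y = y"
  obtains t z N where "t \<noteq> 0" "N \<in> V" "N x = z - (\<phi> z / \<phi> w) *\<^sub>R w" "x + t *\<^sub>R y = z + t *\<^sub>R N y"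
proof -
  obtain g where g: "linear g" "range g \<subseteq> V" "\<forall>v\<in>range Q. g v x = v"
    by (rule ex_orbit_section)
  have gV: "g u \<in> V" for u using g(2) by blast
  define h where "h z = z - (\<phi> z / \<phi> w) *\<^sub>R w" for z
  have linear_h: "linear h"
    unfolding h_def
    by (rule linearI)
       (simp_all add: linear_map_simps[OF linear_\<phi>] add_divide_distrib
         algebra_simps)
  define T where "T z = g (h z) y" for z
  have linear_T: "linear T"
    unfolding T_def
    by (rule linearI)
       (simp_all add: linear_map_simps[OF linear_h] linear_map_simps[OF g(1)])
  have "T ` range P \<subseteq> range P"
    by (rule image_subsetI) (simp add: T_def in_range_iff codomain_V[OF gV])
  then obtain t where t: "t \<noteq> 0" "(\<lambda>z. z + t *\<^sub>R T z) ` range P = range P"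
    by (rule ex_small_perturbation_surj[OF linear_T fin_dim_range])
  have "x + t *\<^sub>R y \<in> range P"
    by (simp add: in_range_iff linear_map_simps[OF linear_proj] Px y)
  then have "x + t *\<^sub>R y \<in> (\<lambda>z. z + t *\<^sub>R T z) ` range P" unfolding t(2) .
  then obtain z where z: "x + t *\<^sub>R y = z + t *\<^sub>R T z" "z \<in> range P" by (rule imageE)
  have "h z \<in> range Q"
    using z(2) w
    by (simp add: range_Q h_def in_range_iff linear_map_simps[OF linear_proj]
        linear_map_simps[OF linear_\<phi>])
  then have "g (h z) x = h z" by (rule bspec[OF g(3)])
  then show ?thesis using that[OF t(1) gV[of "h z"], of z] z(1) by (simp add: T_def h_def)
qed

text \<open>If \<open>M x = 0\<close> and \<open>w = M y \<notin> range Q\<close>, then for generic \<open>t\<close> the vectors \<open>N (x + t y)\<close> with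
  \<open>N \<in> V\<close> fill up the whole space: they include \<open>t w\<close> and, up to a term of order \<open>t\<close>, all of
  \<open>range Q\<close>. So some \<open>N\<close> fixes \<open>x + t y\<close>.\<close>

lemma \<phi>_annihilator:
  assumes M: "M \<in> annihilator V x"
  shows "\<phi> (M v) = 0"
proof (rule ccontr)
  assume "\<phi> (M v) \<noteq> 0"
  have MV: "M \<in> V" "M x = 0" using M by (simp_all add: annihilator_def)
  define y where "y = P v"
  define w where "w = M y"
  have y: "P y = y" by (simp add: y_def idem)
  have w: "P w = w" "\<phi> w \<noteq> 0"
    using \<open>\<phi> (M v) \<noteq> 0\<close> by (simp_all add: w_def y_def domain_V[OF MV(1)] codomain_V[OF MV(1)])
  obtain t z N where t: "t \<noteq> 0" and N: "N \<in> V"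
    and Nx: "N x = z - (\<phi> z / \<phi> w) *\<^sub>R w" and z: "x + t *\<^sub>R y = z + t *\<^sub>R N y"
    by (rule ex_perturbed_orbit_point[OF w y])
  let ?N = "N + (\<phi> z / \<phi> w / t) *\<^sub>R M"
  have "?N (x + t *\<^sub>R y) = N x + t *\<^sub>R N y + (\<phi> z / \<phi> w) *\<^sub>R w"
    using t
    by (simp add: linear_map_simps[OF linear_V[OF N]] MV(2) w_def
        linear_map_simps[OF linear_V[OF MV(1)]])
  also have "\<dots> = x + t *\<^sub>R y" by (simp add: Nx z)
  finally have "?N (x + t *\<^sub>R y) = x + t *\<^sub>R y" .
  moreover have "?N \<in> V"
    by (intro real_vector.subspace_add[OF subspace_V] real_vector.subspace_scale[OF subspace_V]
        N MV)
  ultimately have "x + t *\<^sub>R y = 0" using no_fixed_vector by blast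
  then have "M (x + t *\<^sub>R y) = 0" by (simp add: linear_0[OF linear_V[OF MV(1)]])
  then have "t *\<^sub>R w = 0"
    by (simp add: w_def MV(2) linear_map_simps[OF linear_V[OF MV(1)]])
  then show False using t w(2) linear_0[OF linear_\<phi>] by simp
qed

lemma Q_annihilator: "M \<in> annihilator V x \<Longrightarrow> Q (M v) = M v"
  using \<phi>_annihilator by (simp add: Q_def codomain_V annihilator_def)

lemma annihilator_Q: "M \<in> annihilator V x \<Longrightarrow> M (Q v) = M v"
  by (simp add: annihilator_def Q_def linear_map_simps[OF linear_V] domain_V)

lemma compression_annihilator: "compression Q ` annihilator V x = annihilator V x"
proof -
  have "compression Q M = M" if "M \<in> annihilator V x" for M
    using that by (simp add: compression_def Q_annihilator annihilator_Q)
  then show ?thesis by simp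
qed

sublocale ann: max_trivial_spectrum Q "annihilator V x"
  using ann.trivial_spectrum_quotient dim_annihilator unfolding compression_annihilator
  by (rule max_trivial_spectrumI)

lemma ex_orbit: "Q h = h \<Longrightarrow> \<exists>M\<in>V. M x = h"
  using line.\<delta>.in_range_iff[of h] unfolding orbit_eq[symmetric] orbit_def by blast

lemma Q_orbit: "M \<in> V \<Longrightarrow> Q (M x) = M x"
  using codomain_V \<phi>_orbit fixed_Q_iff by simp

end

lemma (in max_trivial_spectrum) ex_max_adapted_splitting:
  assumes "range P \<noteq> {0}"
  obtains x \<phi> where "max_adapted_splitting P V x \<phi>"
proof -
  obtain x \<phi> where "adapted_splitting P V x \<phi>" using assms by (rule ex_adapted_splitting)
  then show ?thesis using max_trivial_spectrum_axioms by (intro that max_adapted_splitting.intro)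
qed

section \<open>Invariant subspaces of the annihilator\<close>

locale reducible_annihilator = max_adapted_splitting P V x \<phi>
  for P :: "'a::real_vector \<Rightarrow> 'a" and V x \<phi> +
  fixes \<gamma> \<delta> :: "'a \<Rightarrow> 'a"
  assumes decomp_Q: "projector_decomp Q \<gamma> \<delta>"
    and ann_invariant: "M \<in> annihilator V x \<Longrightarrow> \<delta> (M (\<gamma> v)) = 0"
    and proper: "range \<gamma> \<noteq> range Q"
begin

sublocale red: max_invariant_decomp Q \<gamma> \<delta> "annihilator V x"
  by (intro max_invariant_decomp.intro invariant_decomp.intro invariant_decomp_axioms.intro
      decomp_Q ann.max_trivial_spectrum_axioms ann.trivial_spectrum_axioms ann_invariant)

lemma \<delta>x: "\<delta> x = 0"
  using red.proj_\<delta>(2)[of x] by (simp add: Qx linear_0[OF red.\<delta>.linear_proj])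

lemma fixed_\<gamma>_iff: "\<gamma> w = w \<longleftrightarrow> P w = w \<and> \<phi> w = 0 \<and> \<delta> w = 0"
  by (simp add: red.fixed_\<gamma>_iff fixed_Q_iff)

lemma homs_subset_V: "homs \<delta> \<gamma> \<subseteq> V"
  using red.homs_subset by (auto simp: annihilator_def)

text \<open>If \<open>\<delta> w \<noteq> 0\<close>, a rank one operator in \<open>homs \<delta> \<gamma>\<close> maps \<open>w\<close> to \<open>w - t M w\<close>; added to \<open>t M\<close>, it
  fixes \<open>w\<close>.\<close>

lemma \<delta>_eq_0_if_resolvent:
  assumes M: "M \<in> V" and w: "\<gamma> (w - t *\<^sub>R M w) = w - t *\<^sub>R M w"
  shows "\<delta> w = 0"
proof (rule ccontr)
  assume "\<delta> w \<noteq> 0"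
  then have "\<delta> w \<notin> {0}" by simp
  then obtain \<psi> :: "'a \<Rightarrow> real" where \<psi>: "linear \<psi>" "\<psi> (\<delta> w) = 1"
    by (rule separating_functional[OF real_vector.subspace_single_0])
  have "linear (\<lambda>v. \<psi> (\<delta> v))"
    by (rule linearI)
       (simp_all add: linear_map_simps[OF \<psi>(1)] linear_map_simps[OF red.\<delta>.linear_proj])
  then have "(\<lambda>v. \<psi> (\<delta> v) *\<^sub>R (w - t *\<^sub>R M w)) \<in> homs \<delta> \<gamma>"
    by (rule rank_one_in_homs[OF red.\<gamma>.linear_proj w]) (simp add: red.\<delta>.idem)
  then have "(\<lambda>v. \<psi> (\<delta> v) *\<^sub>R (w - t *\<^sub>R M w)) + t *\<^sub>R M \<in> V"
    using homs_subset_V real_vector.subspace_scale[OF subspace_V M]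
    by (intro real_vector.subspace_add[OF subspace_V]) auto
  moreover have "((\<lambda>v. \<psi> (\<delta> v) *\<^sub>R (w - t *\<^sub>R M w)) + t *\<^sub>R M) w = w" by (simp add: \<psi>(2))
  ultimately have "w = 0" by (rule no_fixed_vector)
  then show False using \<open>\<delta> w \<noteq> 0\<close> linear_0[OF red.\<delta>.linear_proj] by simp
qed

definition double_kernel :: "('a \<Rightarrow> 'a) \<Rightarrow> 'a set" where
  "double_kernel M = {w \<in> {w \<in> range P. \<delta> w = 0}. \<delta> (M w) = 0}"

lemma fin_dim_double_kernel:
  assumes "M \<in> V"
  shows "fin_dim (double_kernel M)"
proof -
  have "linear (\<lambda>w. \<delta> (M w))"
    using linear_compose[OF linear_V[OF assms] red.\<delta>.linear_proj] by (simp add: o_def)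
  then show ?thesis
    unfolding double_kernel_def by (intro fin_dim_kernel red.\<delta>.linear_proj fin_dim_range)
qed

lemma dim_double_kernel_le:
  assumes M: "M \<in> V" "\<delta> (M x) \<noteq> 0"
  shows "dim (double_kernel M) \<le> dim (range \<gamma>)"
proof -
  let ?L = "{w \<in> range P. \<delta> w = 0}"
  have L: "fin_dim ?L" using red.\<delta>.linear_proj fin_dim_range by (rule fin_dim_kernel)
  have x: "x \<in> ?L" "x \<notin> double_kernel M"
    using \<delta>x Px M(2) by (simp_all add: in_range_iff double_kernel_def)
  have "{w \<in> ?L. \<phi> w = 0} = range \<gamma>"
    using fixed_\<gamma>_iff in_range_iff red.\<gamma>.in_range_iff by blast
  then have "dim ?L = Suc (dim (range \<gamma>))"
    using dim_functional_kernel[OF linear_\<phi> L x(1)] \<phi>x by simp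
  moreover have sub: "double_kernel M \<subseteq> ?L" by (auto simp: double_kernel_def)
  have "\<not> dim ?L \<le> dim (double_kernel M)"
    using fin_dim_subspace_equal[OF L fin_dim_imp_subspace[OF fin_dim_double_kernel[OF M(1)]] sub] x
    by blast
  ultimately show ?thesis by simp
qed

text \<open>For \<open>t \<noteq> 0\<close> the preimage of \<open>range \<gamma>\<close> under \<open>1 - t M\<close> lies in \<open>double_kernel M\<close>, whose
  dimension is not larger. So the preimage does not depend on \<open>t\<close>; comparing \<open>t = 1\<close> with
  \<open>t = 2\<close> shows that it is \<open>range \<gamma>\<close> itself.\<close>

lemma resolvent_preimage_eq_double_kernel:
  assumes M: "M \<in> V" "\<delta> (M x) \<noteq> 0" and t: "t \<noteq> 0"
  shows "{w \<in> range P. w - t *\<^sub>R M w \<in> range \<gamma>} = double_kernel M"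
proof (rule fin_dim_subspace_equal[OF fin_dim_double_kernel[OF M(1)]])
  have G: "range \<gamma> \<subseteq> range P" using red.range_\<gamma>_subset line.range_\<delta>_subset by blast
  let ?S = "{w \<in> range P. w - t *\<^sub>R M w \<in> range \<gamma>}"
  show "lin_subspace ?S" by (rule subspace_resolvent_preimage[OF M(1) red.\<gamma>.subspace_range G])
  show "dim (double_kernel M) \<le> dim ?S"
    unfolding dim_resolvent_preimage[OF M(1) red.\<gamma>.subspace_range G]
    by (rule dim_double_kernel_le[OF M])
  show "?S \<subseteq> double_kernel M"
  proof
    fix w assume w: "w \<in> ?S"
    then have fixed: "\<gamma> (w - t *\<^sub>R M w) = w - t *\<^sub>R M w" using red.\<gamma>.in_range_iff by simp
    then have \<delta>w: "\<delta> w = 0" by (rule \<delta>_eq_0_if_resolvent[OF M(1)])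
    have "\<delta> (w - t *\<^sub>R M w) = 0" using fixed fixed_\<gamma>_iff by simp
    then have "\<delta> (M w) = 0"
      using \<delta>w t by (simp add: linear_map_simps[OF red.\<delta>.linear_proj])
    then show "w \<in> double_kernel M" using w \<delta>w by (simp add: double_kernel_def)
  qed
qed

lemma invariant_if_orbit_outside:
  assumes M: "M \<in> V" "\<delta> (M x) \<noteq> 0" and v: "v \<in> range \<gamma>"
  shows "M v \<in> range \<gamma>"
proof -
  note preimage = resolvent_preimage_eq_double_kernel[OF M]
  have resolvent: "w - t *\<^sub>R M w \<in> range \<gamma>" if "w \<in> double_kernel M" "t \<noteq> 0" for w t
    using preimage[OF that(2)] that(1) by blast
  have "double_kernel M \<subseteq> range \<gamma>"
  proof
    fix w assume w: "w \<in> double_kernel M"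
    have "2 *\<^sub>R (w - 1 *\<^sub>R M w) - (w - 2 *\<^sub>R M w) \<in> range \<gamma>"
      by (intro real_vector.subspace_diff[OF red.\<gamma>.subspace_range]
          real_vector.subspace_scale[OF red.\<gamma>.subspace_range] resolvent w) simp_all
    then show "w \<in> range \<gamma>" by (simp add: algebra_simps scaleR_2)
  qed
  moreover have "dim (double_kernel M) = dim (range \<gamma>)"
    using dim_resolvent_preimage[OF M(1) red.\<gamma>.subspace_range, of 1] preimage[of 1]
      red.range_\<gamma>_subset line.range_\<delta>_subset by simp
  ultimately have "double_kernel M = range \<gamma>"
    using fin_dim_imp_subspace[OF fin_dim_double_kernel[OF M(1)]]
    by (intro fin_dim_subspace_equal[OF red.\<gamma>.fin_dim_range]) simp_all
  then have "v - 1 *\<^sub>R M v \<in> range \<gamma>" using resolvent[of v 1] v by simp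
  then have "v - (v - 1 *\<^sub>R M v) \<in> range \<gamma>"
    by (rule real_vector.subspace_diff[OF red.\<gamma>.subspace_range v])
  then show ?thesis by simp
qed

lemma invariant_V:
  assumes M: "M \<in> V" and v: "v \<in> range \<gamma>"
  shows "M v \<in> range \<gamma>"
proof (cases "\<delta> (M x) = 0")
  case True
  have "range \<gamma> \<subset> range Q" using red.range_\<gamma>_subset proper by blast
  then obtain h where h: "Q h = h" "\<gamma> h \<noteq> h"
    using line.\<delta>.in_range_iff red.\<gamma>.in_range_iff by blast
  then obtain N where N: "N \<in> V" "N x = h" using ex_orbit by blast
  have \<delta>N: "\<delta> (N x) \<noteq> 0" using h N(2) red.fixed_\<gamma>_iff by simp
  moreover have "\<delta> ((M + N) x) = \<delta> (N x)" using True by (simp add: linear_add[OF red.\<delta>.linear_proj])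
  moreover have "M + N \<in> V" using subspace_V M N(1) by (rule real_vector.subspace_add)
  ultimately have "(M + N) v \<in> range \<gamma>"
    using invariant_if_orbit_outside[of "M + N", OF _ _ v] by simp
  moreover have "N v \<in> range \<gamma>" using \<delta>N by (rule invariant_if_orbit_outside[OF N(1) _ v])
  ultimately have "(M + N) v - N v \<in> range \<gamma>"
    by (rule real_vector.subspace_diff[OF red.\<gamma>.subspace_range])
  then show ?thesis by simp
next
  case False
  then show ?thesis by (rule invariant_if_orbit_outside[OF M _ v])
qed

end

section \<open>Skew operators\<close>

lemmas bilinear_simps = bilinear_ladd bilinear_radd bilinear_lsub bilinear_rsub bilinear_lmul
  bilinear_rmul bilinear_lzero bilinear_rzero

definition definite_on :: "('a::real_vector \<Rightarrow> 'a) \<Rightarrow> ('a \<Rightarrow> 'a \<Rightarrow> real) \<Rightarrow> bool" where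
  "definite_on P b \<longleftrightarrow> (\<forall>v. P v = v \<longrightarrow> b v v = 0 \<longrightarrow> v = 0)"

definition skew_ops :: "('a::real_vector \<Rightarrow> 'a) \<Rightarrow> ('a \<Rightarrow> 'a \<Rightarrow> real) \<Rightarrow> ('a \<Rightarrow> 'a) set" where
  "skew_ops P b = {M \<in> homs P P. \<forall>v. P v = v \<longrightarrow> b v (M v) = 0}"

lemma skew_opsI:
  assumes "M \<in> homs P P" "\<And>v. P v = v \<Longrightarrow> b v (M v) = 0"
  shows "M \<in> skew_ops P b"
  using assms unfolding skew_ops_def by blast

lemma skew_opsD:
  assumes "M \<in> skew_ops P b"
  shows "M \<in> homs P P" "P v = v \<Longrightarrow> b v (M v) = 0"
  using assms by (simp_all add: skew_ops_def)

lemma trivial_spectrum_skew_ops: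
  assumes P: "fin_projector P" and b: "bilinear b" "definite_on P b"
  shows "trivial_spectrum P (skew_ops P b)"
proof (intro trivial_spectrum.intro trivial_spectrum_axioms.intro P)
  interpret fin_projector P by (rule P)
  note homs = subspace_homs[OF linear_proj, of P]
  show "lin_subspace (skew_ops P b)"
  proof (rule real_vector.subspaceI)
    show "0 \<in> skew_ops P b"
      using real_vector.subspace_0[OF homs] by (rule skew_opsI) (simp add: bilinear_simps[OF b(1)])
    fix M assume M: "M \<in> skew_ops P b"
    show "M + N \<in> skew_ops P b" if "N \<in> skew_ops P b" for N
      using real_vector.subspace_add[OF homs skew_opsD(1)[OF M] skew_opsD(1)[OF that]]
      by (rule skew_opsI)
         (simp add: bilinear_simps[OF b(1)] skew_opsD(2)[OF M] skew_opsD(2)[OF that])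
    show "c *\<^sub>R M \<in> skew_ops P b" for c
      using real_vector.subspace_scale[OF homs skew_opsD(1)[OF M]]
      by (rule skew_opsI) (simp add: bilinear_simps[OF b(1)] skew_opsD(2)[OF M])
  qed
  show "skew_ops P b \<subseteq> homs P P" by (auto simp: skew_ops_def)
  fix M v assume M: "M \<in> skew_ops P b" and Mv: "M v = v"
  then have "P v = v" using homs_codomain[OF skew_opsD(1)[OF M], of v] by simp
  moreover from this have "b v v = 0" using skew_opsD(2)[OF M, of v] Mv by simp
  ultimately show "v = 0" using b(2) unfolding definite_on_def by blast
qed

lemma orbit_skew_ops:
  assumes P: "fin_projector P" and b: "bilinear b" "definite_on P b" and u: "P u = u" "u \<noteq> 0"
  shows "orbit (skew_ops P b) u = {w \<in> range P. b u w = 0}"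
proof
  interpret fin_projector P by (rule P)
  show "orbit (skew_ops P b) u \<subseteq> {w \<in> range P. b u w = 0}"
  proof
    fix w assume "w \<in> orbit (skew_ops P b) u"
    then obtain N where N: "N \<in> skew_ops P b" "w = N u" by (auto simp: orbit_def)
    then show "w \<in> {w \<in> range P. b u w = 0}"
      using homs_codomain[OF skew_opsD(1)[OF N(1)], of u] skew_opsD(2)[OF N(1) u(1)]
      by (simp add: in_range_iff)
  qed
  show "{w \<in> range P. b u w = 0} \<subseteq> orbit (skew_ops P b) u"
  proof
    fix w assume "w \<in> {w \<in> range P. b u w = 0}"
    then have w: "P w = w" "b u w = 0" by (simp_all add: in_range_iff)
    have uu: "b u u \<noteq> 0" using b(2) u unfolding definite_on_def by blast
    note simps = linear_map_simps[OF linear_proj]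
      bilinear_simps[OF b(1)]
    define N where "N z = (b (P z) u / b u u) *\<^sub>R w - (b (P z) w / b u u) *\<^sub>R u" for z
    have "linear N"
      unfolding N_def by (rule linearI) (simp_all add: simps add_divide_distrib algebra_simps)
    then have "N \<in> homs P P" by (rule homsI) (simp_all add: N_def simps idem u w)
    then have "N \<in> skew_ops P b" by (rule skew_opsI) (simp add: N_def simps)
    moreover have "w = N u" using uu u(1) w(2) by (simp add: N_def)
    ultimately show "w \<in> orbit (skew_ops P b) u" unfolding orbit_def by (intro image_eqI[of w _ N])
  qed
qed

section \<open>Extending the form from a hyperplane\<close>

lemma independent_pair_coeffs:
  fixes u v :: "'a::real_vector"
  assumes "u \<noteq> 0" "v \<notin> range (\<lambda>c. c *\<^sub>R u)" "a *\<^sub>R u + b *\<^sub>R v = 0"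
  shows "a = 0" "b = 0"
proof -
  show "b = 0"
  proof (rule ccontr)
    assume "b \<noteq> 0"
    have "b *\<^sub>R v = (- a) *\<^sub>R u" using assms(3) by (simp add: eq_neg_iff_add_eq_0 add.commute)
    then have "(1 / b) *\<^sub>R b *\<^sub>R v = (1 / b) *\<^sub>R (- a) *\<^sub>R u" by (rule arg_cong)
    then have "v = (- a / b) *\<^sub>R u" using \<open>b \<noteq> 0\<close> by simp
    then show False using assms(2) by blast
  qed
  then show "a = 0" using assms(1,3) by simp
qed

lemma linear_with_only_eigenvectors:
  fixes k :: "'a::real_vector \<Rightarrow> real"
  assumes add: "\<And>u v. u \<in> S \<Longrightarrow> v \<in> S \<Longrightarrow> k (u + v) *\<^sub>R (u + v) = k u *\<^sub>R u + k v *\<^sub>R v"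
    and scale: "\<And>c u. u \<in> S \<Longrightarrow> k (c *\<^sub>R u) *\<^sub>R (c *\<^sub>R u) = c *\<^sub>R (k u *\<^sub>R u)"
  shows "\<exists>c. \<forall>u\<in>S. k u *\<^sub>R u = c *\<^sub>R u"
proof (cases "S \<subseteq> {0}")
  case False
  then obtain w where w: "w \<in> S" "w \<noteq> 0" by blast
  have "k u *\<^sub>R u = k w *\<^sub>R u" if u: "u \<in> S" for u
  proof (cases "u \<in> range (\<lambda>c. c *\<^sub>R w)")
    case True
    then obtain c where "u = c *\<^sub>R w" by (rule rangeE)
    then show ?thesis using scale[OF w(1), of c] by (simp add: mult.commute)
  next
    case False
    have "(k (w + u) - k w) *\<^sub>R w + (k (w + u) - k u) *\<^sub>R u = 0"
      using add[OF w(1) u] by (simp add: algebra_simps)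
    then have "k (w + u) - k w = 0" "k (w + u) - k u = 0"
      by (rule independent_pair_coeffs[OF w(2) False])+
    then show ?thesis by simp
  qed
  then show ?thesis by blast
qed auto

lemma quadratic_with_only_eigenvectors:
  fixes r :: "'a::real_vector \<Rightarrow> real"
  assumes S: "lin_subspace S"
    and parallelogram: "\<And>u v. u \<in> S \<Longrightarrow> v \<in> S \<Longrightarrow>
      r (u + v) *\<^sub>R (u + v) + r (u - v) *\<^sub>R (u - v) = 2 *\<^sub>R (r u *\<^sub>R u) + 2 *\<^sub>R (r v *\<^sub>R v)"
    and scale: "\<And>c u. u \<in> S \<Longrightarrow> r (c *\<^sub>R u) *\<^sub>R (c *\<^sub>R u) = (c * c) *\<^sub>R (r u *\<^sub>R u)"
    and r0: "r 0 = 0" and u: "u \<in> S"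
  shows "r (c *\<^sub>R u) = c * r u" and "v \<in> S \<Longrightarrow> r (u + v) = r u + r v"
proof -
  have r_scale: "r (c *\<^sub>R u) = c * r u" if "u \<in> S" for c u
  proof (cases "c = 0 \<or> u = 0")
    case False
    then show ?thesis using scale[OF that, of c] by simp
  qed (use r0 in auto)
  then show "r (c *\<^sub>R u) = c * r u" using u .
  show "r (u + v) = r u + r v" if v: "v \<in> S"
  proof (cases "u = 0 \<or> v \<in> range (\<lambda>c. c *\<^sub>R u)")
    case True
    then consider "u = 0" | c where "v = c *\<^sub>R u" by blast
    then show ?thesis
    proof cases
      case 2
      then have "u + v = (1 + c) *\<^sub>R u" by (simp add: scaleR_add_left)
      then show ?thesis using r_scale[OF u] 2 by (simp add: distrib_right)
    qed (simp add: r0)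
  next
    case False
    have "(r (u + v) + r (u - v) - 2 * r u) *\<^sub>R u + (r (u + v) - r (u - v) - 2 * r v) *\<^sub>R v = 0"
      using parallelogram[OF u v] by (simp add: algebra_simps)
    moreover have "u \<noteq> 0" "v \<notin> range (\<lambda>c. c *\<^sub>R u)" using False by simp_all
    ultimately have "r (u + v) + r (u - v) - 2 * r u = 0" "r (u + v) - r (u - v) - 2 * r v = 0"
      by (rule independent_pair_coeffs[rotated 2])+
    then show ?thesis by simp
  qed
qed

text \<open>If \<open>\<rho>\<close> or \<open>\<alpha>\<close> did not vanish on the kernel of \<open>l\<close>, then \<open>\<alpha> l + \<rho>\<close> would take all values on the
  sets \<open>l = 0\<close> or \<open>l = 1\<close>.\<close>

lemma proportional_if_value_avoided:
  fixes l \<alpha> \<rho> :: "'a::real_vector \<Rightarrow> real"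
  assumes S: "lin_subspace S" and lin: "linear l" "linear \<alpha>" "linear \<rho>" and e: "e \<in> S" "l e = 1"
    and avoid: "\<And>m. m \<in> S \<Longrightarrow> \<alpha> m * l m + \<rho> m \<noteq> c" and m: "m \<in> S"
  shows "\<rho> m = \<rho> e * l m" and "\<alpha> m = \<alpha> e * l m"
proof -
  note simps = linear_add[OF lin(1)] linear_add[OF lin(2)] linear_add[OF lin(3)]
    linear_scale[OF lin(1)] linear_scale[OF lin(2)] linear_scale[OF lin(3)]
    linear_diff[OF lin(1)] linear_diff[OF lin(2)] linear_diff[OF lin(3)]
  define m0 where "m0 = m - l m *\<^sub>R e"
  have m0: "m0 \<in> S" "l m0 = 0"
    using S e m unfolding m0_def
    by (simp_all add: simps real_vector.subspace_diff real_vector.subspace_scale)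
  have "\<rho> m0 = 0"
  proof (rule ccontr)
    assume "\<rho> m0 \<noteq> 0"
    then show False
      using avoid[OF real_vector.subspace_scale[OF S m0(1), of "c / \<rho> m0"]]
      by (simp add: simps m0(2))
  qed
  then show "\<rho> m = \<rho> e * l m" by (simp add: m0_def simps mult.commute)
  have "\<alpha> m0 = 0"
  proof (rule ccontr)
    assume nonzero: "\<alpha> m0 \<noteq> 0"
    define s where "s = (c - \<alpha> e - \<rho> e) / \<alpha> m0"
    have "s *\<^sub>R m0 + e \<in> S"
      by (intro real_vector.subspace_add[OF S] real_vector.subspace_scale[OF S] m0(1) e(1))
    from avoid[OF this] show False
      using nonzero by (simp add: simps m0(2) e(2) \<open>\<rho> m0 = 0\<close> s_def)
  qed
  then show "\<alpha> m = \<alpha> e * l m" by (simp add: m0_def simps mult.commute)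
qed

locale skew_annihilator = max_adapted_splitting P V x \<phi>
  for P :: "'a::real_vector \<Rightarrow> 'a" and V x \<phi> +
  fixes q :: "'a \<Rightarrow> 'a \<Rightarrow> real"
  assumes bilinear_q: "bilinear q" and definite_q: "definite_on Q q"
    and annihilator_eq: "annihilator V x = skew_ops Q q"
begin

lemmas q_simps = bilinear_simps[OF bilinear_q]
lemmas \<phi>_simps = linear_map_simps[OF linear_\<phi>]
lemmas Q_simps = linear_map_simps[OF line.\<delta>.linear_proj]

lemma q_nonzero: "Q u = u \<Longrightarrow> u \<noteq> 0 \<Longrightarrow> q u u \<noteq> 0"
  using definite_q unfolding definite_on_def by blast

lemma q_eqI:
  assumes "Q u = u" "Q v = v" "\<And>M. M \<in> V \<Longrightarrow> q u (M x) = q v (M x)"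
  shows "u = v"
proof -
  have fixed: "Q (u - v) = u - v" by (simp add: Q_simps assms(1,2))
  then obtain M where "M \<in> V" "M x = u - v" using ex_orbit by blast
  then have "q (u - v) (u - v) = 0" using assms(3)[of M] by (simp add: q_simps)
  then have "u - v = 0" using q_nonzero[OF fixed] by blast
  then show ?thesis by simp
qed

text \<open>Otherwise \<open>M\<close> plus a suitable skew operator fixes \<open>\<phi> (M u) x + u\<close>.\<close>

lemma value_avoided:
  assumes M: "M \<in> V" and u: "Q u = u" "u \<noteq> 0"
  shows "\<phi> (M u) * q u (M x) + q u (Q (M u)) \<noteq> q u u"
proof
  assume eq: "\<phi> (M u) * q u (M x) + q u (Q (M u)) = q u u"
  define a where "a = \<phi> (M u)"
  define w where "w = u - a *\<^sub>R M x - Q (M u)"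
  have "w \<in> {w \<in> range Q. q u w = 0}"
    using eq u
    by (simp add: line.\<delta>.in_range_iff w_def a_def Q_simps Q_orbit[OF M] line.\<delta>.idem q_simps)
  then have "w \<in> orbit (annihilator V x) u"
    unfolding annihilator_eq
      orbit_skew_ops[OF line.\<delta>.fin_projector_axioms bilinear_q definite_q u] .
  then obtain N where N: "N \<in> V" "N x = 0" "N u = w" by (auto simp: orbit_def annihilator_def)
  have "M u - Q (M u) = a *\<^sub>R x" using codomain_V[OF M, of u] by (simp add: Q_def a_def)
  then have "(M + N) (a *\<^sub>R x + u) = a *\<^sub>R x + u"
    by (simp add: linear_map_simps[OF linear_V[OF M]]
        linear_map_simps[OF linear_V[OF N(1)]] N(2,3) w_def)
  then have "a *\<^sub>R x + u = 0"
    by (rule no_fixed_vector[OF real_vector.subspace_add[OF subspace_V M N(1)]])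
  then have "Q (a *\<^sub>R x + u) = 0" by (simp add: linear_0[OF line.\<delta>.linear_proj])
  then show False using u by (simp add: Q_simps Qx)
qed

lemma proportional:
  assumes u: "Q u = u"
  shows "\<exists>k. \<forall>M\<in>V. \<phi> (M u) = k * q u (M x)" and "\<exists>r. \<forall>M\<in>V. q u (Q (M u)) = r * q u (M x)"
proof (atomize (full), cases "u = 0")
  case True
  then show "(\<exists>k. \<forall>M\<in>V. \<phi> (M u) = k * q u (M x)) \<and> (\<exists>r. \<forall>M\<in>V. q u (Q (M u)) = r * q u (M x))"
    by (simp add: q_simps linear_0[OF linear_V] linear_0[OF linear_\<phi>])
next
  case False
  have "Q ((1 / q u u) *\<^sub>R u) = (1 / q u u) *\<^sub>R u" by (simp add: Q_simps u)
  then obtain N where N: "N \<in> V" "N x = (1 / q u u) *\<^sub>R u" using ex_orbit by blast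
  have "q u (N x) = 1" using q_nonzero[OF u False] by (simp add: N(2) q_simps)
  moreover have "linear (\<lambda>M. q u (M x))" "linear (\<lambda>M. \<phi> (M u))" "linear (\<lambda>M. q u (Q (M u)))"
    by (auto intro!: linearI simp: q_simps \<phi>_simps Q_simps)
  ultimately show "(\<exists>k. \<forall>M\<in>V. \<phi> (M u) = k * q u (M x)) \<and> (\<exists>r. \<forall>M\<in>V. q u (Q (M u)) = r * q u (M x))"
    using proportional_if_value_avoided[OF subspace_V, of "\<lambda>M. q u (M x)" "\<lambda>M. \<phi> (M u)"
        "\<lambda>M. q u (Q (M u))" N "q u u"] value_avoided[OF _ u False] N(1)
    by blast
qed

context
  fixes \<kappa> :: "'a \<Rightarrow> real"
  assumes \<kappa>: "\<And>M u. M \<in> V \<Longrightarrow> Q u = u \<Longrightarrow> \<phi> (M u) = \<kappa> u * q u (M x)"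
begin

lemma coefficient_add:
  assumes uv: "Q u = u" "Q v = v"
  shows "\<kappa> (u + v) *\<^sub>R (u + v) = \<kappa> u *\<^sub>R u + \<kappa> v *\<^sub>R v"
proof (rule q_eqI)
  have sum: "Q (u + v) = u + v" by (simp add: Q_simps uv)
  fix M assume M: "M \<in> V"
  have "q (\<kappa> (u + v) *\<^sub>R (u + v)) (M x) = \<phi> (M (u + v))" by (simp only: \<kappa>[OF M sum] q_simps) simp
  also have "\<dots> = \<phi> (M u) + \<phi> (M v)" by (simp only: linear_add[OF linear_V[OF M]] \<phi>_simps)
  also have "\<dots> = q (\<kappa> u *\<^sub>R u + \<kappa> v *\<^sub>R v) (M x)"
    by (simp only: \<kappa>[OF M uv(1)] \<kappa>[OF M uv(2)] q_simps) simp
  finally show "q (\<kappa> (u + v) *\<^sub>R (u + v)) (M x) = q (\<kappa> u *\<^sub>R u + \<kappa> v *\<^sub>R v) (M x)" .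
qed (simp_all add: Q_simps uv)

lemma coefficient_scaleR:
  assumes u: "Q u = u"
  shows "\<kappa> (c *\<^sub>R u) *\<^sub>R (c *\<^sub>R u) = c *\<^sub>R (\<kappa> u *\<^sub>R u)"
proof (rule q_eqI)
  have fixed: "Q (c *\<^sub>R u) = c *\<^sub>R u" by (simp add: Q_simps u)
  fix M assume M: "M \<in> V"
  have "q (\<kappa> (c *\<^sub>R u) *\<^sub>R (c *\<^sub>R u)) (M x) = \<phi> (M (c *\<^sub>R u))"
    by (simp only: \<kappa>[OF M fixed] q_simps) simp
  also have "\<dots> = c * \<phi> (M u)" by (simp add: linear_scale[OF linear_V[OF M]] \<phi>_simps)
  also have "\<dots> = q (c *\<^sub>R (\<kappa> u *\<^sub>R u)) (M x)" by (simp only: \<kappa>[OF M u] q_simps) simp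
  finally show "q (\<kappa> (c *\<^sub>R u) *\<^sub>R (c *\<^sub>R u)) (M x) = q (c *\<^sub>R (\<kappa> u *\<^sub>R u)) (M x)" .
qed (simp_all add: Q_simps u)

end

lemma ex_coefficient:
  obtains k where "\<forall>M\<in>V. \<forall>u. Q u = u \<longrightarrow> \<phi> (M u) = k * q u (M x)"
proof -
  have "\<forall>u. \<exists>k. Q u = u \<longrightarrow> (\<forall>M\<in>V. \<phi> (M u) = k * q u (M x))"
    using proportional(1) by blast
  then obtain \<kappa> where "\<forall>u. Q u = u \<longrightarrow> (\<forall>M\<in>V. \<phi> (M u) = \<kappa> u * q u (M x))"
    by (rule exE[OF choice])
  then have \<kappa>: "\<phi> (M u) = \<kappa> u * q u (M x)" if "M \<in> V" "Q u = u" for M u using that by blast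
  have "\<exists>c. \<forall>u\<in>range Q. \<kappa> u *\<^sub>R u = c *\<^sub>R u"
    using coefficient_add[OF \<kappa>] coefficient_scaleR[OF \<kappa>]
    by (intro linear_with_only_eigenvectors) (simp_all add: line.\<delta>.in_range_iff)
  then obtain k where k: "\<forall>u\<in>range Q. \<kappa> u *\<^sub>R u = k *\<^sub>R u" by (rule exE)
  have "\<phi> (M u) = k * q u (M x)" if "M \<in> V" "Q u = u" for M u
  proof -
    have "\<kappa> u *\<^sub>R u = k *\<^sub>R u" using k that(2) line.\<delta>.in_range_iff by blast
    then have "q (\<kappa> u *\<^sub>R u) (M x) = q (k *\<^sub>R u) (M x)" by (rule arg_cong)
    then show ?thesis using \<kappa>[OF that] by (simp add: q_simps)
  qed
  then show ?thesis using that[of k] by blast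
qed

context
  fixes \<rho> :: "'a \<Rightarrow> real"
  assumes \<rho>: "\<And>M u. M \<in> V \<Longrightarrow> Q u = u \<Longrightarrow> q u (Q (M u)) = \<rho> u * q u (M x)"
begin

lemma ratio_parallelogram:
  assumes uv: "Q u = u" "Q v = v"
  shows "\<rho> (u + v) *\<^sub>R (u + v) + \<rho> (u - v) *\<^sub>R (u - v) = 2 *\<^sub>R (\<rho> u *\<^sub>R u) + 2 *\<^sub>R (\<rho> v *\<^sub>R v)"
    (is "?l = ?r")
proof (rule q_eqI)
  have fixed: "Q (u + v) = u + v" "Q (u - v) = u - v" by (simp_all add: Q_simps uv)
  fix M assume M: "M \<in> V"
  have "q ?l (M x) = \<rho> (u + v) * q (u + v) (M x) + \<rho> (u - v) * q (u - v) (M x)"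
    by (simp only: q_simps real_scaleR_def)
  also have "\<dots> = q (u + v) (Q (M (u + v))) + q (u - v) (Q (M (u - v)))"
    by (simp only: \<rho>[OF M fixed(1)] \<rho>[OF M fixed(2)])
  also have "\<dots> = 2 * q u (Q (M u)) + 2 * q v (Q (M v))"
    by (simp add: linear_map_simps[OF linear_V[OF M]] Q_simps q_simps)
  also have "\<dots> = q ?r (M x)" by (simp only: \<rho>[OF M uv(1)] \<rho>[OF M uv(2)] q_simps) simp
  finally show "q ?l (M x) = q ?r (M x)" .
qed (simp_all add: Q_simps uv)

lemma ratio_scaleR:
  assumes u: "Q u = u"
  shows "\<rho> (c *\<^sub>R u) *\<^sub>R (c *\<^sub>R u) = (c * c) *\<^sub>R (\<rho> u *\<^sub>R u)" (is "?l = ?r")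
proof (rule q_eqI)
  have fixed: "Q (c *\<^sub>R u) = c *\<^sub>R u" by (simp add: Q_simps u)
  fix M assume M: "M \<in> V"
  have "q ?l (M x) = \<rho> (c *\<^sub>R u) * q (c *\<^sub>R u) (M x)" by (simp only: q_simps real_scaleR_def)
  also have "\<dots> = q (c *\<^sub>R u) (Q (M (c *\<^sub>R u)))" by (simp only: \<rho>[OF M fixed])
  also have "\<dots> = c * c * q u (Q (M u))"
    by (simp add: linear_scale[OF linear_V[OF M]] Q_simps q_simps)
  also have "\<dots> = q ?r (M x)" by (simp only: \<rho>[OF M u] q_simps) simp
  finally show "q ?l (M x) = q ?r (M x)" .
qed (simp_all add: Q_simps u)

end

lemma ex_ratio:
  obtains R where "linear R" "\<forall>v. R (Q v) = R v"
    "\<forall>M\<in>V. \<forall>u. Q u = u \<longrightarrow> q u (Q (M u)) = R u * q u (M x)"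
proof -
  have "\<forall>u. \<exists>r. (Q u = u \<longrightarrow> (\<forall>M\<in>V. q u (Q (M u)) = r * q u (M x))) \<and> (u = 0 \<longrightarrow> r = 0)"
    using proportional(2) by (metis mult_eq_0_iff q_simps(7))
  then obtain \<rho> where
    "\<forall>u. (Q u = u \<longrightarrow> (\<forall>M\<in>V. q u (Q (M u)) = \<rho> u * q u (M x))) \<and> (u = 0 \<longrightarrow> \<rho> u = 0)"
    by (rule exE[OF choice])
  then have \<rho>0: "\<rho> 0 = 0" and "\<forall>u. Q u = u \<longrightarrow> (\<forall>M\<in>V. q u (Q (M u)) = \<rho> u * q u (M x))"
    by blast+
  then have \<rho>: "q u (Q (M u)) = \<rho> u * q u (M x)" if "M \<in> V" "Q u = u" for M u using that by blast
  note additive = quadratic_with_only_eigenvectors[OF line.\<delta>.subspace_range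
      ratio_parallelogram[OF \<rho>] ratio_scaleR[OF \<rho>] \<rho>0, unfolded line.\<delta>.in_range_iff]
  have "linear (\<lambda>v. \<rho> (Q v))" by (rule linearI) (simp_all add: Q_simps additive line.\<delta>.idem)
  moreover have "\<rho> (Q (Q v)) = \<rho> (Q v)" for v by (simp add: line.\<delta>.idem)
  moreover have "q u (Q (M u)) = \<rho> (Q u) * q u (M x)" if "M \<in> V" "Q u = u" for M u
    using \<rho>[OF that] that(2) by simp
  ultimately show ?thesis by (intro that[of "\<lambda>v. \<rho> (Q v)"]) simp_all
qed

end

locale skew_extension = skew_annihilator P V x \<phi> q
  for P :: "'a::real_vector \<Rightarrow> 'a" and V x \<phi> q +
  fixes k :: real and R :: "'a \<Rightarrow> real"
  assumes k: "k \<noteq> 0" and linear_R: "linear R" and RQ: "R (Q v) = R v"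
    and \<phi>_coefficient: "M \<in> V \<Longrightarrow> Q u = u \<Longrightarrow> \<phi> (M u) = k * q u (M x)"
    and q_ratio: "M \<in> V \<Longrightarrow> Q u = u \<Longrightarrow> q u (Q (M u)) = R u * q u (M x)"
begin

definition extended_form :: "'a \<Rightarrow> 'a \<Rightarrow> real" where
  "extended_form v w = q (Q v) (Q w) - (\<phi> v + R v) * \<phi> w / k"

lemma bilinear_extended_form: "bilinear extended_form"
  unfolding bilinear_def extended_form_def
  by (auto intro!: linearI simp: Q_simps \<phi>_simps q_simps linear_map_simps[OF linear_R]
      add_divide_distrib algebra_simps)

lemma definite_extended_form: "definite_on P extended_form"
  unfolding definite_on_def
proof (intro allI impI)
  fix v assume v: "P v = v" "extended_form v v = 0"
  define u where "u = Q v"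
  have u: "Q u = u" by (simp add: u_def line.\<delta>.idem)
  have eq: "q u u = (\<phi> v + R u) * \<phi> v / k" using v(2) by (simp add: extended_form_def u_def RQ)
  have u0: "u = 0"
  proof (rule ccontr)
    assume nonzero: "u \<noteq> 0"
    define h where "h = (\<phi> v / k / q u u) *\<^sub>R u"
    have "Q h = h" and quh: "q u h = \<phi> v / k"
      using u q_nonzero[OF u nonzero] by (simp_all add: h_def Q_simps q_simps)
    then obtain M where M: "M \<in> V" "M x = h" using ex_orbit by blast
    have "\<phi> (M u) * q u (M x) + q u (Q (M u)) = k * (\<phi> v / k) * (\<phi> v / k) + R u * (\<phi> v / k)"
      by (simp only: \<phi>_coefficient[OF M(1) u] q_ratio[OF M(1) u] M(2) quh)
    also have "\<dots> = q u u" unfolding eq using k by (simp add: field_simps)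
    finally show False using value_avoided[OF M(1) u nonzero] by blast
  qed
  then have "\<phi> v = 0" using eq k linear_0[OF linear_R] by (simp add: q_simps)
  then show "v = 0" using v(1) u0 by (simp add: u_def Q_def)
qed

lemma V_eq_skew_ops: "V = skew_ops P extended_form"
proof (rule superset_eq)
  show "trivial_spectrum P (skew_ops P extended_form)"
    by (rule trivial_spectrum_skew_ops[OF fin_projector_axioms bilinear_extended_form
          definite_extended_form])
  show "V \<subseteq> skew_ops P extended_form"
  proof
    fix M assume M: "M \<in> V"
    have "M \<in> homs P P" using V_homs M by blast
    then show "M \<in> skew_ops P extended_form"
    proof (rule skew_opsI)
      fix v assume v: "P v = v"
      define u where "u = Q v"
      have u: "Q u = u" by (simp add: u_def line.\<delta>.idem)
      have "v = u + \<phi> v *\<^sub>R x" using v by (simp add: u_def Q_def)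
      then have "M v = M (u + \<phi> v *\<^sub>R x)" by (rule arg_cong)
      then have Mv: "M v = M u + \<phi> v *\<^sub>R M x"
        by (simp add: linear_map_simps[OF linear_V[OF M]])
      have \<phi>Mv: "\<phi> (M v) = k * q u (M x)"
        using \<phi>_coefficient[OF M u] by (simp add: Mv \<phi>_simps \<phi>_orbit[OF M])
      have "q u (Q (M v)) = (\<phi> v + R v) * q u (M x)"
        using q_ratio[OF M u] RQ[of v]
        by (simp add: Mv Q_simps q_simps Q_orbit[OF M] u_def distrib_right)
      then show "extended_form v (M v) = 0"
        using k by (simp add: extended_form_def \<phi>Mv u_def)
    qed
  qed
qed

end

definition reducible :: "('a::real_vector \<Rightarrow> 'a) \<Rightarrow> ('a \<Rightarrow> 'a) set \<Rightarrow> bool" where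
  "reducible P V \<longleftrightarrow>
     (\<exists>G. lin_subspace G \<and> G \<subseteq> range P \<and> G \<noteq> {0} \<and> G \<noteq> range P \<and> (\<forall>M\<in>V. \<forall>v\<in>G. M v \<in> G))"

definition skew_type :: "('a::real_vector \<Rightarrow> 'a) \<Rightarrow> ('a \<Rightarrow> 'a) set \<Rightarrow> bool" where
  "skew_type P V \<longleftrightarrow> (\<exists>b. bilinear b \<and> definite_on P b \<and> V = skew_ops P b)"

lemma (in fin_projector) reducibleE:
  assumes "reducible P V"
  obtains \<gamma> \<delta> where "projector_decomp P \<gamma> \<delta>" "range \<gamma> \<noteq> {0}" "range \<gamma> \<noteq> range P"
    "\<forall>M\<in>V. \<forall>v. \<delta> (M (\<gamma> v)) = 0"
proof -
  obtain G where G: "lin_subspace G" "G \<subseteq> range P" "G \<noteq> {0}" "G \<noteq> range P"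
    and invariant: "\<forall>M\<in>V. \<forall>v\<in>G. M v \<in> G"
    using assms unfolding reducible_def by (elim exE conjE)
  obtain \<gamma> \<delta> where splitting: "projector_decomp P \<gamma> \<delta>" and G_eq: "range \<gamma> = G"
    by (rule ex_projector_decomp[OF G(1,2)])
  interpret projector_decomp P \<gamma> \<delta> by (rule splitting)
  have "\<delta> (M (\<gamma> v)) = 0" if "M \<in> V" for M v
  proof -
    have "M (\<gamma> v) \<in> range \<gamma>" using invariant that by (simp add: G_eq[symmetric])
    then show ?thesis using fixed_\<gamma>_iff \<gamma>.in_range_iff by simp
  qed
  then show ?thesis using that[OF splitting] G(3,4) by (simp add: G_eq)
qed

lemma (in skew_annihilator) skew_type_if_coefficient:
  assumes "k \<noteq> 0" "\<forall>M\<in>V. \<forall>u. Q u = u \<longrightarrow> \<phi> (M u) = k * q u (M x)"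
  shows "skew_type P V"
proof -
  obtain R where R: "linear R" "\<forall>v. R (Q v) = R v"
    "\<forall>M\<in>V. \<forall>u. Q u = u \<longrightarrow> q u (Q (M u)) = R u * q u (M x)" by (rule ex_ratio)
  interpret skew_extension P V x \<phi> q k R
    using assms R
    by (intro skew_extension.intro skew_extension_axioms.intro skew_annihilator_axioms) simp_all
  show ?thesis
    unfolding skew_type_def
    by (intro exI[of _ extended_form] conjI bilinear_extended_form definite_extended_form
        V_eq_skew_ops)
qed

lemma (in skew_annihilator) reducible_or_skew_type: "reducible P V \<or> skew_type P V"
proof -
  obtain k where k: "\<forall>M\<in>V. \<forall>u. Q u = u \<longrightarrow> \<phi> (M u) = k * q u (M x)" by (rule ex_coefficient)
  consider (nonzero) "k \<noteq> 0" | (line) "range Q = {0}" | (invariant) "k = 0" "range Q \<noteq> {0}" by blast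
  then show ?thesis
  proof cases
    case nonzero
    then show ?thesis using skew_type_if_coefficient[OF _ k] by blast
  next
    case line
    then have zero: "u = 0" if "Q u = u" for u using that line.\<delta>.in_range_iff by blast
    have "\<phi> (M u) = 1 * q u (M x)" if "M \<in> V" "Q u = u" for M u
      unfolding zero[OF that(2)]
      using linear_0[OF linear_V[OF that(1)]] linear_0[OF linear_\<phi>] by (simp add: q_simps)
    then have "skew_type P V" by (intro skew_type_if_coefficient[of 1]) simp_all
    then show ?thesis ..
  next
    case invariant
    have "\<forall>M\<in>V. \<forall>u\<in>range Q. M u \<in> range Q"
    proof (intro ballI)
      fix M u assume M: "M \<in> V" and "u \<in> range Q"
      then have "\<phi> (M u) = 0" using k M invariant(1) by (simp add: line.\<delta>.in_range_iff)
      then show "M u \<in> range Q" using codomain_V[OF M] by (simp add: range_Q in_range_iff)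
    qed
    then have "reducible P V"
      unfolding reducible_def
      using line.\<delta>.subspace_range psubset_imp_subset[OF range_Q_psubset] invariant(2)
        less_imp_neq[OF range_Q_psubset]
      by (intro exI[of _ "range Q"] conjI)
    then show ?thesis ..
  qed
qed

lemma (in max_adapted_splitting) reducible_if_annihilator_reducible:
  assumes "reducible Q (annihilator V x)"
  shows "reducible P V"
proof -
  obtain \<gamma> \<delta> where splitting: "projector_decomp Q \<gamma> \<delta>"
    and nonzero: "range \<gamma> \<noteq> {0}" and smaller: "range \<gamma> \<noteq> range Q"
    and invariant: "\<forall>M\<in>annihilator V x. \<forall>v. \<delta> (M (\<gamma> v)) = 0"
    using assms by (rule line.\<delta>.reducibleE)
  interpret reducible_annihilator P V x \<phi> \<gamma> \<delta>
    using invariant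
    by (intro reducible_annihilator.intro reducible_annihilator_axioms.intro
        max_adapted_splitting_axioms splitting smaller) simp
  have "range \<gamma> \<subseteq> range P" "range \<gamma> \<noteq> range P"
    using red.range_\<gamma>_subset range_Q_psubset by auto
  moreover have "\<forall>M\<in>V. \<forall>v\<in>range \<gamma>. M v \<in> range \<gamma>" using invariant_V by (intro ballI)
  ultimately show ?thesis
    unfolding reducible_def using red.\<gamma>.subspace_range nonzero
    by (intro exI[of _ "range \<gamma>"] conjI)
qed

theorem max_trivial_spectrum_reducible_or_skew:
  assumes "max_trivial_spectrum P V"
  shows "reducible P V \<or> skew_type P V"
  using assms
proof (induction "dim (range P)" arbitrary: P V)
  case 0
  then interpret max_trivial_spectrum P V by simp
  have "range P = {0}" using 0 fin_dim_eq_zero_iff[OF fin_dim_range] by simp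
  then have P0: "P v = 0" for v by (metis rangeI singletonD)
  define b :: "'a \<Rightarrow> 'a \<Rightarrow> real" where "b v w = 0" for v w
  have b: "bilinear b" by (auto simp: bilinear_def b_def intro: linearI)
  have definite: "definite_on P b" by (simp add: definite_on_def P0)
  have "V \<subseteq> skew_ops P b" using V_homs by (auto simp: skew_ops_def b_def)
  then have "V = skew_ops P b"
    using trivial_spectrum_skew_ops[OF fin_projector_axioms b definite]
    by (rule superset_eq[rotated])
  then show ?case unfolding skew_type_def using b definite by (intro disjI2 exI[of _ b] conjI)
next
  case (Suc n)
  then interpret max_trivial_spectrum P V by simp
  have "range P \<noteq> {0}" using Suc.hyps(2) by (metis dim_zero nat.distinct(1))
  then obtain x \<phi> where "max_adapted_splitting P V x \<phi>" by (rule ex_max_adapted_splitting)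
  then interpret max_adapted_splitting P V x \<phi> .
  have n: "n = dim (range Q)" using dim_range_Q Suc.hyps(2) by simp
  consider (reducible) "reducible Q (annihilator V x)" | (skew) "skew_type Q (annihilator V x)"
    using Suc.hyps(1)[OF n ann.max_trivial_spectrum_axioms] by (rule disjE)
  then show ?case
  proof cases
    case reducible
    then show ?thesis by (intro disjI1 reducible_if_annihilator_reducible)
  next
    case skew
    then obtain q where "bilinear q" "definite_on Q q" "annihilator V x = skew_ops Q q"
      unfolding skew_type_def by (elim exE conjE)
    then interpret skew_annihilator P V x \<phi> q
      by (intro skew_annihilator.intro skew_annihilator_axioms.intro max_adapted_splitting_axioms)
    show ?thesis by (rule reducible_or_skew_type)
  qed
qed

section \<open>Joins of spaces of matrices\<close>

abbreviation mat_subspace :: "nat \<Rightarrow> real mat set \<Rightarrow> bool" where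
  "mat_subspace n W \<equiv> VectorSpace.subspace class_ring W (module_mat TYPE(real) n n)"

lemma mat_subspaceD:
  assumes "mat_subspace n W"
  shows "W \<subseteq> carrier_mat n n" "0\<^sub>m n n \<in> W" "A \<in> W \<Longrightarrow> B \<in> W \<Longrightarrow> A + B \<in> W" "A \<in> W \<Longrightarrow> c \<cdot>\<^sub>m A \<in> W"
proof -
  interpret vectorspace class_ring "module_mat TYPE(real) n n" by (rule matrix_vs)
  have "submodule class_ring W (module_mat TYPE(real) n n)"
    using assms by (rule VectorSpace.subspace.submod)
  then show "W \<subseteq> carrier_mat n n" "0\<^sub>m n n \<in> W" "A \<in> W \<Longrightarrow> B \<in> W \<Longrightarrow> A + B \<in> W" "A \<in> W \<Longrightarrow> c \<cdot>\<^sub>m A \<in> W"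
    unfolding submodule_def by (auto simp: module_mat_simps class_ring_simps)
qed

lemma mat_subspaceI:
  assumes "W \<subseteq> carrier_mat n n" "0\<^sub>m n n \<in> W" "\<And>A B. A \<in> W \<Longrightarrow> B \<in> W \<Longrightarrow> A + B \<in> W"
    and "\<And>c A. A \<in> W \<Longrightarrow> c \<cdot>\<^sub>m A \<in> W"
  shows "mat_subspace n W"
proof -
  interpret vectorspace class_ring "module_mat TYPE(real) n n" by (rule matrix_vs)
  have "submodule class_ring W (module_mat TYPE(real) n n)"
    unfolding submodule_def using assms module_axioms
    by (auto simp: module_mat_simps class_ring_simps)
  then show ?thesis by (rule VectorSpace.subspace.intro[OF vectorspace_axioms])
qed

lemma skew_mats_carrier: "A \<in> skew_mats n \<Longrightarrow> A \<in> carrier_mat n n"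
  by (simp add: skew_mats_def)

lemma skew_mats_entry:
  assumes "A \<in> skew_mats n" "i < n" "j < n"
  shows "A $$ (j, i) = - A $$ (i, j)"
proof -
  have "transpose_mat A $$ (i, j) = (- A) $$ (i, j)" using assms(1) by (simp add: skew_mats_def)
  then show ?thesis using skew_mats_carrier[OF assms(1)] assms(2,3) by simp
qed

lemma skew_matsI:
  assumes A: "A \<in> carrier_mat n n" and skew: "\<And>i j. i < n \<Longrightarrow> j < n \<Longrightarrow> A $$ (j, i) = - A $$ (i, j)"
  shows "A \<in> skew_mats n"
proof -
  have "transpose_mat A = - A"
  proof (rule eq_matI)
    fix i j assume "i < dim_row (- A)" "j < dim_col (- A)"
    then have "i < n" "j < n" using A by auto
    then show "transpose_mat A $$ (i, j) = (- A) $$ (i, j)" using A skew[of i j] by simp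
  qed (use A in auto)
  then show ?thesis using A by (simp add: skew_mats_def)
qed

lemma mat_subspace_skew_mats: "mat_subspace n (skew_mats n)"
proof (rule mat_subspaceI)
  show "skew_mats n \<subseteq> carrier_mat n n" using skew_mats_carrier by blast
  show "0\<^sub>m n n \<in> skew_mats n" by (rule skew_matsI) simp_all
  fix A assume A: "A \<in> skew_mats n"
  note A_carrier = skew_mats_carrier[OF A]
  show "c \<cdot>\<^sub>m A \<in> skew_mats n" for c
  proof (rule skew_matsI)
    fix i j assume ij: "i < n" "j < n"
    show "(c \<cdot>\<^sub>m A) $$ (j, i) = - (c \<cdot>\<^sub>m A) $$ (i, j)"
      using A_carrier ij skew_mats_entry[OF A ij] by simp
  qed (simp add: A_carrier)
  show "A + B \<in> skew_mats n" if B: "B \<in> skew_mats n" for B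
  proof (rule skew_matsI)
    fix i j assume ij: "i < n" "j < n"
    show "(A + B) $$ (j, i) = - (A + B) $$ (i, j)"
      using A_carrier skew_mats_carrier[OF B] ij skew_mats_entry[OF A ij] skew_mats_entry[OF B ij]
      by simp
  qed (simp add: A_carrier skew_mats_carrier[OF B])
qed

lemma mat_subspace_join_mats:
  assumes A: "mat_subspace a A" and B: "mat_subspace b B"
  shows "mat_subspace (a + b) (join_mats a b A B)"
proof (rule mat_subspaceI)
  note A = mat_subspaceD[OF A] and B = mat_subspaceD[OF B]
  show "join_mats a b A B \<subseteq> carrier_mat (a + b) (a + b)"
    using A(1) B(1) by (auto simp: join_mats_def intro!: four_block_carrier_mat)
  have join: "four_block_mat M X (0\<^sub>m b a) N \<in> join_mats a b A B"
    if "M \<in> A" "X \<in> carrier_mat a b" "N \<in> B" for M X N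
    using that unfolding join_mats_def by blast
  show "0\<^sub>m (a + b) (a + b) \<in> join_mats a b A B" using join[OF A(2) zero_carrier_mat B(2)] by simp
  fix Y assume "Y \<in> join_mats a b A B"
  then obtain M X N where Y: "Y = four_block_mat M X (0\<^sub>m b a) N"
    and M: "M \<in> A" "M \<in> carrier_mat a a" and X: "X \<in> carrier_mat a b"
    and N: "N \<in> B" "N \<in> carrier_mat b b"
    using A(1) B(1) unfolding join_mats_def by blast
  show "c \<cdot>\<^sub>m Y \<in> join_mats a b A B" for c
  proof -
    have "c \<cdot>\<^sub>m Y = four_block_mat (c \<cdot>\<^sub>m M) (c \<cdot>\<^sub>m X) (0\<^sub>m b a) (c \<cdot>\<^sub>m N)"
      using smult_four_block_mat[OF M(2) X zero_carrier_mat N(2)] by (simp add: Y)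
    then show ?thesis using join[OF A(4)[OF M(1)] _ B(4)[OF N(1)]] X by simp
  qed
  show "Y + Y' \<in> join_mats a b A B" if "Y' \<in> join_mats a b A B" for Y'
  proof -
    from that obtain M' X' N' where Y': "Y' = four_block_mat M' X' (0\<^sub>m b a) N'"
      and M': "M' \<in> A" "M' \<in> carrier_mat a a" and X': "X' \<in> carrier_mat a b"
      and N': "N' \<in> B" "N' \<in> carrier_mat b b"
      using A(1) B(1) unfolding join_mats_def by blast
    have "Y + Y' = four_block_mat (M + M') (X + X') (0\<^sub>m b a) (N + N')"
      using add_four_block_mat[OF M(2) X zero_carrier_mat N(2) M'(2) X' zero_carrier_mat N'(2)]
      by (simp add: Y Y')
    then show ?thesis using join[OF A(3)[OF M(1) M'(1)] _ B(3)[OF N(1) N'(1)]] X X' by simp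
  qed
qed

lemma mat_subspace_skew_join: "mat_subspace (sum_list ns) (skew_join ns)"
proof (induction ns)
  case Nil
  show ?case by (rule mat_subspaceI) auto
next
  case (Cons m ms)
  then show ?case using mat_subspace_join_mats[OF mat_subspace_skew_mats] by simp
qed

lemma one_in_translate_skew_join:
  "1\<^sub>m (sum_list ns) \<in> translate_mat (1\<^sub>m (sum_list ns)) (skew_join ns)"
proof -
  have "(1\<^sub>m (sum_list ns) :: real mat) = 1\<^sub>m (sum_list ns) + 0\<^sub>m (sum_list ns) (sum_list ns)"
    by simp
  then show ?thesis
    unfolding translate_mat_def using mat_subspaceD(2)[OF mat_subspace_skew_join] by blast
qed

lemma join_mats_empty:
  assumes "W \<subseteq> carrier_mat k k"
  shows "join_mats 0 k (carrier_mat 0 0) W = W"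
proof -
  have block: "four_block_mat A B (0\<^sub>m k 0) C = C"
    if "A \<in> carrier_mat 0 0" "C \<in> carrier_mat k k" for A B C :: "real mat"
    using that by (intro eq_matI) auto
  show ?thesis
  proof
    show "join_mats 0 k (carrier_mat 0 0) W \<subseteq> W" using block assms by (auto simp: join_mats_def)
    show "W \<subseteq> join_mats 0 k (carrier_mat 0 0) W"
    proof
      fix C assume C: "C \<in> W"
      then have "four_block_mat (0\<^sub>m 0 0) (0\<^sub>m 0 k) (0\<^sub>m k 0) C = C" using block assms by auto
      then show "C \<in> join_mats 0 k (carrier_mat 0 0) W"
        unfolding join_mats_def using C
        by (metis (mono_tags, lifting) mem_Collect_eq zero_carrier_mat)
    qed
  qed
qed

lemma skew_join_append:
  "skew_join (as @ bs) = join_mats (sum_list as) (sum_list bs) (skew_join as) (skew_join bs)"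
proof (induction as)
  case Nil
  then show ?case using join_mats_empty[OF skew_join_carrier] by simp
next
  case (Cons a as)
  have "skew_mats a \<subseteq> carrier_mat a a" by (auto simp: skew_mats_def)
  then show ?case
    using Cons skew_join_carrier[of as] skew_join_carrier[of bs] by (simp add: join_mats_assoc)
qed

lemma join_mats_translate_one:
  assumes X: "X \<subseteq> carrier_mat a a" and Y: "Y \<subseteq> carrier_mat b b"
  shows "join_mats a b (translate_mat (1\<^sub>m a) X) (translate_mat (1\<^sub>m b) Y) =
         translate_mat (1\<^sub>m (a + b)) (join_mats a b X Y)" (is "?l = ?r")
proof -
  let ?block = "\<lambda>A B C. four_block_mat A B (0\<^sub>m b a) C"
  have block: "?block (1\<^sub>m a + A) B (1\<^sub>m b + C) = 1\<^sub>m (a + b) + ?block A B C"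
    if "A \<in> X" "B \<in> carrier_mat a b" "C \<in> Y" for A B C
    using that subsetD[OF X that(1)] subsetD[OF Y that(3)] by (intro eq_matI) auto
  have "?l = {?block (1\<^sub>m a + A) B (1\<^sub>m b + C) |A B C. A \<in> X \<and> B \<in> carrier_mat a b \<and> C \<in> Y}"
    unfolding join_mats_def translate_mat_def by blast
  also have "\<dots> = {1\<^sub>m (a + b) + ?block A B C |A B C. A \<in> X \<and> B \<in> carrier_mat a b \<and> C \<in> Y}"
    by (intro Collect_cong) (metis (no_types, lifting) block)
  also have "\<dots> = ?r" unfolding join_mats_def translate_mat_def by blast
  finally show ?thesis .
qed

section \<open>Matrix form\<close>

definition one_plus_mat ::
    "nat \<Rightarrow> (nat \<Rightarrow> 'a::real_vector) \<Rightarrow> (nat \<Rightarrow> 'a \<Rightarrow> real) \<Rightarrow> ('a \<Rightarrow> 'a) \<Rightarrow> real mat" where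
  "one_plus_mat n s r M = mat n n (\<lambda>(i, j). r i (s j + M (s j)))"

text \<open>The family \<open>s\<close> is not required to be a basis, nor \<open>r\<close> to be one of the dual space: this is
  automatic as the identity matrix occurs.\<close>

definition has_skew_form :: "('a::real_vector \<Rightarrow> 'a) \<Rightarrow> ('a \<Rightarrow> 'a) set \<Rightarrow> nat list \<Rightarrow> bool" where
  "has_skew_form P V ns \<longleftrightarrow> (\<exists>s r. (\<forall>j<sum_list ns. P (s j) = s j) \<and> (\<forall>i. linear (r i)) \<and>
     one_plus_mat (sum_list ns) s r ` V = translate_mat (1\<^sub>m (sum_list ns)) (skew_join ns))"

lemma has_skew_formE:
  assumes "has_skew_form P V ns"
  obtains s r where "\<forall>j<sum_list ns. P (s j) = s j" "\<forall>i. linear (r i)"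
    "one_plus_mat (sum_list ns) s r ` V = translate_mat (1\<^sub>m (sum_list ns)) (skew_join ns)"
  using assms unfolding has_skew_form_def by (elim exE conjE)

definition rank_one_sum ::
    "nat \<Rightarrow> nat \<Rightarrow> (nat \<Rightarrow> 'b::real_vector) \<Rightarrow> (nat \<Rightarrow> 'a \<Rightarrow> real) \<Rightarrow> (nat \<Rightarrow> nat \<Rightarrow> real) \<Rightarrow> 'a \<Rightarrow> 'b" where
  "rank_one_sum m n t d K v = (\<Sum>j<n. \<Sum>i<m. (K i j * d j v) *\<^sub>R t i)"

lemma rank_one_sum_in_homs:
  assumes Q: "linear Q" "\<And>i. i < m \<Longrightarrow> Q (t i) = t i"
    and d: "\<And>j. linear (d j)" "\<And>j v. d j (P v) = d j v"
  shows "rank_one_sum m n t d K \<in> homs P Q"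
proof (rule homsI)
  show "linear (rank_one_sum m n t d K)"
    unfolding rank_one_sum_def
    by (rule linearI)
       (simp_all add: linear_map_simps[OF d(1)] algebra_simps sum.distrib
         scaleR_sum_right)
  show "Q (rank_one_sum m n t d K v) = rank_one_sum m n t d K v" for v
    unfolding rank_one_sum_def by (simp add: linear_sum[OF Q(1)] linear_scale[OF Q(1)] Q(2))
  show "rank_one_sum m n t d K (P v) = rank_one_sum m n t d K v" for v
    unfolding rank_one_sum_def by (simp only: d(2))
qed

lemma rank_one_sum_entry:
  assumes r: "linear r" "\<And>i. i < m \<Longrightarrow> r (t i) = (if i = l then 1 else 0)" "l < m"
    and d: "\<And>j. j < n \<Longrightarrow> d j v = (if j = k then 1 else 0)" "k < n"
  shows "r (rank_one_sum m n t d K v) = K l k"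
proof -
  have "r (rank_one_sum m n t d K v) = (\<Sum>j<n. \<Sum>i<m. K i j * d j v * r (t i))"
    unfolding rank_one_sum_def by (simp add: linear_sum[OF r(1)] linear_scale[OF r(1)])
  also have "\<dots> = (\<Sum>j<n. \<Sum>i<m. if i = l then (if j = k then K l k else 0) else 0)"
    by (intro sum.cong refl) (simp add: r(2) d(1))
  also have "\<dots> = K l k" using r(3) d(2) by simp
  finally show ?thesis .
qed

subsection \<open>Matrices of skew operators\<close>

lemma definite_positive_or_negative:
  assumes P: "fin_projector P" and b: "bilinear b" "definite_on P b"
  shows "(\<forall>v. P v = v \<longrightarrow> v \<noteq> 0 \<longrightarrow> 0 < b v v) \<or> (\<forall>v. P v = v \<longrightarrow> v \<noteq> 0 \<longrightarrow> b v v < 0)"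
proof (rule ccontr)
  interpret fin_projector P by (rule P)
  note b_simps = bilinear_simps[OF b(1)]
  assume "\<not> ?thesis"
  then obtain v w where v: "P v = v" "0 \<le> b v v" "v \<noteq> 0" and w: "P w = w" "b w w \<le> 0" "w \<noteq> 0"
    by (auto simp: not_less)
  then have signs: "0 < b v v" "b w w < 0" using b(2) unfolding definite_on_def by force+
  then have "b w w * b v v < 0" by (simp add: mult_neg_pos)
  then have "0 < discrim (b w w) (b v w + b w v) (b v v)"
    unfolding discrim_def using zero_le_power2[of "b v w + b w v"] by linarith
  then obtain t where "b w w * t\<^sup>2 + (b v w + b w v) * t + b v v = 0"
    using discriminant_pos_ex[of "b w w" "b v w + b w v" "b v v"] signs(2) by auto
  then have "b (v + t *\<^sub>R w) (v + t *\<^sub>R w) = 0"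
    by (simp add: b_simps power2_eq_square algebra_simps)
  moreover have "P (v + t *\<^sub>R w) = v + t *\<^sub>R w"
    by (simp add: linear_map_simps[OF linear_proj] v w)
  ultimately have "v + t *\<^sub>R w = 0" using b(2) unfolding definite_on_def by blast
  then have "v = (- t) *\<^sub>R w" by (simp add: eq_neg_iff_add_eq_0)
  then have "b v v = b ((- t) *\<^sub>R w) ((- t) *\<^sub>R w)" by (rule arg_cong[of _ _ "\<lambda>u. b u u"])
  also have "\<dots> = t * t * b w w" by (simp only: b_simps) simp
  finally have "b v v = t * t * b w w" .
  then show False using signs mult_nonneg_nonpos[of "t * t" "b w w"] by simp
qed

definition orthonormal_basis ::
    "('a::real_vector \<Rightarrow> 'a \<Rightarrow> real) \<Rightarrow> 'a set \<Rightarrow> nat \<Rightarrow> (nat \<Rightarrow> 'a) \<Rightarrow> bool" where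
  "orthonormal_basis c E n s \<longleftrightarrow> (\<forall>i<n. s i \<in> E) \<and>
     (\<forall>i<n. \<forall>j<n. c (s i) (s j) = (if i = j then 1 else 0)) \<and> (\<forall>v\<in>E. v = (\<Sum>i<n. c (s i) v *\<^sub>R s i))"

lemma orthonormal_basis_extend:
  assumes c: "bilinear c" "\<And>u v. c u v = c v u" and E: "lin_subspace E"
    and z: "z \<in> E" "c z z = 1" and s: "orthonormal_basis c {w \<in> E. c z w = 0} n s"
  shows "orthonormal_basis c E (Suc n) (s(n := z))"
proof -
  note c_simps = bilinear_simps[OF c(1)]
  have sE: "s i \<in> E" "c z (s i) = 0" "c (s i) z = 0" if "i < n" for i
    using s that c(2)[of z "s i"] by (simp_all add: orthonormal_basis_def)
  have ss: "c (s i) (s j) = (if i = j then 1 else 0)" if "i < n" "j < n" for i j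
    using s that by (simp add: orthonormal_basis_def)
  have "v = (\<Sum>i<Suc n. c ((s(n := z)) i) v *\<^sub>R (s(n := z)) i)" if v: "v \<in> E" for v
  proof -
    define w where "w = v - c z v *\<^sub>R z"
    have "w \<in> {w \<in> E. c z w = 0}"
      using v z E by (simp add: w_def c_simps real_vector.subspace_diff real_vector.subspace_scale)
    then have "w = (\<Sum>i<n. c (s i) w *\<^sub>R s i)" using s unfolding orthonormal_basis_def by blast
    also have "\<dots> = (\<Sum>i<n. c (s i) v *\<^sub>R s i)"
      by (rule sum.cong) (simp_all add: w_def c_simps sE)
    finally have "v - c z v *\<^sub>R z = (\<Sum>i<n. c (s i) v *\<^sub>R s i)" unfolding w_def .
    then have "v = (\<Sum>i<n. c (s i) v *\<^sub>R s i) + c z v *\<^sub>R z" by (simp only: diff_eq_eq)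
    also have "\<dots> = (\<Sum>i<Suc n. c ((s(n := z)) i) v *\<^sub>R (s(n := z)) i)" by simp
    finally show ?thesis .
  qed
  moreover have "\<forall>i<Suc n. (s(n := z)) i \<in> E"
    "\<forall>i<Suc n. \<forall>j<Suc n. c ((s(n := z)) i) ((s(n := z)) j) = (if i = j then 1 else 0)"
    using sE ss z by (simp_all add: less_Suc_eq)
  ultimately show ?thesis unfolding orthonormal_basis_def by (intro conjI ballI)
qed

lemma ex_orthonormal_basis:
  assumes c: "bilinear c" "\<And>u v. c u v = c v u"
    and "fin_dim E" "\<And>v. v \<in> E \<Longrightarrow> v \<noteq> 0 \<Longrightarrow> 0 < c v v"
  shows "\<exists>s. orthonormal_basis c E (dim E) s"
  using assms(3,4)
proof (induction "dim E" arbitrary: E)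
  case 0
  then have "E = {0}" using fin_dim_eq_zero_iff[of E] by simp
  then show ?case by (simp add: orthonormal_basis_def dim_zero)
next
  case (Suc n)
  have E: "lin_subspace E" using Suc.prems(1) by (rule fin_dim_imp_subspace)
  have "E \<noteq> {0}" using Suc.hyps(2) by (metis dim_zero nat.distinct(1))
  then obtain w where w: "w \<in> E" "w \<noteq> 0" using real_vector.subspace_0[OF E] by blast
  define z where "z = (1 / sqrt (c w w)) *\<^sub>R w"
  have z: "z \<in> E" "c z z = 1"
    using w Suc.prems(2)[OF w] real_vector.subspace_scale[OF E w(1)]
    by (simp_all add: z_def bilinear_simps[OF c(1)])
  have linear_z: "linear (c z)" using c(1) by (simp add: bilinear_def)
  have fin: "fin_dim {w \<in> E. c z w = 0}" using linear_z Suc.prems(1) by (rule fin_dim_kernel)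
  have n: "n = dim {w \<in> E. c z w = 0}"
    using dim_functional_kernel[OF linear_z Suc.prems(1) z(1)] z(2) Suc.hyps(2) by simp
  have "\<exists>s. orthonormal_basis c {w \<in> E. c z w = 0} n s"
    unfolding n using Suc.prems(2) by (intro Suc.hyps(1)[OF n fin]) simp
  then obtain s where "orthonormal_basis c {w \<in> E. c z w = 0} n s" by (rule exE)
  then have "orthonormal_basis c E (Suc n) (s(n := z))" by (rule orthonormal_basis_extend[OF c E z])
  then show ?case unfolding Suc.hyps(2)[symmetric] by blast
qed

lemma sum_skew_eq_0:
  fixes a :: "nat \<Rightarrow> real"
  assumes "\<And>i j. i < n \<Longrightarrow> j < n \<Longrightarrow> K j i = - K i j"
  shows "(\<Sum>i<n. \<Sum>j<n. a i * a j * K i j) = 0" (is "?T = 0")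
proof -
  have "?T = (\<Sum>i<n. \<Sum>j<n. a j * a i * K j i)" by (rule sum.swap)
  also have "\<dots> = (\<Sum>i<n. \<Sum>j<n. - (a i * a j * K i j))"
  proof (intro sum.cong refl)
    fix i j assume "i \<in> {..<n}" "j \<in> {..<n}"
    then show "a j * a i * K j i = - (a i * a j * K i j)" using assms[of i j] by simp
  qed
  finally have "?T = - ?T" by (simp add: sum_negf)
  then show ?thesis by simp
qed

lemma bilinear_symmetric_part:
  fixes b :: "'a::real_vector \<Rightarrow> 'a \<Rightarrow> real"
  assumes "bilinear b"
  shows "bilinear (\<lambda>u v. (b u v + b v u) / 2)"
  unfolding bilinear_def
  by (auto intro!: linearI simp: bilinear_simps[OF assms] algebra_simps add_divide_distrib)

locale orthonormal_frame = fin_projector P for P :: "'a::real_vector \<Rightarrow> 'a" +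
  fixes b c :: "'a \<Rightarrow> 'a \<Rightarrow> real" and s :: "nat \<Rightarrow> 'a" and n :: nat
  assumes bilinear_b: "bilinear b" and positive: "P v = v \<Longrightarrow> v \<noteq> 0 \<Longrightarrow> 0 < b v v"
    and c_def: "c = (\<lambda>u v. (b u v + b v u) / 2)" and s: "orthonormal_basis c (range P) n s"
begin

lemmas b_simps = bilinear_simps[OF bilinear_b]

lemma linear_b: "linear (b u)" "linear (\<lambda>u. b u v)"
  using bilinear_b by (simp_all add: bilinear_def)

lemma bilinear_c: "bilinear c"
  unfolding c_def using bilinear_b by (rule bilinear_symmetric_part)

lemma linear_c: "linear (c u)"
  using bilinear_c by (simp add: bilinear_def)

lemma s_fixed: "i < n \<Longrightarrow> P (s i) = s i"
  using s by (simp add: orthonormal_basis_def in_range_iff)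

lemma s_orthonormal: "i < n \<Longrightarrow> j < n \<Longrightarrow> c (s i) (s j) = (if i = j then 1 else 0)"
  using s by (simp add: orthonormal_basis_def)

lemma expansion:
  assumes "P v = v"
  shows "(\<Sum>i<n. c (s i) v *\<^sub>R s i) = v"
proof -
  have "v \<in> range P" using assms by (simp add: in_range_iff)
  then have "v = (\<Sum>i<n. c (s i) v *\<^sub>R s i)" using s unfolding orthonormal_basis_def by blast
  then show ?thesis by (rule sym)
qed

lemma coordinate: "k < n \<Longrightarrow> c (s k) (\<Sum>i<n. a i *\<^sub>R s i) = a k"
  by (simp add: linear_sum[OF linear_c] linear_scale[OF linear_c] s_orthonormal if_distrib
      cong: if_cong)

lemma b_symmetric_part: "i < n \<Longrightarrow> j < n \<Longrightarrow> b (s i) (s j) + b (s j) (s i) = (if i = j then 2 else 0)"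
  using s_orthonormal[of i j] by (simp add: c_def split: if_splits)

lemma b_expand_left: "P v = v \<Longrightarrow> b v w = (\<Sum>i<n. c (s i) v * b (s i) w)"
  using arg_cong[OF expansion[of v], of "\<lambda>u. b u w"]
  by (simp add: linear_sum[OF linear_b(2)] b_simps)

lemma ex_dual_vector:
  assumes j: "j < n"
  shows "\<exists>t. P t = t \<and> (\<forall>i<n. b (s i) t = (if i = j then 1 else 0))"
proof -
  define B where "B v = (\<Sum>i<n. b (s i) v *\<^sub>R s i)" for v
  have linear_B: "linear B"
    unfolding B_def
    by (rule linearI) (simp_all add: b_simps scaleR_add_left sum.distrib scaleR_sum_right)
  have "B ` range P = range P"
  proof (rule inj_endomorphism_image_eq[OF linear_B fin_dim_range])
    show "B ` range P \<subseteq> range P"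
      by (rule image_subsetI)
         (simp add: in_range_iff B_def linear_sum[OF linear_proj] linear_scale[OF linear_proj]
           s_fixed)
    fix v assume "v \<in> range P" "B v = 0"
    then have v: "P v = v" "\<And>i. i < n \<Longrightarrow> b (s i) v = 0"
      using coordinate[of _ "\<lambda>i. b (s i) v"] bilinear_simps(8)[OF bilinear_c]
      by (simp_all add: in_range_iff B_def)
    then have "b v v = 0" by (simp add: b_expand_left[OF v(1)])
    then show "v = 0" using positive[OF v(1)] by fastforce
  qed
  moreover have "s j \<in> range P" using s_fixed[OF j] by (simp add: in_range_iff)
  ultimately obtain t where t: "t \<in> range P" "s j = B t" by (metis imageE)
  have "b (s i) t = (if i = j then 1 else 0)" if "i < n" for i
    using coordinate[OF that, of "\<lambda>i. b (s i) t"] s_orthonormal[OF that j] t(2) by (simp add: B_def)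
  then show ?thesis using t(1) in_range_iff by blast
qed

lemma skew_op_entries:
  assumes M: "M \<in> skew_ops P b" and ij: "i < n" "j < n"
  shows "b (s j) (M (s i)) = - b (s i) (M (s j))"
proof -
  note skew = skew_opsD(2)[OF M]
  have "P (s i + s j) = s i + s j" using s_fixed ij by (simp add: linear_add[OF linear_proj])
  then have "b (s i + s j) (M (s i + s j)) = 0" "b (s i) (M (s i)) = 0" "b (s j) (M (s j)) = 0"
    using skew s_fixed ij by blast+
  then show ?thesis by (simp add: linear_add[OF homs_linear[OF skew_opsD(1)[OF M]]] b_simps)
qed

lemma ex_skew_op_with_entries:
  assumes K: "\<And>i j. i < n \<Longrightarrow> j < n \<Longrightarrow> K j i = - K i j"
  shows "\<exists>M\<in>skew_ops P b. \<forall>i<n. \<forall>j<n. b (s i) (M (s j)) = K i j"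
proof -
  have "\<forall>j\<in>{..<n}. \<exists>t. P t = t \<and> (\<forall>i<n. b (s i) t = (if i = j then 1 else 0))"
    using ex_dual_vector by simp
  then obtain t where "\<forall>j\<in>{..<n}. P (t j) = t j \<and> (\<forall>i<n. b (s i) (t j) = (if i = j then 1 else 0))"
    by (rule exE[OF bchoice])
  then have t: "P (t j) = t j" "i < n \<Longrightarrow> b (s i) (t j) = (if j = i then 1 else 0)" if "j < n" for i j
    using that by simp_all
  define d where "d j v = c (s j) (P v)" for j v
  have linear_d: "linear (d j)" for j
    using linear_compose[OF linear_proj linear_c] by (simp add: d_def[abs_def] o_def)
  have dP: "d j (P v) = d j v" for j v by (simp add: d_def idem)
  define M where "M = rank_one_sum n n t d K"
  have "M \<in> homs P P"
    unfolding M_def using t(1) linear_d dP by (intro rank_one_sum_in_homs linear_proj)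
  then have "M \<in> skew_ops P b"
  proof (rule skew_opsI)
    fix v assume v: "P v = v"
    have b_t: "b v (t i) = c (s i) v" if i: "i < n" for i
    proof -
      have "b v (t i) = (\<Sum>l<n. if l = i then c (s i) v else 0)"
        unfolding b_expand_left[OF v] by (intro sum.cong refl) (simp add: t(2)[OF i])
      then show ?thesis using i by simp
    qed
    have "b v (M v) = (\<Sum>j<n. \<Sum>i<n. K i j * c (s j) v * c (s i) v)"
      by (simp add: M_def rank_one_sum_def linear_sum[OF linear_b(1)] b_simps b_t d_def v)
    also have "\<dots> = (\<Sum>j<n. \<Sum>i<n. c (s j) v * c (s i) v * K i j)" by (simp add: mult_ac)
    also have "\<dots> = 0" by (rule sum_skew_eq_0) (rule K)
    finally show "b v (M v) = 0" .
  qed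
  moreover have "b (s i) (M (s j)) = K i j" if "i < n" "j < n" for i j
    unfolding M_def
    by (rule rank_one_sum_entry[OF linear_b(1)])
       (use that t(2) s_fixed s_orthonormal in \<open>simp_all add: d_def\<close>)
  ultimately show ?thesis by blast
qed

lemma one_plus_mat_skew_ops:
  "one_plus_mat n s (\<lambda>i. b (s i)) ` skew_ops P b = translate_mat (1\<^sub>m n) (skew_mats n)"
proof
  show "one_plus_mat n s (\<lambda>i. b (s i)) ` skew_ops P b \<subseteq> translate_mat (1\<^sub>m n) (skew_mats n)"
  proof (rule image_subsetI)
    fix M assume M: "M \<in> skew_ops P b"
    define A where "A = mat n n (\<lambda>(i, j). b (s i) (s j + M (s j)) - (if i = j then 1 else 0))"
    have "one_plus_mat n s (\<lambda>i. b (s i)) M = 1\<^sub>m n + A"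
      unfolding one_plus_mat_def A_def by (intro eq_matI) auto
    moreover have "A \<in> skew_mats n"
    proof (rule skew_matsI)
      fix i j assume ij: "i < n" "j < n"
      show "A $$ (j, i) = - A $$ (i, j)"
        using skew_op_entries[OF M ij] b_symmetric_part[OF ij] ij
        by (simp add: A_def b_simps split: if_splits)
    qed (simp add: A_def)
    ultimately show "one_plus_mat n s (\<lambda>i. b (s i)) M \<in> translate_mat (1\<^sub>m n) (skew_mats n)"
      unfolding translate_mat_def by blast
  qed
  show "translate_mat (1\<^sub>m n) (skew_mats n) \<subseteq> one_plus_mat n s (\<lambda>i. b (s i)) ` skew_ops P b"
  proof
    fix Z assume "Z \<in> translate_mat (1\<^sub>m n) (skew_mats n)"
    then obtain A where A: "A \<in> skew_mats n" "Z = 1\<^sub>m n + A" unfolding translate_mat_def by blast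
    define K where "K i j = A $$ (i, j) + (if i = j then 1 else 0) - b (s i) (s j)" for i j
    have "K j i = - K i j" if "i < n" "j < n" for i j
      using skew_mats_entry[OF A(1) that] b_symmetric_part[OF that]
      by (simp add: K_def split: if_splits)
    then obtain M where M: "M \<in> skew_ops P b" "\<forall>i<n. \<forall>j<n. b (s i) (M (s j)) = K i j"
      using ex_skew_op_with_entries[of K] by blast
    have "Z = one_plus_mat n s (\<lambda>i. b (s i)) M"
      unfolding A(2) one_plus_mat_def
      using skew_mats_carrier[OF A(1)] M(2) by (intro eq_matI) (auto simp: b_simps K_def)
    then show "Z \<in> one_plus_mat n s (\<lambda>i. b (s i)) ` skew_ops P b" using M(1) by (rule image_eqI)
  qed
qed

end

lemma has_skew_form_positive:
  assumes P: "fin_projector P" and b: "bilinear b" "\<forall>v. P v = v \<longrightarrow> v \<noteq> 0 \<longrightarrow> 0 < b v v"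
  shows "has_skew_form P (skew_ops P b) [dim (range P)]"
proof -
  interpret fin_projector P by (rule P)
  define c where "c = (\<lambda>u v. (b u v + b v u) / 2)"
  have "bilinear c" unfolding c_def using b(1) by (rule bilinear_symmetric_part)
  moreover have "c u v = c v u" for u v by (simp add: c_def add.commute)
  moreover have "0 < c v v" if "v \<in> range P" "v \<noteq> 0" for v
    using that b(2) by (simp add: c_def in_range_iff)
  ultimately obtain s where s: "orthonormal_basis c (range P) (dim (range P)) s"
    using ex_orthonormal_basis[OF _ _ fin_dim_range, of c] by blast
  interpret orthonormal_frame P b c s "dim (range P)"
    by (intro orthonormal_frame.intro orthonormal_frame_axioms.intro P b(1) b(2)[rule_format]
        c_def s)
  have "\<forall>i. linear (b (s i))" "\<forall>j<sum_list [dim (range P)]. P (s j) = s j"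
    using linear_b(1) s_fixed by simp_all
  then show ?thesis
    unfolding has_skew_form_def using one_plus_mat_skew_ops
    by (intro exI[of _ s] exI[of _ "\<lambda>i. b (s i)"])
       (simp add: skew_join_singleton del: skew_join.simps)
qed

lemma has_skew_form_skew_ops:
  assumes P: "fin_projector P" and b: "bilinear b" "definite_on P b"
  shows "has_skew_form P (skew_ops P b) [dim (range P)]"
proof -
  consider (positive) "\<forall>v. P v = v \<longrightarrow> v \<noteq> 0 \<longrightarrow> 0 < b v v"
    | (negative) "\<forall>v. P v = v \<longrightarrow> v \<noteq> 0 \<longrightarrow> b v v < 0"
    using definite_positive_or_negative[OF assms] by blast
  then show ?thesis
  proof cases
    case positive
    then show ?thesis by (rule has_skew_form_positive[OF P b(1)])
  next
    case negative
    have "bilinear (\<lambda>u v. - b u v)"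
      unfolding bilinear_def by (auto intro!: linearI simp: bilinear_simps[OF b(1)])
    then have "has_skew_form P (skew_ops P (\<lambda>u v. - b u v)) [dim (range P)]"
      by (rule has_skew_form_positive[OF P]) (use negative in simp)
    then show ?thesis by (simp add: skew_ops_def)
  qed
qed

subsection \<open>Block triangular spaces\<close>

locale block_frames = projector_decomp P \<gamma> \<delta> for P \<gamma> \<delta> :: "'a::real_vector \<Rightarrow> 'a" +
  fixes A B :: "('a \<Rightarrow> 'a) set" and a b :: nat and s1 s2 :: "nat \<Rightarrow> 'a" and r1 r2 :: "nat \<Rightarrow> 'a \<Rightarrow> real"
  assumes A: "A \<subseteq> homs \<gamma> \<gamma>" and B: "B \<subseteq> homs \<delta> \<delta>"
    and s1: "j < a \<Longrightarrow> \<gamma> (s1 j) = s1 j" and s2: "j < b \<Longrightarrow> \<delta> (s2 j) = s2 j"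
    and linear_r1: "linear (r1 i)" and linear_r2: "linear (r2 i)"
    and one_A: "1\<^sub>m a \<in> one_plus_mat a s1 r1 ` A" and one_B: "1\<^sub>m b \<in> one_plus_mat b s2 r2 ` B"
begin

definition s :: "nat \<Rightarrow> 'a" where
  "s j = (if j < a then s1 j else s2 (j - a))"

definition r :: "nat \<Rightarrow> 'a \<Rightarrow> real" where
  "r i v = (if i < a then r1 i (\<gamma> v) else r2 (i - a) (\<delta> v))"

lemma s_fixed: "j < a + b \<Longrightarrow> P (s j) = s j"
  using s1[of j] s2[of "j - a"] fixed_\<gamma>_iff fixed_\<delta>_iff by (auto simp: s_def)

lemma linear_r: "linear (r i)"
  using linear_compose[OF \<gamma>.linear_proj linear_r1[of i]]
    linear_compose[OF \<delta>.linear_proj linear_r2[of "i - a"]]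
  by (cases "i < a") (simp_all add: r_def[abs_def] o_def)

lemma one_plus_mat_blocks:
  assumes M: "M \<in> A" and N: "N \<in> B" and X: "X \<in> homs \<delta> \<gamma>"
  shows "one_plus_mat (a + b) s r (M + N + X) =
    four_block_mat (one_plus_mat a s1 r1 M) (mat a b (\<lambda>(i, j). r1 i (X (s2 j)))) (0\<^sub>m b a)
      (one_plus_mat b s2 r2 N)" (is "?L = ?R")
proof (rule eq_matI)
  note M = homsD[OF subsetD[OF A M]] and N = homsD[OF subsetD[OF B N]] and X = homsD[OF X]
  have \<gamma>_images: "\<gamma> (M v) = M v" "\<gamma> (N v) = 0" "\<gamma> (X v) = X v" for v
    using M(2) X(2) \<gamma>\<delta>[of "N v"] N(2) by simp_all
  have \<delta>_images: "\<delta> (M v) = 0" "\<delta> (N v) = N v" "\<delta> (X v) = 0" for v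
    using N(2) \<delta>\<gamma>[of "M v"] \<delta>\<gamma>[of "X v"] M(2) X(2) by simp_all
  have on_s1: "\<delta> (s1 j) = 0" "N (s1 j) = 0" "X (s1 j) = 0" if "j < a" for j
    using \<delta>\<gamma>[of "s1 j"] N(3)[of "s1 j"] X(3)[of "s1 j"] s1[OF that]
    by (simp_all add: linear_0[OF N(1)] linear_0[OF X(1)])
  have on_s2: "\<gamma> (s2 j) = 0" "M (s2 j) = 0" if "j < b" for j
    using \<gamma>\<delta>[of "s2 j"] M(3)[of "s2 j"] s2[OF that] by (simp_all add: linear_0[OF M(1)])
  fix i j assume "i < dim_row ?R" "j < dim_col ?R"
  then have "i < a + b" "j < a + b" by (simp_all add: one_plus_mat_def)
  then show "?L $$ (i, j) = ?R $$ (i, j)"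
    by (cases "i < a"; cases "j < a")
       (simp_all add: one_plus_mat_def s_def r_def linear_add[OF \<gamma>.linear_proj]
         linear_add[OF \<delta>.linear_proj] \<gamma>_images \<delta>_images on_s1 on_s2 s1 s2 linear_0[OF linear_r2])
qed (simp_all add: one_plus_mat_def)

lemma ex_dual_vectors:
  obtains t where "\<forall>i<a. \<gamma> (t i) = t i" "\<forall>i<a. \<forall>l<a. r1 l (t i) = (if i = l then 1 else 0)"
proof -
  obtain M where M: "1\<^sub>m a = one_plus_mat a s1 r1 M" "M \<in> A" using one_A by (rule imageE)
  have "\<gamma> (s1 i + M (s1 i)) = s1 i + M (s1 i)" if "i < a" for i
    using homs_codomain[OF subsetD[OF A M(2)]] s1[OF that]
    by (simp add: linear_add[OF \<gamma>.linear_proj])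
  moreover have "r1 l (s1 i + M (s1 i)) = (if i = l then 1 else 0)" if "i < a" "l < a" for i l
    using arg_cong[OF M(1), of "\<lambda>Z. Z $$ (l, i)"] that
    by (cases "i = l") (simp_all add: one_plus_mat_def)
  ultimately show ?thesis by (intro that[of "\<lambda>i. s1 i + M (s1 i)"]) simp_all
qed

lemma ex_dual_functionals:
  obtains d where "\<forall>j. linear (d j)" "\<forall>j v. d j (\<delta> v) = d j v"
    "\<forall>j<b. \<forall>k<b. d j (s2 k) = (if j = k then (1::real) else 0)"
proof -
  obtain N where N: "1\<^sub>m b = one_plus_mat b s2 r2 N" "N \<in> B" using one_B by (rule imageE)
  note homs = homsD[OF subsetD[OF B N(2)]]
  define d where "d j v = r2 j (\<delta> v + N v)" for j v
  have "linear (d j)" for j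
    unfolding d_def
    by (rule linearI)
       (simp_all add: linear_map_simps[OF \<delta>.linear_proj]
         linear_map_simps[OF homs(1)] linear_map_simps[OF linear_r2] algebra_simps)
  moreover have "d j (\<delta> v) = d j v" for j v by (simp add: d_def \<delta>.idem homs(3))
  moreover have "d j (s2 k) = (if j = k then 1 else 0)" if "j < b" "k < b" for j k
    using arg_cong[OF N(1), of "\<lambda>Z. Z $$ (j, k)"] that by (simp add: one_plus_mat_def d_def s2)
  ultimately show ?thesis by (intro that[of d]) simp_all
qed

lemma ex_hom_with_entries:
  assumes Y: "Y \<in> carrier_mat a b"
  shows "\<exists>X\<in>homs \<delta> \<gamma>. mat a b (\<lambda>(i, j). r1 i (X (s2 j))) = Y"
proof -
  obtain t where t: "\<forall>i<a. \<gamma> (t i) = t i" "\<forall>i<a. \<forall>l<a. r1 l (t i) = (if i = l then 1 else 0)"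
    by (rule ex_dual_vectors)
  obtain d where d: "\<forall>j. linear (d j)" "\<forall>j v. d j (\<delta> v) = d j v"
      "\<forall>j<b. \<forall>k<b. d j (s2 k) = (if j = k then (1::real) else 0)"
    by (rule ex_dual_functionals)
  define X where "X = rank_one_sum a b t d (\<lambda>i j. Y $$ (i, j))"
  have "X \<in> homs \<delta> \<gamma>"
    unfolding X_def using t(1) d(1,2) by (intro rank_one_sum_in_homs \<gamma>.linear_proj) simp_all
  moreover have "r1 l (X (s2 k)) = Y $$ (l, k)" if "l < a" "k < b" for l k
    unfolding X_def by (rule rank_one_sum_entry[OF linear_r1]) (use t(2) d(3) that in simp_all)
  then have "mat a b (\<lambda>(i, j). r1 i (X (s2 j))) = Y" using Y by (intro eq_matI) auto
  ultimately show ?thesis by blast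
qed

lemma one_plus_mat_image_blocks:
  "one_plus_mat (a + b) s r ` (A + B + homs \<delta> \<gamma>) =
   join_mats a b (one_plus_mat a s1 r1 ` A) (one_plus_mat b s2 r2 ` B)"
proof
  show "one_plus_mat (a + b) s r ` (A + B + homs \<delta> \<gamma>) \<subseteq>
      join_mats a b (one_plus_mat a s1 r1 ` A) (one_plus_mat b s2 r2 ` B)"
  proof (rule image_subsetI)
    fix W assume "W \<in> A + B + homs \<delta> \<gamma>"
    then obtain M N X where "W = M + N + X" "M \<in> A" "N \<in> B" "X \<in> homs \<delta> \<gamma>"
      by (auto elim!: set_plus_elim)
    then show "one_plus_mat (a + b) s r W \<in>
        join_mats a b (one_plus_mat a s1 r1 ` A) (one_plus_mat b s2 r2 ` B)"
      unfolding join_mats_def using one_plus_mat_blocks mat_carrier by blast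
  qed
  show "join_mats a b (one_plus_mat a s1 r1 ` A) (one_plus_mat b s2 r2 ` B) \<subseteq>
      one_plus_mat (a + b) s r ` (A + B + homs \<delta> \<gamma>)"
  proof
    fix Z assume "Z \<in> join_mats a b (one_plus_mat a s1 r1 ` A) (one_plus_mat b s2 r2 ` B)"
    then obtain M Y N where MN: "M \<in> A" "N \<in> B" and Y: "Y \<in> carrier_mat a b"
      and Z: "Z = four_block_mat (one_plus_mat a s1 r1 M) Y (0\<^sub>m b a) (one_plus_mat b s2 r2 N)"
      unfolding join_mats_def by blast
    obtain X where X: "X \<in> homs \<delta> \<gamma>" "mat a b (\<lambda>(i, j). r1 i (X (s2 j))) = Y"
      using ex_hom_with_entries[OF Y] by (rule bexE)
    have "Z = one_plus_mat (a + b) s r (M + N + X)"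
      unfolding Z one_plus_mat_blocks[OF MN X(1)] X(2) ..
    moreover have "M + N + X \<in> A + B + homs \<delta> \<gamma>" by (intro set_plus_intro MN X(1))
    ultimately show "Z \<in> one_plus_mat (a + b) s r ` (A + B + homs \<delta> \<gamma>)" by (rule image_eqI)
  qed
qed

end

lemma has_skew_form_blocks:
  assumes "projector_decomp P \<gamma> \<delta>" "A \<subseteq> homs \<gamma> \<gamma>" "B \<subseteq> homs \<delta> \<delta>"
    and A: "has_skew_form \<gamma> A as" and B: "has_skew_form \<delta> B bs"
  shows "has_skew_form P (A + B + homs \<delta> \<gamma>) (as @ bs)"
proof -
  let ?a = "sum_list as" and ?b = "sum_list bs"
  obtain s1 r1 where A_form: "\<forall>j<?a. \<gamma> (s1 j) = s1 j" "\<forall>i. linear (r1 i)"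
      "one_plus_mat ?a s1 r1 ` A = translate_mat (1\<^sub>m ?a) (skew_join as)"
    using A by (rule has_skew_formE)
  obtain s2 r2 where B_form: "\<forall>j<?b. \<delta> (s2 j) = s2 j" "\<forall>i. linear (r2 i)"
      "one_plus_mat ?b s2 r2 ` B = translate_mat (1\<^sub>m ?b) (skew_join bs)"
    using B by (rule has_skew_formE)
  interpret block_frames P \<gamma> \<delta> A B ?a ?b s1 s2 r1 r2
  proof (intro block_frames.intro block_frames_axioms.intro assms(1-3))
    show "1\<^sub>m ?a \<in> one_plus_mat ?a s1 r1 ` A" "1\<^sub>m ?b \<in> one_plus_mat ?b s2 r2 ` B"
      unfolding A_form(3) B_form(3) by (rule one_in_translate_skew_join)+
  qed (use A_form(1,2) B_form(1,2) in simp_all)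
  have "one_plus_mat (?a + ?b) s r ` (A + B + homs \<delta> \<gamma>) =
      translate_mat (1\<^sub>m (?a + ?b)) (skew_join (as @ bs))"
    unfolding one_plus_mat_image_blocks A_form(3) B_form(3) skew_join_append
    by (rule join_mats_translate_one[OF skew_join_carrier skew_join_carrier])
  then show ?thesis
    unfolding has_skew_form_def using s_fixed linear_r
    by (intro exI[of _ s] exI[of _ r]) simp
qed

lemma ex_has_skew_form_if_skew_type:
  assumes P: "fin_projector P" and skew: "skew_type P V"
  shows "\<exists>ns. (\<forall>m\<in>set ns. 0 < m) \<and> sum_list ns = dim (range P) \<and> has_skew_form P V ns"
proof -
  obtain b where "bilinear b" "definite_on P b" "V = skew_ops P b"
    using skew unfolding skew_type_def by (elim exE conjE)
  then have form: "has_skew_form P V [dim (range P)]" using has_skew_form_skew_ops[OF P] by simp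
  show ?thesis
  proof (cases "dim (range P) = 0")
    case True
    have "skew_mats 0 = carrier_mat 0 0"
      using skew_mats_carrier by (auto intro: skew_matsI)
    then have "skew_join [0] = skew_join []"
      unfolding skew_join_singleton by (simp only: skew_join.simps(1))
    then have "has_skew_form P V []"
      using form True by (simp add: has_skew_form_def del: skew_join.simps)
    then show ?thesis using True by (intro exI[of _ "[]"]) simp
  next
    case False
    then show ?thesis using form by (intro exI[of _ "[dim (range P)]"]) simp
  qed
qed

lemma (in max_trivial_spectrum) ex_max_invariant_decomp:
  assumes "reducible P V"
  obtains \<gamma> \<delta> where "max_invariant_decomp P \<gamma> \<delta> V"
    "dim (range \<gamma>) < dim (range P)" "dim (range \<delta>) < dim (range P)"
proof -
  obtain \<gamma> \<delta> where splitting: "projector_decomp P \<gamma> \<delta>"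
    and proper: "range \<gamma> \<noteq> {0}" "range \<gamma> \<noteq> range P"
    and invariant: "\<forall>M\<in>V. \<forall>v. \<delta> (M (\<gamma> v)) = 0"
    using assms by (rule reducibleE)
  interpret projector_decomp P \<gamma> \<delta> by (rule splitting)
  have "dim (range \<gamma>) \<noteq> 0" using fin_dim_eq_zero_iff[OF \<gamma>.fin_dim_range] proper(1) by simp
  moreover have "\<not> dim (range P) \<le> dim (range \<gamma>)"
    using fin_dim_subspace_equal[OF fin_dim_range \<gamma>.subspace_range range_\<gamma>_subset] proper(2)
    by blast
  moreover have "max_invariant_decomp P \<gamma> \<delta> V"
    using invariant
    by (intro max_invariant_decomp.intro invariant_decomp.intro invariant_decomp_axioms.intro
        splitting max_trivial_spectrum_axioms trivial_spectrum_axioms) simp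
  ultimately show ?thesis using dim_range_eq that by simp
qed

theorem max_trivial_spectrum_has_skew_form:
  assumes "max_trivial_spectrum P V"
  shows "\<exists>ns. (\<forall>m\<in>set ns. 0 < m) \<and> sum_list ns = dim (range P) \<and> has_skew_form P V ns"
  using assms
proof (induction "dim (range P)" arbitrary: P V rule: less_induct)
  case less
  then interpret max_trivial_spectrum P V by simp
  consider (reducible) "reducible P V" | (skew) "skew_type P V"
    using max_trivial_spectrum_reducible_or_skew[OF less.prems] by (rule disjE)
  then show ?case
  proof cases
    case skew
    then show ?thesis by (rule ex_has_skew_form_if_skew_type[OF fin_projector_axioms])
  next
    case reducible
    then obtain \<gamma> \<delta> where splitting: "max_invariant_decomp P \<gamma> \<delta> V"
      and smaller: "dim (range \<gamma>) < dim (range P)" "dim (range \<delta>) < dim (range P)"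
      by (rule ex_max_invariant_decomp)
    interpret max_invariant_decomp P \<gamma> \<delta> V by (rule splitting)
    obtain as where as: "\<forall>m\<in>set as. 0 < m" "sum_list as = dim (range \<gamma>)"
        "has_skew_form \<gamma> (compression \<gamma> ` V) as"
      using less.hyps[OF smaller(1) max_sub] by (elim exE conjE)
    obtain bs where bs: "\<forall>m\<in>set bs. 0 < m" "sum_list bs = dim (range \<delta>)"
        "has_skew_form \<delta> (compression \<delta> ` V) bs"
      using less.hyps[OF smaller(2) max_quotient] by (elim exE conjE)
    have "has_skew_form P V (as @ bs)"
      using has_skew_form_blocks[OF projector_decomp_axioms
          trivial_spectrum.V_homs[OF trivial_spectrum_sub]
          trivial_spectrum.V_homs[OF trivial_spectrum_quotient] as(3) bs(3)]
      unfolding eq_blocks[symmetric] .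
    then show ?thesis
      using as(1,2) bs(1,2) dim_range_eq by (intro exI[of _ "as @ bs"]) auto
  qed
qed

section \<open>Matrices as operators on sequences\<close>

definition trunc :: "nat \<Rightarrow> (nat \<Rightarrow> real) \<Rightarrow> nat \<Rightarrow> real" where
  "trunc n f = (\<lambda>i. if i < n then f i else 0)"

definition unit_seq :: "nat \<Rightarrow> nat \<Rightarrow> real" where
  "unit_seq k = (\<lambda>i. if i = k then 1 else 0)"

lemma linear_trunc: "linear (trunc n)"
  by (rule linearI) (auto simp: trunc_def)

lemma trunc_idem: "trunc n (trunc n f) = trunc n f"
  by (simp add: trunc_def fun_eq_iff)

lemma trunc_fixed_iff: "trunc n f = f \<longleftrightarrow> (\<forall>i\<ge>n. f i = 0)"
  by (simp add: trunc_def fun_eq_iff not_less)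

lemma trunc_unit_seq: "k < n \<Longrightarrow> trunc n (unit_seq k) = unit_seq k"
  by (simp add: trunc_fixed_iff unit_seq_def)

lemma trunc_expansion: "trunc n f = (\<Sum>k<n. f k *\<^sub>R unit_seq k)"
proof
  fix i
  have "(\<Sum>k<n. f k *\<^sub>R unit_seq k) i = (\<Sum>k<n. if k = i then f i else 0)"
    unfolding sum_fun_apply by (intro sum.cong) (auto simp: unit_seq_def)
  then show "trunc n f i = (\<Sum>k<n. f k *\<^sub>R unit_seq k) i" by (simp add: trunc_def)
qed

lemma fin_projector_trunc: "fin_projector (trunc n)"
proof (rule fin_projector.intro[OF linear_trunc trunc_idem])
  have "range (trunc n) \<subseteq> span (unit_seq ` {..<n})"
    unfolding trunc_expansion
    by (intro image_subsetI real_vector.span_sum real_vector.span_scale real_vector.span_base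
        imageI)
  then show "fin_dim (range (trunc n))"
    by (intro fin_dim_subset(1)[OF fin_dim_span]
        real_vector.linear_subspace_image[OF linear_trunc real_vector.subspace_UNIV]) auto
qed

lemma in_range_trunc_iff: "f \<in> range (trunc n) \<longleftrightarrow> trunc n f = f"
  by (rule fin_projector.in_range_iff[OF fin_projector_trunc])

lemma fin_dim_range_trunc: "fin_dim (range (trunc n))"
  by (rule fin_projector.fin_dim_range[OF fin_projector_trunc])

lemma dim_range_trunc: "dim (range (trunc n)) = n"
proof (induction n)
  case 0
  have "range (trunc 0) = {0}" by (auto simp: trunc_def zero_fun_def)
  then show ?case by (simp add: dim_zero)
next
  case (Suc n)
  have "{f \<in> range (trunc (Suc n)). f n = 0} = range (trunc n)"
    unfolding set_eq_iff mem_Collect_eq in_range_trunc_iff trunc_fixed_iff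
    by (metis Suc_le_eq le_neq_implies_less le_refl nat_less_le)
  moreover have "unit_seq n \<in> range (trunc (Suc n))"
    by (simp add: in_range_trunc_iff trunc_unit_seq)
  ultimately show ?case
    using dim_functional_kernel[OF linear_eval fin_dim_range_trunc, of "unit_seq n" "Suc n" n] Suc
    by (simp add: unit_seq_def)
qed

definition mat_op :: "nat \<Rightarrow> real mat \<Rightarrow> (nat \<Rightarrow> real) \<Rightarrow> nat \<Rightarrow> real" where
  "mat_op n A f = (\<lambda>i. if i < n then \<Sum>j<n. A $$ (i, j) * f j else 0)"

lemma linear_mat_op: "linear (mat_op n A)"
  by (rule linearI) (auto simp: mat_op_def fun_eq_iff algebra_simps sum.distrib sum_distrib_left)

lemma trunc_mat_op: "trunc n (mat_op n A f) = mat_op n A f" "mat_op n A (trunc n f) = mat_op n A f"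
  by (auto simp: trunc_def mat_op_def fun_eq_iff)

lemma mat_op_in_homs: "mat_op n A \<in> homs (trunc n) (trunc n)"
  by (rule homsI) (rule linear_mat_op trunc_mat_op)+

lemma mat_op_add:
  assumes "A \<in> carrier_mat n n" "B \<in> carrier_mat n n"
  shows "mat_op n (A + B) = mat_op n A + mat_op n B"
  using assms by (auto simp: mat_op_def fun_eq_iff algebra_simps sum.distrib)

lemma mat_op_smult:
  assumes "A \<in> carrier_mat n n"
  shows "mat_op n (c \<cdot>\<^sub>m A) = c *\<^sub>R mat_op n A"
  using assms by (auto simp: mat_op_def fun_eq_iff sum_distrib_left mult.assoc)

lemma mat_op_zero: "mat_op n (0\<^sub>m n n) = 0"
  by (auto simp: mat_op_def fun_eq_iff)

lemma mat_op_one: "mat_op n (1\<^sub>m n) = trunc n"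
proof (intro ext)
  fix f :: "nat \<Rightarrow> real" and i
  have "(\<Sum>j<n. 1\<^sub>m n $$ (i, j) * f j) = (\<Sum>j<n. if j = i then f i else 0)" if "i < n"
    using that by (intro sum.cong) auto
  then show "mat_op n (1\<^sub>m n) f i = trunc n f i" by (simp add: mat_op_def trunc_def)
qed

lemma index_mult_mat_sum:
  assumes "A \<in> carrier_mat n n" "B \<in> carrier_mat n n" "i < n" "j < n"
  shows "(A * B) $$ (i, j) = (\<Sum>k<n. A $$ (i, k) * B $$ (k, j))"
  using assms by (auto simp: scalar_prod_def atLeast0LessThan intro!: sum.cong)

lemma mat_op_mult:
  assumes "A \<in> carrier_mat n n" "B \<in> carrier_mat n n"
  shows "mat_op n (A * B) f = mat_op n A (mat_op n B f)"
proof
  fix i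
  show "mat_op n (A * B) f i = mat_op n A (mat_op n B f) i"
  proof (cases "i < n")
    case True
    have "mat_op n (A * B) f i = (\<Sum>j<n. (\<Sum>k<n. A $$ (i, k) * B $$ (k, j)) * f j)"
      using True by (simp add: mat_op_def index_mult_mat_sum[OF assms])
    also have "\<dots> = (\<Sum>k<n. A $$ (i, k) * (\<Sum>j<n. B $$ (k, j) * f j))"
      unfolding sum_distrib_right sum_distrib_left by (subst sum.swap) (simp add: mult.assoc)
    also have "\<dots> = mat_op n A (mat_op n B f) i" using True by (simp add: mat_op_def)
    finally show ?thesis .
  qed (simp add: mat_op_def)
qed

lemma mat_op_unit_seq: "i < n \<Longrightarrow> j < n \<Longrightarrow> mat_op n A (unit_seq j) i = A $$ (i, j)"
proof -
  assume ij: "i < n" "j < n"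
  have "(\<Sum>k<n. A $$ (i, k) * unit_seq j k) = (\<Sum>k<n. if k = j then A $$ (i, j) else 0)"
    by (intro sum.cong) (auto simp: unit_seq_def)
  then show ?thesis using ij by (simp add: mat_op_def)
qed

lemma mat_op_inject:
  assumes "A \<in> carrier_mat n n" "B \<in> carrier_mat n n" "mat_op n A = mat_op n B"
  shows "A = B"
proof (rule eq_matI)
  fix i j assume "i < dim_row B" "j < dim_col B"
  then have "i < n" "j < n" using assms(2) by auto
  then show "A $$ (i, j) = B $$ (i, j)"
    using mat_op_unit_seq[of i n j A] mat_op_unit_seq[of i n j B] assms(3) by simp
qed (use assms in auto)

lemma linear_functional_expansion:
  fixes L :: "(nat \<Rightarrow> real) \<Rightarrow> real"
  assumes L: "linear L" and f: "trunc n f = f"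
  shows "L f = (\<Sum>k<n. L (unit_seq k) * f k)"
proof -
  have "L f = L (\<Sum>k<n. f k *\<^sub>R unit_seq k)" using f by (simp only: trunc_expansion)
  also have "\<dots> = (\<Sum>k<n. f k * L (unit_seq k))" by (simp add: linear_sum[OF L] linear_scale[OF L])
  finally show ?thesis by (simp add: mult.commute)
qed

definition mat_of_op :: "nat \<Rightarrow> ((nat \<Rightarrow> real) \<Rightarrow> nat \<Rightarrow> real) \<Rightarrow> real mat" where
  "mat_of_op n M = mat n n (\<lambda>(i, j). M (unit_seq j) i)"

lemma mat_op_mat_of_op:
  assumes M: "M \<in> homs (trunc n) (trunc n)"
  shows "mat_op n (mat_of_op n M) = M"
proof (intro ext)
  fix f i
  have "linear (\<lambda>f. M f i)"
    by (rule linearI) (simp_all add: linear_map_simps[OF homs_linear[OF M]])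
  then have "M (trunc n f) i = (\<Sum>k<n. M (unit_seq k) i * trunc n f k)"
    by (rule linear_functional_expansion[OF _ trunc_idem])
  then have "M f i = (\<Sum>k<n. M (unit_seq k) i * trunc n f k)" by (simp only: homs_domain[OF M])
  also have "\<dots> = (\<Sum>k<n. M (unit_seq k) i * f k)" by (intro sum.cong refl) (simp add: trunc_def)
  finally have "M f i = (\<Sum>k<n. M (unit_seq k) i * f k)" .
  moreover have "M f i = 0" if "\<not> i < n"
    using fun_cong[OF homs_codomain[OF M, of f], of i] that by (simp add: trunc_def)
  ultimately show "mat_op n (mat_of_op n M) f i = M f i" by (simp add: mat_op_def mat_of_op_def)
qed

lemma GL_inverse:
  assumes "A \<in> GL n"
  obtains B where "B \<in> carrier_mat n n" "A * B = 1\<^sub>m n" "B * A = 1\<^sub>m n"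
proof -
  have A: "A \<in> carrier_mat n n" using assms by (simp add: GL_def)
  obtain B where B: "A * B = 1\<^sub>m n" "B * A = 1\<^sub>m (dim_row B)"
    using assms A unfolding GL_def invertible_mat_def inverts_mat_def by auto
  have "dim_col B = n" using arg_cong[OF B(1), of dim_col] by simp
  moreover have "dim_row B = n" using arg_cong[OF B(2), of dim_col] A by simp
  ultimately show ?thesis using that[of B] B by auto
qed

lemma GL_if_det_nonzero:
  assumes "A \<in> carrier_mat n n" "det A \<noteq> 0"
  shows "A \<in> GL n"
proof -
  have "A \<in> Units (ring_mat TYPE(real) n ())" using det_non_zero_imp_unit[OF assms] .
  then obtain B where "B \<in> carrier_mat n n" "A * B = 1\<^sub>m n" "B * A = 1\<^sub>m n"
    unfolding Units_def by (auto simp: ring_mat_simps)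
  then show ?thesis using assms(1) unfolding GL_def invertible_mat_def inverts_mat_def by auto
qed

section \<open>Existence\<close>

locale mat_space_embedding =
  fixes n :: nat and W :: "real mat set" and F :: "real mat \<Rightarrow> 'b::real_vector"
  assumes W: "mat_subspace n W"
    and F_add: "A \<in> W \<Longrightarrow> B \<in> W \<Longrightarrow> F (A + B) = F A + F B"
    and F_smult: "A \<in> W \<Longrightarrow> F (c \<cdot>\<^sub>m A) = c *\<^sub>R F A"
    and inj: "inj_on F W"
begin

lemmas W_closed = mat_subspaceD[OF W]

lemma F_zero: "F (0\<^sub>m n n) = 0"
proof -
  have "0 \<cdot>\<^sub>m 0\<^sub>m n n = (0\<^sub>m n n :: real mat)" by (intro eq_matI) auto
  then show ?thesis using F_smult[OF W_closed(2), of 0] by simp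
qed

lemma subspace_image: "lin_subspace (F ` W)"
proof (rule real_vector.subspaceI)
  show "0 \<in> F ` W" using W_closed(2) by (intro image_eqI[of _ _ "0\<^sub>m n n"]) (simp_all add: F_zero)
  fix x assume "x \<in> F ` W"
  then obtain A where A: "x = F A" "A \<in> W" by (rule imageE)
  show "c *\<^sub>R x \<in> F ` W" for c
    using A W_closed(4) F_smult by (intro image_eqI[of _ _ "c \<cdot>\<^sub>m A"]) simp_all
  show "x + y \<in> F ` W" if y: "y \<in> F ` W" for y
  proof -
    obtain B where "y = F B" "B \<in> W" using y by (rule imageE)
    then show ?thesis using A W_closed(3) F_add by (intro image_eqI[of _ _ "A + B"]) simp_all
  qed
qed

sublocale W_vs: vectorspace class_ring "(module_mat TYPE(real) n n)\<lparr>carrier := W\<rparr>"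
proof -
  interpret vectorspace class_ring "module_mat TYPE(real) n n" by (rule matrix_vs)
  show "vectorspace class_ring ((module_mat TYPE(real) n n)\<lparr>carrier := W\<rparr>)"
    by (rule subspace_is_vs[OF W])
qed

lemma image_lincomb:
  assumes "finite D" "D \<subseteq> W"
  shows "W_vs.lincomb a D \<in> W \<and> F (W_vs.lincomb a D) = (\<Sum>A\<in>D. a A *\<^sub>R F A)"
  using assms
proof (induction D)
  case empty
  then show ?case using W_closed(2) F_zero by (simp add: W_vs.lincomb_def module_mat_simps)
next
  case (insert A D)
  then have AD: "A \<in> W" "D \<subseteq> W" by auto
  have "W_vs.lincomb a (insert A D) = a A \<cdot>\<^sub>m A + W_vs.lincomb a D"
    unfolding W_vs.lincomb_def
    using insert.hyps AD W_closed(4)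
    by (subst W_vs.finsum_insert) (auto simp: module_mat_simps)
  then show ?case using insert.IH[OF AD(2)] insert.hyps W_closed(3,4) AD F_add F_smult by simp
qed

lemma span_if_image_spans:
  assumes C: "finite C" "C \<subseteq> W" and span: "F ` W \<subseteq> span (F ` C)"
  shows "W_vs.span C = W"
proof
  show "W_vs.span C \<subseteq> W"
  proof
    fix X assume "X \<in> W_vs.span C"
    then obtain a D where "X = W_vs.lincomb a D" "finite D" "D \<subseteq> C" unfolding W_vs.span_def by blast
    then show "X \<in> W" using image_lincomb[of D a] C(2) by auto
  qed
  show "W \<subseteq> W_vs.span C"
  proof
    fix X assume X: "X \<in> W"
    then have "F X \<in> span (F ` C)" using span by blast
    then obtain u where "F X = (\<Sum>b\<in>F ` C. u b *\<^sub>R b)"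
      unfolding real_vector.span_finite[OF finite_imageI[OF C(1)]] by (rule rangeE)
    also have "\<dots> = (\<Sum>A\<in>C. u (F A) *\<^sub>R F A)"
      using inj_on_subset[OF inj C(2)] by (simp add: sum.reindex)
    also have "\<dots> = F (W_vs.lincomb (\<lambda>A. u (F A)) C)" using image_lincomb[OF C] by simp
    finally have "X = W_vs.lincomb (\<lambda>A. u (F A)) C"
      using inj_onD[OF inj _ X] image_lincomb[OF C] by blast
    moreover have "(\<lambda>A. u (F A)) \<in> C \<rightarrow> carrier class_ring" by (simp add: class_ring_simps)
    ultimately show "X \<in> W_vs.span C" unfolding W_vs.span_def using C(1) by blast
  qed
qed

lemma dim_le_dim_image:
  assumes "fin_dim (F ` W)"
  shows "W_vs.dim \<le> dim (F ` W)"
proof -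
  obtain B where B: "finite B" "span B = F ` W" "card B = dim (F ` W)"
    using assms by (rule fin_dim_basis)
  then have "B \<subseteq> F ` W" using real_vector.span_superset by blast
  then obtain C where C: "C \<subseteq> W" "finite C" "B = F ` C"
    using finite_subset_image[OF B(1)] by blast
  have "inj_on F C" using inj C(1) by (rule inj_on_subset)
  then have card: "card C = dim (F ` W)" using card_image B(3) C(3) by metis
  have "W_vs.span C = W" using B(2) C by (intro span_if_image_spans) simp_all
  then have "\<exists>A. finite A \<and> card A = card C \<and> A \<subseteq> W \<and> W_vs.span A = W" using C by blast
  then have "W_vs.dim \<le> card C" unfolding W_vs.dim_def by (intro Least_le) simp
  then show ?thesis using card by simp
qed

end

locale gl_affine_space =
  fixes n :: nat and P R :: "real mat" and W :: "real mat set"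
  assumes P: "P \<in> carrier_mat n n" and W: "mat_subspace n W"
    and GL: "A \<in> W \<Longrightarrow> P + A \<in> GL n"
    and R: "R \<in> carrier_mat n n" and PR: "P * R = 1\<^sub>m n" and RP: "R * P = 1\<^sub>m n"
begin

lemma W_carrier: "A \<in> W \<Longrightarrow> A \<in> carrier_mat n n"
  using mat_subspaceD(1)[OF W] by blast

definition normalized_op :: "real mat \<Rightarrow> (nat \<Rightarrow> real) \<Rightarrow> nat \<Rightarrow> real" where
  "normalized_op A = mat_op n (R * A)"

lemma mat_op_P_normalized_op: "A \<in> W \<Longrightarrow> mat_op n P (normalized_op A f) = mat_op n A f"
  using mat_op_mult[OF P R, of "mat_op n A f"] mat_op_mult[OF R W_carrier, of A f]
  by (simp add: normalized_op_def PR mat_op_one trunc_mat_op)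

sublocale mat_space_embedding n W normalized_op
proof (rule mat_space_embedding.intro)
  show "mat_subspace n W" by (rule W)
  fix A B assume A: "A \<in> W"
  note carrier = W_carrier[OF A] mult_carrier_mat[OF R W_carrier[OF A]]
  show "normalized_op (A + B) = normalized_op A + normalized_op B" if B: "B \<in> W"
    using mult_add_distrib_mat[OF R carrier(1) W_carrier[OF B]]
      mat_op_add[OF carrier(2) mult_carrier_mat[OF R W_carrier[OF B]]]
    by (simp add: normalized_op_def)
  show "normalized_op (c \<cdot>\<^sub>m A) = c *\<^sub>R normalized_op A" for c
    using mult_smult_distrib[OF R carrier(1)] mat_op_smult[OF carrier(2)]
    by (simp add: normalized_op_def)
next
  show "inj_on normalized_op W"
  proof (rule inj_onI)
    fix A B assume AB: "A \<in> W" "B \<in> W" "normalized_op A = normalized_op B"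
    have "mat_op n A = mat_op n B"
      using mat_op_P_normalized_op[OF AB(1)] mat_op_P_normalized_op[OF AB(2)] AB(3)
      by (intro ext) metis
    then show "A = B" by (rule mat_op_inject[OF W_carrier W_carrier, OF AB(1,2)])
  qed
qed

lemma trivial_spectrum_normalized: "trivial_spectrum (trunc n) (normalized_op ` W)"
proof (intro trivial_spectrum.intro trivial_spectrum_axioms.intro fin_projector_trunc
    subspace_image)
  show "normalized_op ` W \<subseteq> homs (trunc n) (trunc n)"
    unfolding normalized_op_def using mat_op_in_homs by blast
  fix M f assume mem: "M \<in> normalized_op ` W" and f: "M f = f"
  obtain A where M: "M = normalized_op A" and A: "A \<in> W" using mem by (rule imageE)
  define X where "X = P + (-1) \<cdot>\<^sub>m A"
  have "X \<in> GL n" unfolding X_def by (rule GL[OF mat_subspaceD(4)[OF W A]])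
  then obtain Y where Y: "Y \<in> carrier_mat n n" "X * Y = 1\<^sub>m n" "Y * X = 1\<^sub>m n" by (rule GL_inverse)
  have "mat_op n P f = mat_op n A f" using mat_op_P_normalized_op[OF A, of f] f M by simp
  then have "mat_op n X f = 0"
    using P W_carrier[OF A] by (simp add: X_def mat_op_add mat_op_smult)
  moreover have "mat_op n (Y * X) f = mat_op n Y (mat_op n X f)"
    using P W_carrier[OF A] by (intro mat_op_mult[OF Y(1)]) (simp add: X_def)
  ultimately have "trunc n f = 0" by (simp add: Y(3) mat_op_one linear_0[OF linear_mat_op])
  moreover have "trunc n f = f"
    using trunc_mat_op(1)[of n "R * A" f] f by (simp add: M normalized_op_def)
  ultimately show "f = 0" by simp
qed

lemma one_plus_mat_normalized_op:
  assumes A: "A \<in> W" and r: "\<forall>i. linear (r i)" and s: "\<forall>j<n. trunc n (s j) = s j"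
  shows "one_plus_mat n s r (normalized_op A) =
    (mat n n (\<lambda>(i, k). r i (unit_seq k)) * R) * (P + A) * mat n n (\<lambda>(k, j). s j k)"
    (is "?L = (?r * R) * (P + A) * ?s")
proof -
  define B where "B = 1\<^sub>m n + R * A"
  have carrier: "B \<in> carrier_mat n n" "?r \<in> carrier_mat n n" "?s \<in> carrier_mat n n"
    using R W_carrier[OF A] by (simp_all add: B_def)
  have "R * (P + A) = B"
    unfolding B_def using mult_add_distrib_mat[OF R P W_carrier[OF A]] RP by simp
  then have "(?r * R) * (P + A) * ?s = ?r * (B * ?s)"
    using carrier R P W_carrier[OF A] by (simp add: assoc_mult_mat[of _ n n _ n _ n])
  also have "\<dots> = ?L"
  proof (rule eq_matI)
    fix i j assume "i < dim_row ?L" "j < dim_col ?L"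
    then have ij: "i < n" "j < n" by (simp_all add: one_plus_mat_def)
    have B_s: "mat_op n B (s j) = s j + normalized_op A (s j)"
      using s ij(2) mult_carrier_mat[OF R W_carrier[OF A]]
      by (simp add: B_def mat_op_add mat_op_one normalized_op_def)
    have entry: "(B * ?s) $$ (k, j) = mat_op n B (s j) k" if "k < n" for k
      using that ij(2) carrier by (subst index_mult_mat_sum[of _ n]) (simp_all add: mat_op_def)
    have "(?r * (B * ?s)) $$ (i, j) = (\<Sum>k<n. ?r $$ (i, k) * (B * ?s) $$ (k, j))"
      by (rule index_mult_mat_sum[OF carrier(2) mult_carrier_mat[OF carrier(1,3)] ij])
    also have "\<dots> = (\<Sum>k<n. r i (unit_seq k) * mat_op n B (s j) k)"
      using ij by (intro sum.cong refl) (simp add: entry del: index_mult_mat)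
    also have "\<dots> = r i (mat_op n B (s j))"
      using linear_functional_expansion[OF r[rule_format] trunc_mat_op(1)] by simp
    finally show "(?r * (B * ?s)) $$ (i, j) = ?L $$ (i, j)"
      using ij by (simp add: one_plus_mat_def B_s)
  qed (simp_all add: one_plus_mat_def)
  finally show ?thesis by simp
qed

lemma equiv_if_has_skew_form:
  assumes form: "has_skew_form (trunc n) (normalized_op ` W) ns" and n: "n = sum_list ns"
  shows "equiv_mats n (translate_mat P W) (translate_mat (1\<^sub>m n) (skew_join ns))"
proof -
  obtain s r where s: "\<forall>j<n. trunc n (s j) = s j" and r: "\<forall>i. linear (r i)"
    and eq: "one_plus_mat n s r ` normalized_op ` W = translate_mat (1\<^sub>m n) (skew_join ns)"
    using form unfolding n by (rule has_skew_formE)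
  define L where "L = mat n n (\<lambda>(i, k). r i (unit_seq k)) * R"
  define S where "S = mat n n (\<lambda>(k, j). s j k)"
  have carrier: "L \<in> carrier_mat n n" "S \<in> carrier_mat n n"
    unfolding L_def S_def by (rule mult_carrier_mat[OF _ R], simp_all)
  have "translate_mat (1\<^sub>m n) (skew_join ns) = (\<lambda>A. L * (P + A) * S) ` W"
    unfolding eq[symmetric] image_image L_def S_def
    by (rule image_cong[OF refl one_plus_mat_normalized_op[OF _ r s]])
  also have "\<dots> = {L * M * S |M. M \<in> translate_mat P W}" unfolding translate_mat_def by blast
  finally have image:
    "translate_mat (1\<^sub>m n) (skew_join ns) = {L * M * S |M. M \<in> translate_mat P W}" .
  then have "1\<^sub>m n \<in> {L * M * S |M. M \<in> translate_mat P W}"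
    using one_in_translate_skew_join[of ns] n by simp
  then obtain A where A: "A \<in> W" "1\<^sub>m n = L * (P + A) * S" unfolding translate_mat_def by blast
  have "det (L * (P + A) * S) = det L * det (P + A) * det S"
    using carrier P W_carrier[OF A(1)] by (simp add: det_mult[of _ n])
  then have "det L * det (P + A) * det S = 1" using A(2) by (metis det_one)
  then have "L \<in> GL n" "S \<in> GL n" using carrier by (auto intro: GL_if_det_nonzero)
  then show ?thesis unfolding equiv_mats_def using image by blast
qed

end

theorem ex_skew_join_equiv:
  assumes "affine_subspace_mat n V" and GL: "V \<subseteq> GL n" and dim_V: "affine_dim_mat n V = n choose 2"
  shows "\<exists>ns. (\<forall>m\<in>set ns. 0 < m) \<and> n = sum_list ns \<and>
           equiv_mats n V (translate_mat (1\<^sub>m n) (skew_join ns))"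
proof -
  obtain P W where P: "P \<in> carrier_mat n n" and W: "mat_subspace n W" and V: "V = translate_mat P W"
    using assms(1) unfolding affine_subspace_mat_def by blast
  have PW: "P + A \<in> GL n" if "A \<in> W" for A using that GL unfolding V translate_mat_def by blast
  have "P \<in> GL n" using PW[OF mat_subspaceD(2)[OF W]] P by simp
  then obtain R where R: "R \<in> carrier_mat n n" "P * R = 1\<^sub>m n" "R * P = 1\<^sub>m n" by (rule GL_inverse)
  interpret gl_affine_space n P R W
    by (intro gl_affine_space.intro P W PW R)
  interpret trivial_spectrum "trunc n" "normalized_op ` W" by (rule trivial_spectrum_normalized)
  have "W_vs.dim = n choose 2"
    using dim_V direction_translate_mat[OF P W] by (simp add: affine_dim_mat_def V)
  then have "max_trivial_spectrum (trunc n) (normalized_op ` W)"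
    using dim_le_dim_image[OF fin_dim_V] trivial_spectrum_axioms
    by (intro max_trivial_spectrumI) (simp_all add: dim_range_trunc)
  then obtain ns where "\<forall>m\<in>set ns. 0 < m" "n = sum_list ns"
      "has_skew_form (trunc n) (normalized_op ` W) ns"
    using max_trivial_spectrum_has_skew_form dim_range_trunc by metis
  then show ?thesis using equiv_if_has_skew_form unfolding V by blast
qed

section \<open>Uniqueness\<close>

definition orbit_dims :: "('a::real_vector \<Rightarrow> 'a) \<Rightarrow> ('a \<Rightarrow> 'b::real_vector) set \<Rightarrow> nat set" where
  "orbit_dims P V = {dim (orbit V x) |x. P x = x \<and> x \<noteq> 0}"

lemma orbit_mat_op: "orbit (mat_op n ` W) f = (\<lambda>A. mat_op n A f) ` W"
  by (simp add: orbit_def image_image)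

lemma orbit_mat_op_subset: "orbit (mat_op n ` W) f \<subseteq> range (trunc n)"
  unfolding orbit_mat_op by (rule image_subsetI) (simp add: in_range_trunc_iff trunc_mat_op)

lemma subspace_orbit_mat_op:
  assumes W: "mat_subspace n W"
  shows "lin_subspace (orbit (mat_op n ` W) f)"
proof -
  have carrier: "A \<in> carrier_mat n n" if "A \<in> W" for A using mat_subspaceD(1)[OF W] that by blast
  interpret mat_space_embedding n W "mat_op n"
  proof (rule mat_space_embedding.intro[OF W])
    show "inj_on (mat_op n) W" by (rule inj_onI) (rule mat_op_inject[OF carrier carrier])
  qed (rule mat_op_add[OF carrier carrier] mat_op_smult[OF carrier]; assumption)+
  show ?thesis by (rule subspace_orbit[OF subspace_image])
qed

lemma fin_dim_orbit_mat_op: "mat_subspace n W \<Longrightarrow> fin_dim (orbit (mat_op n ` W) f)"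
  by (rule fin_dim_subset(1)[OF fin_dim_range_trunc
        subspace_orbit_mat_op orbit_mat_op_subset])

lemma orbit_dims_mult_subset:
  assumes W: "mat_subspace n W" and R: "R \<in> GL n" and S: "S \<in> GL n"
  shows "orbit_dims (trunc n) (mat_op n ` {R * A * S |A. A \<in> W}) \<subseteq>
    orbit_dims (trunc n) (mat_op n ` W)"
proof
  obtain R' where R': "R' \<in> carrier_mat n n" "R * R' = 1\<^sub>m n" "R' * R = 1\<^sub>m n"
    using R by (rule GL_inverse)
  obtain S' where S': "S' \<in> carrier_mat n n" "S * S' = 1\<^sub>m n" "S' * S = 1\<^sub>m n"
    using S by (rule GL_inverse)
  have carrier: "R \<in> carrier_mat n n" "S \<in> carrier_mat n n" using R S by (simp_all add: GL_def)
  fix d assume "d \<in> orbit_dims (trunc n) (mat_op n ` {R * A * S |A. A \<in> W})"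
  then obtain f where f: "trunc n f = f" "f \<noteq> 0"
    and d: "d = dim (orbit (mat_op n ` {R * A * S |A. A \<in> W}) f)"
    unfolding orbit_dims_def by blast
  let ?g = "mat_op n S f"
  have "mat_op n (R * A * S) f = mat_op n R (mat_op n A ?g)" if "A \<in> W" for A
    using mat_subspaceD(1)[OF W] that carrier by (simp add: mat_op_mult[of _ n] subset_iff)
  then have "orbit (mat_op n ` {R * A * S |A. A \<in> W}) f = mat_op n R ` orbit (mat_op n ` W) ?g"
    unfolding orbit_def Setcompr_eq_image image_image by (rule image_cong[OF refl])
  moreover have "dim (mat_op n R ` orbit (mat_op n ` W) ?g) = dim (orbit (mat_op n ` W) ?g)"
  proof (rule dim_image_inj[OF linear_mat_op fin_dim_orbit_mat_op[OF W]])
    fix v assume "v \<in> orbit (mat_op n ` W) ?g" "mat_op n R v = 0"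
    moreover from this have "trunc n v = v" using orbit_mat_op_subset in_range_trunc_iff by blast
    ultimately show "v = 0"
      using mat_op_mult[OF R'(1) carrier(1), of v] linear_0[OF linear_mat_op]
      by (simp add: R'(3) mat_op_one)
  qed
  moreover have "?g \<noteq> 0"
    using mat_op_mult[OF S'(1) carrier(2), of f] f linear_0[OF linear_mat_op]
    by (auto simp: S'(3) mat_op_one)
  ultimately show "d \<in> orbit_dims (trunc n) (mat_op n ` W)"
    unfolding orbit_dims_def d using trunc_mat_op(1)[of n S f] by auto
qed

lemma orbit_dims_mult:
  assumes W: "mat_subspace n W" and J: "mat_subspace n J" and R: "R \<in> GL n" and S: "S \<in> GL n"
    and J_eq: "J = {R * A * S |A. A \<in> W}"
  shows "orbit_dims (trunc n) (mat_op n ` J) = orbit_dims (trunc n) (mat_op n ` W)"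
proof
  show "orbit_dims (trunc n) (mat_op n ` J) \<subseteq> orbit_dims (trunc n) (mat_op n ` W)"
    unfolding J_eq by (rule orbit_dims_mult_subset[OF W R S])
  obtain R' where R': "R' \<in> carrier_mat n n" "R * R' = 1\<^sub>m n" "R' * R = 1\<^sub>m n"
    using R by (rule GL_inverse)
  obtain S' where S': "S' \<in> carrier_mat n n" "S * S' = 1\<^sub>m n" "S' * S = 1\<^sub>m n"
    using S by (rule GL_inverse)
  have carrier: "R \<in> carrier_mat n n" "S \<in> carrier_mat n n" using R S by (simp_all add: GL_def)
  have GL': "R' \<in> GL n" "S' \<in> GL n"
    using R' S' carrier by (auto simp: GL_def invertible_mat_def inverts_mat_def)
  have "R' * (R * A * S) * S' = A" if "A \<in> W" for A
  proof -
    have A: "A \<in> carrier_mat n n" using mat_subspaceD(1)[OF W] that by blast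
    have "R' * (R * A * S) * S' = (R' * R) * A * (S * S')"
      using A carrier R'(1) S'(1) by (simp add: assoc_mult_mat[of _ n n _ n _ n])
    then show ?thesis using A by (simp add: R'(3) S'(2))
  qed
  then have "W = {R' * B * S' |B. B \<in> J}"
    unfolding J_eq Setcompr_eq_image image_image by simp
  then show "orbit_dims (trunc n) (mat_op n ` W) \<subseteq> orbit_dims (trunc n) (mat_op n ` J)"
    using orbit_dims_mult_subset[OF J GL'] by simp
qed

lemma direction_mat_mult:
  assumes V: "V \<subseteq> carrier_mat n n" and R: "R \<in> carrier_mat n n" and S: "S \<in> carrier_mat n n"
  shows "direction_mat {R * M * S |M. M \<in> V} = {R * D * S |D. D \<in> direction_mat V}"
proof -
  have "R * (A - B) * S = R * A * S - R * B * S" if "A \<in> V" "B \<in> V" for A B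
    using subsetD[OF V that(1)] subsetD[OF V that(2)] R S
    by (simp add: mult_minus_distrib_mat[of _ n n] minus_mult_distrib_mat[of _ n n])
  then have "{R * A * S - R * B * S |A B. A \<in> V \<and> B \<in> V} = {R * (A - B) * S |A B. A \<in> V \<and> B \<in> V}"
    by (intro Collect_cong) (metis (no_types, lifting))
  then show ?thesis unfolding direction_mat_def by blast
qed

definition shift :: "nat \<Rightarrow> (nat \<Rightarrow> real) \<Rightarrow> nat \<Rightarrow> real" where
  "shift m f = (\<lambda>i. f (i + m))"

definition unshift :: "nat \<Rightarrow> (nat \<Rightarrow> real) \<Rightarrow> nat \<Rightarrow> real" where
  "unshift m g = (\<lambda>i. if i < m then 0 else g (i - m))"

lemma linear_shift: "linear (shift m)"
  by (rule linearI) (auto simp: shift_def)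

lemma shift_unshift: "shift m (unshift m g) = g"
  by (simp add: shift_def unshift_def)

lemma shift_eq_0_iff: "shift m f = 0 \<longleftrightarrow> trunc m f = f"
  unfolding trunc_fixed_iff by (auto simp: shift_def fun_eq_iff) (metis le_add_diff_inverse2)

lemma trunc_shift: "trunc (m + k) f = f \<Longrightarrow> trunc k (shift m f) = shift m f"
  unfolding trunc_fixed_iff by (simp add: shift_def)

lemma trunc_unshift: "trunc k g = g \<Longrightarrow> trunc (m + k) (unshift m g) = unshift m g"
  unfolding trunc_fixed_iff by (simp add: unshift_def)

lemma trunc_add_fixed: "trunc m f = f \<Longrightarrow> trunc (m + k) f = f"
  unfolding trunc_fixed_iff by simp

lemma dim_shift_preimage:
  assumes T: "lin_subspace T" "T \<subseteq> range (trunc k)"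
  shows "dim {h \<in> range (trunc (m + k)). shift m h \<in> T} = m + dim T"
proof -
  let ?S = "{h \<in> range (trunc (m + k)). shift m h \<in> T}"
  interpret fin_projector "trunc (m + k)" by (rule fin_projector_trunc)
  have "lin_subspace ?S"
    using real_vector.subspace_inter[OF subspace_range
        real_vector.linear_subspace_linear_preimage[OF linear_shift T(1)]]
    by (simp add: Collect_conj_eq)
  then have "fin_dim ?S" by (rule fin_dim_subset(1)[OF fin_dim_range]) blast
  then have "dim ?S = dim (shift m ` ?S) + dim {h \<in> ?S. shift m h = 0}"
    by (rule rank_nullity[OF linear_shift])
  moreover have "shift m ` ?S = T"
  proof
    show "T \<subseteq> shift m ` ?S"
    proof
      fix g assume g: "g \<in> T"
      then have "trunc k g = g" using T(2) in_range_trunc_iff by blast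
      then have "unshift m g \<in> ?S"
        using g by (simp add: in_range_trunc_iff trunc_unshift shift_unshift)
      then show "g \<in> shift m ` ?S" by (rule rev_image_eqI) (simp add: shift_unshift)
    qed
  qed blast
  moreover have "{h \<in> ?S. shift m h = 0} = range (trunc m)"
    using real_vector.subspace_0[OF T(1)] trunc_add_fixed[of m _ k]
    unfolding shift_eq_0_iff in_range_trunc_iff set_eq_iff mem_Collect_eq
    by (metis shift_eq_0_iff)
  ultimately show ?thesis by (simp add: dim_range_trunc)
qed

lemma sum_lessThan_add: "(\<Sum>j<m + k. h j) = (\<Sum>j<m. h j) + (\<Sum>j<k. h (j + m))" for h :: "nat \<Rightarrow> real"
  by (induction k) (simp_all add: add.commute add.left_commute)

lemma mat_op_four_block:
  assumes "A \<in> carrier_mat m m" "B \<in> carrier_mat m k" "C \<in> carrier_mat k k"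
  shows "mat_op (m + k) (four_block_mat A B (0\<^sub>m k m) C) f = (\<lambda>i. if i < m
    then mat_op m A f i + (\<Sum>j<k. B $$ (i, j) * shift m f j) else mat_op k C (shift m f) (i - m))"
proof
  fix i
  let ?Z = "four_block_mat A B (0\<^sub>m k m) C"
  have "mat_op (m + k) ?Z f i = (\<Sum>j<m. ?Z $$ (i, j) * f j) + (\<Sum>j<k. ?Z $$ (i, j + m) * shift m f j)"
    if "i < m + k"
    using that by (simp add: mat_op_def shift_def sum_lessThan_add)
  moreover have "?Z $$ (i, j) = (if i < m then A $$ (i, j) else 0)" if "i < m + k" "j < m" for j
    using assms that by auto
  moreover have "?Z $$ (i, j + m) = (if i < m then B $$ (i, j) else C $$ (i - m, j))"
    if "i < m + k" "j < k" for j
    using assms that by auto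
  ultimately show "mat_op (m + k) ?Z f i = (if i < m
      then mat_op m A f i + (\<Sum>j<k. B $$ (i, j) * shift m f j) else mat_op k C (shift m f) (i - m))"
    by (cases "i < m + k") (auto simp: mat_op_def)
qed

lemma orbit_join_head:
  assumes X: "mat_subspace m X" and Y: "mat_subspace k Y" and f: "trunc m f = f"
  shows "orbit (mat_op (m + k) ` join_mats m k X Y) f = orbit (mat_op m ` X) f"
proof -
  have head: "mat_op (m + k) (four_block_mat A B (0\<^sub>m k m) C) f = mat_op m A f"
    if "A \<in> X" "B \<in> carrier_mat m k" "C \<in> Y" for A B C
  proof -
    have "A \<in> carrier_mat m m" "C \<in> carrier_mat k k"
      using that mat_subspaceD(1)[OF X] mat_subspaceD(1)[OF Y] by blast+
    moreover have shift: "shift m f = 0" using f by (simp add: shift_eq_0_iff)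
    ultimately have "mat_op (m + k) (four_block_mat A B (0\<^sub>m k m) C) f =
      (\<lambda>i. if i < m then mat_op m A f i else 0)"
      using that(2) by (simp add: mat_op_four_block shift linear_0[OF linear_mat_op] fun_eq_iff)
    then show ?thesis by (simp add: fun_eq_iff mat_op_def)
  qed
  show ?thesis
  proof
    show "orbit (mat_op (m + k) ` join_mats m k X Y) f \<subseteq> orbit (mat_op m ` X) f"
      unfolding orbit_mat_op join_mats_def using head by auto
    show "orbit (mat_op m ` X) f \<subseteq> orbit (mat_op (m + k) ` join_mats m k X Y) f"
      unfolding orbit_mat_op
    proof (rule image_subsetI)
      fix A assume A: "A \<in> X"
      have "four_block_mat A (0\<^sub>m m k) (0\<^sub>m k m) (0\<^sub>m k k) \<in> join_mats m k X Y"
        unfolding join_mats_def using A mat_subspaceD(2)[OF Y] zero_carrier_mat by blast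
      then show "mat_op m A f \<in> (\<lambda>Z. mat_op (m + k) Z f) ` join_mats m k X Y"
        by (rule rev_image_eqI) (simp add: head A mat_subspaceD(2)[OF Y])
    qed
  qed
qed

lemma ex_mat_with_image:
  assumes g: "trunc k g = g" "g \<noteq> 0"
  shows "\<exists>B\<in>carrier_mat m k. \<forall>i<m. (\<Sum>j<k. B $$ (i, j) * g j) = h i"
proof -
  obtain l where l: "g l \<noteq> 0" using g(2) by (auto simp: fun_eq_iff)
  then have "l < k" using g(1) unfolding trunc_fixed_iff by (meson not_less)
  define B where "B = mat m k (\<lambda>(i, j). if j = l then h i / g l else 0)"
  have "(\<Sum>j<k. B $$ (i, j) * g j) = h i" if "i < m" for i
  proof -
    have "(\<Sum>j<k. B $$ (i, j) * g j) = (\<Sum>j<k. if j = l then h i else 0)"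
      using that l by (intro sum.cong refl) (auto simp: B_def)
    then show ?thesis using \<open>l < k\<close> by simp
  qed
  moreover have "B \<in> carrier_mat m k" by (simp add: B_def)
  ultimately show ?thesis by blast
qed

lemma orbit_join_tail:
  assumes X: "mat_subspace m X" and Y: "mat_subspace k Y"
    and f: "trunc (m + k) f = f" "shift m f \<noteq> 0"
  shows "orbit (mat_op (m + k) ` join_mats m k X Y) f =
    {h \<in> range (trunc (m + k)). shift m h \<in> orbit (mat_op k ` Y) (shift m f)}"
proof
  let ?S = "{h \<in> range (trunc (m + k)). shift m h \<in> orbit (mat_op k ` Y) (shift m f)}"
  have Y_carrier: "C \<in> carrier_mat k k" if "C \<in> Y" for C using that mat_subspaceD(1)[OF Y] by blast
  show "orbit (mat_op (m + k) ` join_mats m k X Y) f \<subseteq> ?S"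
    unfolding orbit_mat_op[of "m + k"]
  proof (rule image_subsetI)
    fix Z assume "Z \<in> join_mats m k X Y"
    then obtain A B C where Z: "Z = four_block_mat A B (0\<^sub>m k m) C"
      and A: "A \<in> X" and B: "B \<in> carrier_mat m k" and C: "C \<in> Y"
      unfolding join_mats_def by blast
    have "A \<in> carrier_mat m m" using A mat_subspaceD(1)[OF X] by blast
    then have "shift m (mat_op (m + k) Z f) = mat_op k C (shift m f)"
      using B Y_carrier[OF C] by (simp add: Z mat_op_four_block shift_def)
    then show "mat_op (m + k) Z f \<in> ?S"
      using C by (simp add: in_range_trunc_iff trunc_mat_op orbit_mat_op)
  qed
  show "?S \<subseteq> orbit (mat_op (m + k) ` join_mats m k X Y) f"
  proof
    fix h assume h: "h \<in> ?S"
    then obtain C where C: "shift m h = mat_op k C (shift m f)" "C \<in> Y"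
      unfolding orbit_mat_op by blast
    obtain B where B: "B \<in> carrier_mat m k" "\<forall>i<m. (\<Sum>j<k. B $$ (i, j) * shift m f j) = h i"
      using ex_mat_with_image[OF trunc_shift[OF f(1)] f(2), of m h] by blast
    have "four_block_mat (0\<^sub>m m m) B (0\<^sub>m k m) C \<in> join_mats m k X Y"
      unfolding join_mats_def using mat_subspaceD(2)[OF X] B(1) C(2) by blast
    moreover have "h = mat_op (m + k) (four_block_mat (0\<^sub>m m m) B (0\<^sub>m k m) C) f"
    proof
      fix i
      have "h i = mat_op k C (shift m f) (i - m)" if "\<not> i < m"
        using fun_cong[OF C(1), of "i - m"] that by (simp add: shift_def)
      then show "h i = mat_op (m + k) (four_block_mat (0\<^sub>m m m) B (0\<^sub>m k m) C) f i"
        using B Y_carrier[OF C(2)] by (simp add: mat_op_four_block mat_op_zero)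
    qed
    ultimately show "h \<in> orbit (mat_op (m + k) ` join_mats m k X Y) f"
      unfolding orbit_mat_op by (intro image_eqI)
  qed
qed

lemma orbit_dims_join_tail:
  assumes X: "mat_subspace m X" and Y: "mat_subspace k Y"
  shows "{dim (orbit (mat_op (m + k) ` join_mats m k X Y) f) |f.
      trunc (m + k) f = f \<and> shift m f \<noteq> 0} =
    (+) m ` orbit_dims (trunc k) (mat_op k ` Y)" (is "?L = ?T")
proof
  have dim_orbit: "dim (orbit (mat_op (m + k) ` join_mats m k X Y) f) =
      m + dim (orbit (mat_op k ` Y) (shift m f))"
    if "trunc (m + k) f = f" "shift m f \<noteq> 0" for f
    unfolding orbit_join_tail[OF X Y that]
    by (rule dim_shift_preimage[OF subspace_orbit_mat_op[OF Y] orbit_mat_op_subset])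
  show "?L \<subseteq> ?T"
    unfolding orbit_dims_def using dim_orbit trunc_shift by fastforce
  show "?T \<subseteq> ?L"
  proof
    fix d assume "d \<in> ?T"
    then obtain g where g: "trunc k g = g" "g \<noteq> 0" and d: "d = m + dim (orbit (mat_op k ` Y) g)"
      unfolding orbit_dims_def by blast
    have "trunc (m + k) (unshift m g) = unshift m g" "shift m (unshift m g) \<noteq> 0"
      using g by (simp_all add: shift_unshift trunc_unshift)
    moreover from this have "d = dim (orbit (mat_op (m + k) ` join_mats m k X Y) (unshift m g))"
      by (simp add: dim_orbit d shift_unshift)
    ultimately show "d \<in> ?L" by blast
  qed
qed

lemma orbit_dims_join:
  assumes X: "mat_subspace m X" and Y: "mat_subspace k Y"
  shows "orbit_dims (trunc (m + k)) (mat_op (m + k) ` join_mats m k X Y) =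
    orbit_dims (trunc m) (mat_op m ` X) \<union> (+) m ` orbit_dims (trunc k) (mat_op k ` Y)"
proof -
  let ?dim = "\<lambda>f. dim (orbit (mat_op (m + k) ` join_mats m k X Y) f)"
  have "trunc (m + k) f = f \<and> f \<noteq> 0 \<longleftrightarrow>
      (trunc m f = f \<and> f \<noteq> 0) \<or> (trunc (m + k) f = f \<and> shift m f \<noteq> 0)" for f
    using trunc_add_fixed[of m f k] linear_0[OF linear_shift, of m] shift_eq_0_iff[of m f] by auto
  then have "orbit_dims (trunc (m + k)) (mat_op (m + k) ` join_mats m k X Y) =
      {?dim f |f. trunc m f = f \<and> f \<noteq> 0} \<union> {?dim f |f. trunc (m + k) f = f \<and> shift m f \<noteq> 0}"
    unfolding orbit_dims_def by blast
  also have "{?dim f |f. trunc m f = f \<and> f \<noteq> 0} = orbit_dims (trunc m) (mat_op m ` X)"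
    unfolding orbit_dims_def using orbit_join_head[OF X Y] by (intro Collect_cong) metis
  finally show ?thesis unfolding orbit_dims_join_tail[OF X Y] .
qed

definition dot :: "nat \<Rightarrow> (nat \<Rightarrow> real) \<Rightarrow> (nat \<Rightarrow> real) \<Rightarrow> real" where
  "dot n f g = (\<Sum>i<n. f i * g i)"

lemma bilinear_dot: "bilinear (dot n)"
  unfolding bilinear_def dot_def
  by (auto intro!: linearI simp: algebra_simps sum.distrib sum_distrib_left)

lemma definite_dot: "definite_on (trunc n) (dot n)"
  unfolding definite_on_def
proof (intro allI impI)
  fix f assume f: "trunc n f = f" "dot n f f = 0"
  then have "\<forall>i\<in>{..<n}. f i * f i = 0" unfolding dot_def by (subst (asm) sum_nonneg_eq_0_iff) auto
  then have "f i = 0" for i using f(1) unfolding trunc_fixed_iff by (cases "i < n") auto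
  then show "f = 0" by (simp add: fun_eq_iff)
qed

lemma dot_unit_seq: "i < n \<Longrightarrow> dot n (unit_seq i) f = f i"
proof -
  assume i: "i < n"
  have "dot n (unit_seq i) f = (\<Sum>j<n. if j = i then f i else 0)"
    unfolding dot_def by (intro sum.cong) (auto simp: unit_seq_def)
  then show ?thesis using i by simp
qed

lemma mat_op_skew_mats: "mat_op n ` skew_mats n = skew_ops (trunc n) (dot n)"
proof
  show "mat_op n ` skew_mats n \<subseteq> skew_ops (trunc n) (dot n)"
  proof (intro image_subsetI skew_opsI mat_op_in_homs)
    fix A f assume "A \<in> skew_mats n"
    then have "(\<Sum>i<n. \<Sum>j<n. f i * f j * A $$ (i, j)) = 0" by (intro sum_skew_eq_0 skew_mats_entry)
    then show "dot n f (mat_op n A f) = 0"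
      by (simp add: dot_def mat_op_def sum_distrib_left mult_ac)
  qed
  show "skew_ops (trunc n) (dot n) \<subseteq> mat_op n ` skew_mats n"
  proof
    fix M assume M: "M \<in> skew_ops (trunc n) (dot n)"
    note homs = skew_opsD(1)[OF M]
    have "mat_of_op n M \<in> skew_mats n"
    proof (rule skew_matsI)
      fix i j assume ij: "i < n" "j < n"
      note unit = trunc_unit_seq[OF ij(1)] trunc_unit_seq[OF ij(2)]
      have "trunc n (unit_seq i + unit_seq j) = unit_seq i + unit_seq j"
        by (simp only: linear_add[OF linear_trunc] unit)
      then have "dot n (unit_seq i + unit_seq j) (M (unit_seq i + unit_seq j)) = 0"
        by (rule skew_opsD(2)[OF M])
      then have "dot n (unit_seq j) (M (unit_seq i)) = - dot n (unit_seq i) (M (unit_seq j))"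
        unfolding linear_add[OF homs_linear[OF homs]] bilinear_simps[OF bilinear_dot]
        using skew_opsD(2)[OF M unit(1)] skew_opsD(2)[OF M unit(2)] by linarith
      then show "mat_of_op n M $$ (j, i) = - mat_of_op n M $$ (i, j)"
        using ij by (simp add: mat_of_op_def dot_unit_seq)
    qed (simp add: mat_of_op_def)
    then show "M \<in> mat_op n ` skew_mats n"
      by (rule rev_image_eqI) (simp add: mat_op_mat_of_op[OF homs])
  qed
qed

lemma orbit_dims_skew_mats:
  assumes "0 < n"
  shows "orbit_dims (trunc n) (mat_op n ` skew_mats n) = {n - 1}"
proof -
  have dim: "dim (orbit (mat_op n ` skew_mats n) f) = n - 1" if f: "trunc n f = f" "f \<noteq> 0" for f
  proof -
    have "dot n f f \<noteq> 0" using definite_dot f unfolding definite_on_def by blast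
    moreover have "linear (dot n f)" using bilinear_dot by (simp add: bilinear_def)
    ultimately have "dim (range (trunc n)) = Suc (dim {g \<in> range (trunc n). dot n f g = 0})"
      using f(1) by (intro dim_functional_kernel[OF _ fin_dim_range_trunc])
        (auto simp: in_range_trunc_iff)
    then show ?thesis
      unfolding mat_op_skew_mats
        orbit_skew_ops[OF fin_projector_trunc bilinear_dot definite_dot f] dim_range_trunc by simp
  qed
  have "unit_seq 0 \<noteq> 0" by (simp add: unit_seq_def fun_eq_iff)
  then have "n - 1 \<in> orbit_dims (trunc n) (mat_op n ` skew_mats n)"
    unfolding orbit_dims_def using dim[of "unit_seq 0"] trunc_unit_seq[OF assms] by force
  then show ?thesis using dim unfolding orbit_dims_def by blast
qed

text \<open>The numbers \<open>n\<^sub>1 + \<dots> + n\<^sub>k - 1\<close>.\<close>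

fun levels :: "nat list \<Rightarrow> nat set" where
  "levels [] = {}"
| "levels (m # ms) = insert (m - 1) ((+) m ` levels ms)"

lemma levels_inject:
  assumes "\<forall>m\<in>set ns. 0 < m" "\<forall>m\<in>set ns'. 0 < m" "levels ns = levels ns'"
  shows "ns = ns'"
  using assms
proof (induction ns arbitrary: ns')
  case Nil
  then show ?case by (cases ns') auto
next
  case (Cons m ms)
  then obtain m' ms' where ns': "ns' = m' # ms'" by (cases ns') auto
  have pos: "0 < m" "0 < m'" using Cons.prems ns' by auto
  have eq: "insert (m - 1) ((+) m ` levels ms) = insert (m' - 1) ((+) m' ` levels ms')"
    using Cons.prems(3) ns' by simp
  then have "m - 1 \<in> insert (m' - 1) ((+) m' ` levels ms')"
    "m' - 1 \<in> insert (m - 1) ((+) m ` levels ms)"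
    by blast+
  then have m: "m = m'" using pos by auto
  have "m - 1 \<notin> (+) m ` levels ms" "m - 1 \<notin> (+) m ` levels ms'" using pos by auto
  then have "(+) m ` levels ms = (+) m ` levels ms'" using eq m by (metis insert_ident)
  then have "levels ms = levels ms'" by (simp add: inj_image_eq_iff)
  then have "ms = ms'" using Cons.IH[of ms'] Cons.prems ns' by simp
  then show ?case using m ns' by simp
qed

lemma orbit_dims_skew_join:
  assumes "\<forall>m\<in>set ns. 0 < m"
  shows "orbit_dims (trunc (sum_list ns)) (mat_op (sum_list ns) ` skew_join ns) = levels ns"
  using assms
proof (induction ns)
  case Nil
  have "f = 0" if "trunc 0 f = f" for f using that by (auto simp: trunc_fixed_iff)
  then show ?case unfolding orbit_dims_def by auto
next
  case (Cons m ms)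
  then show ?case
    using orbit_dims_join[OF mat_subspace_skew_mats mat_subspace_skew_join, of m ms]
    by (simp add: orbit_dims_skew_mats)
qed

theorem orbit_dims_direction_if_equiv:
  assumes "affine_subspace_mat n V" and pos: "\<forall>m\<in>set ns. 0 < m" and n: "n = sum_list ns"
    and equiv: "equiv_mats n V (translate_mat (1\<^sub>m n) (skew_join ns))"
  shows "orbit_dims (trunc n) (mat_op n ` direction_mat V) = levels ns"
proof -
  obtain P W where P: "P \<in> carrier_mat n n" and W: "mat_subspace n W" and V: "V = translate_mat P W"
    using assms(1) unfolding affine_subspace_mat_def by blast
  obtain R S where R: "R \<in> GL n" and S: "S \<in> GL n"
    and eq: "translate_mat (1\<^sub>m n) (skew_join ns) = {R * M * S |M. M \<in> V}"
    using equiv unfolding equiv_mats_def by blast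
  have direction: "direction_mat V = W" unfolding V by (rule direction_translate_mat[OF P W])
  have J: "mat_subspace n (skew_join ns)" unfolding n by (rule mat_subspace_skew_join)
  have "V \<subseteq> carrier_mat n n" using P mat_subspaceD(1)[OF W] by (auto simp: V translate_mat_def)
  then have "{R * D * S |D. D \<in> W} = direction_mat (translate_mat (1\<^sub>m n) (skew_join ns))"
    unfolding eq direction[symmetric] using R S
    by (intro direction_mat_mult[symmetric]) (auto simp: GL_def)
  also have "\<dots> = skew_join ns" by (rule direction_translate_mat[OF one_carrier_mat J])
  finally have "skew_join ns = {R * D * S |D. D \<in> W}" ..
  then have "orbit_dims (trunc n) (mat_op n ` skew_join ns) = orbit_dims (trunc n) (mat_op n ` W)"
    by (rule orbit_dims_mult[OF W J R S])
  then show ?thesis using orbit_dims_skew_join[OF pos] by (simp add: direction n)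
qed

theorem corollary8:
  fixes n :: nat and V :: "real mat set"
  assumes "affine_subspace_mat n V"
    and "V \<subseteq> GL n"
    and "affine_dim_mat n V = n choose 2"
  shows "\<exists>!ns. (\<forall>m \<in> set ns. 0 < m) \<and> n = sum_list ns \<and>
           equiv_mats n V (translate_mat (1\<^sub>m n) (skew_join ns))"
proof (rule ex_ex1I)
  show "\<exists>ns. (\<forall>m \<in> set ns. 0 < m) \<and> n = sum_list ns \<and>
          equiv_mats n V (translate_mat (1\<^sub>m n) (skew_join ns))"
    by (rule ex_skew_join_equiv[OF assms])
next
  fix ns ns'
  assume ns: "(\<forall>m \<in> set ns. 0 < m) \<and> n = sum_list ns \<and>
               equiv_mats n V (translate_mat (1\<^sub>m n) (skew_join ns))"
    and ns': "(\<forall>m \<in> set ns'. 0 < m) \<and> n = sum_list ns' \<and>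
      equiv_mats n V (translate_mat (1\<^sub>m n) (skew_join ns'))"
  note orbit_dims = orbit_dims_direction_if_equiv[OF assms(1)]
  have "levels ns = levels ns'"
    using orbit_dims[of ns] orbit_dims[of ns'] ns ns' by (elim conjE) simp
  then show "ns = ns'" using ns ns' by (intro levels_inject) simp_all
qed

end
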